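(* Let $X$ be a finite-dimensional Hilbert space, let $A$ be a linear operator on $X$ with $\|e^{tA}\|\le\nu e^{-\omega t}$ ($t\ge0$) for some $\omega>0$, $\nu\ge1$, let $B:\mathbb R^m\to X$, $K:\mathbb R^d\to X$, $C:X\to\mathcal H$ be linear with the pair $(A,C)$ observable, let $R$ be a symmetric positive-definite $m\times m$ matrix, and let $Z^{\operatorname{ou}}$ be the controlled Ornstein-Uhlenbeck process $\mathrm dZ^{\operatorname{ou}}_t=AZ^{\operatorname{ou}}_t\,\mathrm dt+Bu_t\,\mathrm dt+K\,\mathrm dW_t$, $Z^{\operatorname{ou}}_0=\xi$, with $(W_t)$ a standard $d$-dimensional Wiener process. The solution to the optimal control problem of minimizing $$J^{\operatorname{ou}}_{\operatorname{LQR}}(CZ^{\operatorname{ou}},u,\infty)=\limsup_{T\to\infty}\frac1T\left(\|CZ^{\operatorname{ou}}\|^2_{L^2(\Omega_T)}+\langle u,Ru\rangle_{L^2(\Omega_T)}\right)$$ is given by the fixed-point equation (as $Z^{\operatorname{ou}}$ itself depends on $u$) $$u_P(t)=-R^{-1}B^*PZ^{\operatorname{ou}}_t,$$ where $P$ is the unique positive-definite solution of the Riccati equation $A^*P+PA+C^*C-PBR^{-1}B^*P=0$. Define $L_0:=0$, $L_k:=R^{-1}B^*P_{k-1}$ for $k\ge1$ and $A_k:=A-BL_k$ for $k\ge0$, where $P_k\ge0$ is the unique solution of the Lyapunov equation $$A_k^*P_k+P_kA_k+C^*C+L_k^*RL_k=0 .$$ Then the matrices $P_k$ converge quadratically and monotonically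 (in the sense of operators) to $P$. The control functions $$u_{P_k}(t)=-R^{-1}B^*P_kZ^{\operatorname{ou}}_t$$ satisfy, for $\|P-P_k\|$ sufficiently small and uniformly in the final time parameter $T$, $$T^{-1/2}\|u_P-u_{P_k}\|_{L^2(\Omega_T)}=\mathcal O\left(\|P_k-P_{k-1}\|^2\right).$$
   Context: $(\Omega,\mathcal F,\mathbb P)$ is a fixed probability space, $\mathcal H$ a (real) Hilbert space, $\xi\in L^2(\Omega,\mathcal F_0,X)$, and controls are adapted processes $u$ with values in $\mathbb R^m$ that are in $L^2(\Omega_T)$ for every finite $T$, where $\Omega_T=\Omega\times(0,T)$, $\langle f,g\rangle_{L^2(\Omega_T)}=\mathbb E\int_0^T\langle f(t),g(t)\rangle\,\mathrm dt$ and $\|\cdot\|_{L^2(\Omega_T)}$ is the associated norm. The feedback controls are closed-loop: in $u_P(t)=-R^{-1}B^*PZ_t$ the process $Z$ solves $\mathrm dZ_t=(A-BR^{-1}B^*P)Z_t\,\mathrm dt+K\,\mathrm dW_t$, $Z_0=\xi$, and in $u_{P_k}(t)=-R^{-1}B^*P_kZ_t$ the process $Z$ solves $\mathrm dZ_t=(A-BR^{-1}B^*P_k)Z_t\,\mathrm dt+K\,\mathrm dW_t$, $Z_0=\xi$ (same Wiener process and initial state). $g=\mathcal O(f)$ means there is a constant $c>0$ (here independent of $k$ and $T$) with $\|g\|\le c\|f\|$. *)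

theory Defs
  imports "HOL-Probability.Probability"
begin

section \<open>Operators\<close>

text \<open>
  Linear maps out of a finite-dimensional space are bounded, so they are represented by the
  type \<open>\<Rightarrow>\<^sub>L\<close>, whose norm is the operator norm.  Note that \<open>o\<^sub>L\<close> binds more weakly than \<open>+\<close>
  and \<open>-\<close>.
\<close>

definition adj :: "('a::real_inner \<Rightarrow>\<^sub>L 'b::real_inner) \<Rightarrow> ('b \<Rightarrow>\<^sub>L 'a)" where
  "adj S = Blinfun (adjoint (blinfun_apply S))"

definition matrix_op :: "real^'n^'n \<Rightarrow> (real^'n) \<Rightarrow>\<^sub>L (real^'n)" where
  "matrix_op R = Blinfun (\<lambda>v. R *v v)"

definition symmetric_pos_def_matrix :: "real^'n^'n \<Rightarrow> bool" where
  "symmetric_pos_def_matrix R \<longleftrightarrow> transpose R = R \<and> (\<forall>v. v \<noteq> 0 \<longrightarrow> 0 < v \<bullet> (R *v v))"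

definition pos_semidef :: "('a::real_inner \<Rightarrow>\<^sub>L 'a) \<Rightarrow> bool" where
  "pos_semidef P \<longleftrightarrow> adj P = P \<and> (\<forall>x. 0 \<le> x \<bullet> P x)"

definition pos_def :: "('a::real_inner \<Rightarrow>\<^sub>L 'a) \<Rightarrow> bool" where
  "pos_def P \<longleftrightarrow> adj P = P \<and> (\<forall>x. x \<noteq> 0 \<longrightarrow> 0 < x \<bullet> P x)"

definition op_le :: "('a::real_inner \<Rightarrow>\<^sub>L 'a) \<Rightarrow> ('a \<Rightarrow>\<^sub>L 'a) \<Rightarrow> bool" where
  "op_le P Q \<longleftrightarrow> pos_semidef (Q - P)"

text \<open>
  The exponential \<open>e\<^sup>S\<close>, as a norm-convergent series; the library's \<open>exp\<close> is unavailable because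
  \<open>\<Rightarrow>\<^sub>L\<close> is not an instance of the class of normed algebras.
\<close>

definition op_exp :: "('a::banach \<Rightarrow>\<^sub>L 'a) \<Rightarrow> ('a \<Rightarrow>\<^sub>L 'a)" where
  "op_exp S = (\<Sum>n. (1 / fact n) *\<^sub>R (((\<lambda>Q. S o\<^sub>L Q) ^^ n) id_blinfun))"

text \<open>
  Observability of \<open>(A, C)\<close>: initial states of \<open>x' = A x\<close> producing the same output \<open>C x\<close> on
  \<open>[0, \<infinity>)\<close> are equal.
\<close>

definition observable :: "('x::banach \<Rightarrow>\<^sub>L 'x) \<Rightarrow> ('x \<Rightarrow>\<^sub>L 'h::real_normed_vector) \<Rightarrow> bool" where
  "observable A C \<longleftrightarrow>
     (\<forall>x y. (\<forall>t\<ge>0. C (op_exp (t *\<^sub>R A) x) = C (op_exp (t *\<^sub>R A) y)) \<longrightarrow> x = y)"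


section \<open>Riccati and Lyapunov equations\<close>

definition gain ::
  "((real^'m) \<Rightarrow>\<^sub>L 'x::euclidean_space) \<Rightarrow> real^'m^'m \<Rightarrow> ('x \<Rightarrow>\<^sub>L 'x) \<Rightarrow> ('x \<Rightarrow>\<^sub>L (real^'m))" where
  "gain B R P = (matrix_op (matrix_inv R) o\<^sub>L adj B o\<^sub>L P)"

definition riccati ::
  "('x::euclidean_space \<Rightarrow>\<^sub>L 'x) \<Rightarrow> ((real^'m) \<Rightarrow>\<^sub>L 'x) \<Rightarrow> ('x \<Rightarrow>\<^sub>L 'h::real_inner)
    \<Rightarrow> real^'m^'m \<Rightarrow> ('x \<Rightarrow>\<^sub>L 'x) \<Rightarrow> bool" where
  "riccati A B C R P \<longleftrightarrow>
     (adj A o\<^sub>L P) + (P o\<^sub>L A) + (adj C o\<^sub>L C)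
       - (P o\<^sub>L B o\<^sub>L matrix_op (matrix_inv R) o\<^sub>L adj B o\<^sub>L P) = 0"

definition lyapunov ::
  "('x::euclidean_space \<Rightarrow>\<^sub>L 'x) \<Rightarrow> ((real^'m) \<Rightarrow>\<^sub>L 'x) \<Rightarrow> ('x \<Rightarrow>\<^sub>L 'h::real_inner)
    \<Rightarrow> real^'m^'m \<Rightarrow> ('x \<Rightarrow>\<^sub>L (real^'m)) \<Rightarrow> ('x \<Rightarrow>\<^sub>L 'x) \<Rightarrow> bool" where
  "lyapunov A B C R L P \<longleftrightarrow>
     (let A\<^sub>L = A - (B o\<^sub>L L) in
        (adj A\<^sub>L o\<^sub>L P) + (P o\<^sub>L A\<^sub>L) + (adj C o\<^sub>L C) + (adj L o\<^sub>L matrix_op R o\<^sub>L L) = 0)"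

definition lyapunov_sol ::
  "('x::euclidean_space \<Rightarrow>\<^sub>L 'x) \<Rightarrow> ((real^'m) \<Rightarrow>\<^sub>L 'x) \<Rightarrow> ('x \<Rightarrow>\<^sub>L 'h::real_inner)
    \<Rightarrow> real^'m^'m \<Rightarrow> ('x \<Rightarrow>\<^sub>L (real^'m)) \<Rightarrow> ('x \<Rightarrow>\<^sub>L 'x)" where
  "lyapunov_sol A B C R L = (THE P. pos_semidef P \<and> lyapunov A B C R L P)"

primrec L_seq ::
  "('x::euclidean_space \<Rightarrow>\<^sub>L 'x) \<Rightarrow> ((real^'m) \<Rightarrow>\<^sub>L 'x) \<Rightarrow> ('x \<Rightarrow>\<^sub>L 'h::real_inner)
    \<Rightarrow> real^'m^'m \<Rightarrow> nat \<Rightarrow> ('x \<Rightarrow>\<^sub>L (real^'m))" where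
  "L_seq A B C R 0 = 0"
| "L_seq A B C R (Suc k) = gain B R (lyapunov_sol A B C R (L_seq A B C R k))"

definition P_seq ::
  "('x::euclidean_space \<Rightarrow>\<^sub>L 'x) \<Rightarrow> ((real^'m) \<Rightarrow>\<^sub>L 'x) \<Rightarrow> ('x \<Rightarrow>\<^sub>L 'h::real_inner)
    \<Rightarrow> real^'m^'m \<Rightarrow> nat \<Rightarrow> ('x \<Rightarrow>\<^sub>L 'x)" where
  "P_seq A B C R k = lyapunov_sol A B C R (L_seq A B C R k)"


section \<open>Stochastic processes\<close>

text \<open>
  Processes are functions of a time \<open>t :: real\<close> and a sample point; only times \<open>t \<ge> 0\<close> matter.
  Neither completeness nor right-continuity of the filtration is required, so almost sure path
  continuity does not give measurability in \<open>(\<omega>, t)\<close>; it is required separately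
  (\<open>jointly_measurable\<close>) where processes are integrated over \<open>\<Omega> \<times> (0, T)\<close>.
\<close>

definition filtration_on :: "'w measure \<Rightarrow> (real \<Rightarrow> 'w measure) \<Rightarrow> bool" where
  "filtration_on M F \<longleftrightarrow> filtration (space M) F \<and> (\<forall>t. subalgebra M (F t))"

definition wiener_process ::
  "'w measure \<Rightarrow> (real \<Rightarrow> 'w measure) \<Rightarrow> (real \<Rightarrow> 'w \<Rightarrow> real^'d) \<Rightarrow> bool" where
  "wiener_process M F W \<longleftrightarrow>
     (\<forall>t\<ge>0. W t \<in> borel_measurable (F t)) \<and>
     (AE \<omega> in M. W 0 \<omega> = 0) \<and>
     (AE \<omega> in M. continuous_on {0..} (\<lambda>t. W t \<omega>)) \<and>
     (\<forall>s t. 0 \<le> s \<and> s < t \<longrightarrow>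
        prob_space.indep_vars M (\<lambda>_. borel) (\<lambda>i \<omega>. (W t \<omega> - W s \<omega>) $ i) UNIV \<and>
        (\<forall>i. distributed M lborel (\<lambda>\<omega>. (W t \<omega> - W s \<omega>) $ i) (normal_density 0 (sqrt (t - s)))) \<and>
        prob_space.indep_set M (sets (F s))
          (sets (vimage_algebra (space M) (\<lambda>\<omega>. W t \<omega> - W s \<omega>) borel)))"

definition Omega_T :: "'w measure \<Rightarrow> real \<Rightarrow> ('w \<times> real) measure" where
  "Omega_T M T = M \<Otimes>\<^sub>M restrict_space lborel {0<..<T}"

definition L2_inner ::
  "'w measure \<Rightarrow> real \<Rightarrow> (real \<Rightarrow> 'w \<Rightarrow> 'v::real_inner) \<Rightarrow> (real \<Rightarrow> 'w \<Rightarrow> 'v) \<Rightarrow> real" where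
  "L2_inner M T f g = (LINT \<omega>|M. (LINT t:{0<..<T}|lborel. f t \<omega> \<bullet> g t \<omega>))"

definition L2_norm :: "'w measure \<Rightarrow> real \<Rightarrow> (real \<Rightarrow> 'w \<Rightarrow> 'v::real_inner) \<Rightarrow> real" where
  "L2_norm M T f = sqrt (L2_inner M T f f)"

definition adapted ::
  "(real \<Rightarrow> 'w measure) \<Rightarrow> (real \<Rightarrow> 'w \<Rightarrow> 'v::topological_space) \<Rightarrow> bool" where
  "adapted F Y \<longleftrightarrow> (\<forall>t\<ge>0. Y t \<in> borel_measurable (F t))"

definition jointly_measurable ::
  "'w measure \<Rightarrow> (real \<Rightarrow> 'w \<Rightarrow> 'v::topological_space) \<Rightarrow> bool" where
  "jointly_measurable M Y \<longleftrightarrow> (\<forall>T>0. (\<lambda>(\<omega>, t). Y t \<omega>) \<in> borel_measurable (Omega_T M T))"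

definition admissible_control ::
  "'w measure \<Rightarrow> (real \<Rightarrow> 'w measure) \<Rightarrow> (real \<Rightarrow> 'w \<Rightarrow> real^'m) \<Rightarrow> bool" where
  "admissible_control M F u \<longleftrightarrow> adapted F u \<and> jointly_measurable M u \<and>
     (\<forall>T>0. integrable (Omega_T M T) (\<lambda>(\<omega>, t). (norm (u t \<omega>))\<^sup>2))"

text \<open>
  \<open>dZ = (A Z + B u) dt + K dW\<close>, \<open>Z\<^sub>0 = \<xi>\<close>, in integrated form.  As \<open>K\<close> is constant and
  \<open>W\<^sub>0 = 0\<close>, the Ito integral of \<open>K\<close> over \<open>[0, t]\<close> is \<open>K W\<^sub>t\<close>.
\<close>

definition ou_process ::
  "'w measure \<Rightarrow> (real \<Rightarrow> 'w measure) \<Rightarrow> (real \<Rightarrow> 'w \<Rightarrow> real^'d) \<Rightarrow> ('w \<Rightarrow> 'x::euclidean_space)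
    \<Rightarrow> ('x \<Rightarrow>\<^sub>L 'x) \<Rightarrow> ((real^'m) \<Rightarrow>\<^sub>L 'x) \<Rightarrow> ((real^'d) \<Rightarrow>\<^sub>L 'x)
    \<Rightarrow> (real \<Rightarrow> 'w \<Rightarrow> real^'m) \<Rightarrow> (real \<Rightarrow> 'w \<Rightarrow> 'x) \<Rightarrow> bool" where
  "ou_process M F W \<xi> A B K u Z \<longleftrightarrow>
     adapted F Z \<and> jointly_measurable M Z \<and>
     (AE \<omega> in M. continuous_on {0..} (\<lambda>t. Z t \<omega>)) \<and>
     (AE \<omega> in M. \<forall>t\<ge>0.
        set_integrable lborel {0..t} (\<lambda>s. A (Z s \<omega>) + B (u s \<omega>)) \<and>
        Z t \<omega> = \<xi> \<omega> + (LINT s:{0..t}|lborel. A (Z s \<omega>) + B (u s \<omega>)) + K (W t \<omega>))"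

definition closed_loop ::
  "'w measure \<Rightarrow> (real \<Rightarrow> 'w measure) \<Rightarrow> (real \<Rightarrow> 'w \<Rightarrow> real^'d) \<Rightarrow> ('w \<Rightarrow> 'x::euclidean_space)
    \<Rightarrow> ('x \<Rightarrow>\<^sub>L 'x) \<Rightarrow> ((real^'m) \<Rightarrow>\<^sub>L 'x) \<Rightarrow> ((real^'d) \<Rightarrow>\<^sub>L 'x)
    \<Rightarrow> ('x \<Rightarrow>\<^sub>L (real^'m)) \<Rightarrow> (real \<Rightarrow> 'w \<Rightarrow> 'x) \<Rightarrow> bool" where
  "closed_loop M F W \<xi> A B K L Z \<longleftrightarrow> ou_process M F W \<xi> (A - (B o\<^sub>L L)) B K (\<lambda>t \<omega>. 0) Z"

definition feedback :: "('x::euclidean_space \<Rightarrow>\<^sub>L (real^'m)) \<Rightarrow> (real \<Rightarrow> 'w \<Rightarrow> 'x)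
    \<Rightarrow> real \<Rightarrow> 'w \<Rightarrow> real^'m" where
  "feedback L Z t \<omega> = - L (Z t \<omega>)"


section \<open>The ergodic linear-quadratic control problem\<close>

definition J_LQR ::
  "'w measure \<Rightarrow> real^'m^'m \<Rightarrow> (real \<Rightarrow> 'w \<Rightarrow> 'h::real_inner) \<Rightarrow> (real \<Rightarrow> 'w \<Rightarrow> real^'m) \<Rightarrow> ereal" where
  "J_LQR M R Y u =
     Limsup at_top (\<lambda>T. ereal ((1 / T) * ((L2_norm M T Y)\<^sup>2 + L2_inner M T u (\<lambda>t \<omega>. R *v u t \<omega>))))"

definition optimal_control ::
  "'w measure \<Rightarrow> (real \<Rightarrow> 'w measure) \<Rightarrow> (real \<Rightarrow> 'w \<Rightarrow> real^'d) \<Rightarrow> ('w \<Rightarrow> 'x::euclidean_space)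
    \<Rightarrow> ('x \<Rightarrow>\<^sub>L 'x) \<Rightarrow> ((real^'m) \<Rightarrow>\<^sub>L 'x) \<Rightarrow> ((real^'d) \<Rightarrow>\<^sub>L 'x) \<Rightarrow> ('x \<Rightarrow>\<^sub>L 'h::real_inner)
    \<Rightarrow> real^'m^'m \<Rightarrow> (real \<Rightarrow> 'w \<Rightarrow> real^'m) \<Rightarrow> (real \<Rightarrow> 'w \<Rightarrow> 'x) \<Rightarrow> bool" where
  "optimal_control M F W \<xi> A B K C R u Z \<longleftrightarrow>
     admissible_control M F u \<and> ou_process M F W \<xi> A B K u Z \<and>
     (\<forall>u' Z'. admissible_control M F u' \<longrightarrow> ou_process M F W \<xi> A B K u' Z' \<longrightarrow>
        J_LQR M R (\<lambda>t \<omega>. C (Z t \<omega>)) u \<le> J_LQR M R (\<lambda>t \<omega>. C (Z' t \<omega>)) u')"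

end

theory Submission
  imports Defs
begin

text \<open>
  The matrix part rests on the Lyapunov operator \<open>X \<mapsto> S\<^sup>* X + X S\<close>.  If \<open>S\<close> is stable, then
  the form of \<open>X\<close> along the flow of \<open>S\<close> tends to \<open>0\<close>, and its derivative is the form of
  \<open>S\<^sup>* X + X S\<close>; hence the operator is bijective and reverses signs (\<open>lyapunov_positive\<close>,
  \<open>lyap_op_injective\<close>, \<open>lyapunov_solvable\<close>).  Conversely, a positive definite \<open>X\<close> satisfying a
  Lyapunov inequality whose right-hand side sees the output \<open>C\<close> forces stability, by observability
  (\<open>stable_of_lyapunov_inequality\<close>).  For fixed symmetric \<open>X\<close> the Lyapunov residual is quadratic in the gain
  and minimal at \<open>R\<^sup>-\<^sup>1 B\<^sup>* X\<close>, where it equals the Riccati residual (\<open>completing_the_square\<close>).  This single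
  identity shows that the iterates stay stabilising, decrease, and dominate every positive definite Riccati
  solution.  So they converge, the limit solves the Riccati equation, and it is the only positive
  definite solution.  The same identity expresses the error of an iterate by squares of the previous error, and by
  squares of the last increment, which gives \<open>quadratic_convergence\<close> and \<open>error_le_increment\<close>.

  The stochastic part needs no stochastic integral.  The noise is additive, so \<open>Z - K W\<close> is
  absolutely continuous in time and ordinary integration by parts applies path by path.  Probability enters only
  through the fact that \<open>W\<^sub>T - W\<^sub>t\<close> is orthogonal to all square-integrable variables known at time \<open>t\<close>
  (\<open>mean_pairing\<close>).  A Lyapunov function then bounds the second moment of a stable process uniformly in
  time (\<open>second_moment_bounded\<close>).

  For optimality, let \<open>Z\<close> be the Riccati closed loop and let \<open>D\<close> and \<open>v\<close> be the differences of states and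
  controls between a competitor and \<open>Z\<close>.  The Riccati equation makes the linear part of the cost
  difference a total derivative, so that up to time \<open>T\<close> the competitor's cost exceeds that of \<open>Z\<close> by the
  cost of \<open>(D, v)\<close> minus \<open>2 E(P D\<^sub>T \<bullet> Z\<^sub>T)\<close> (\<open>cost_expansion\<close>).  The last term is at most the cost of
  \<open>v\<close> plus a constant, and constants vanish in the time average (\<open>cost_gap\<close>).

  Finally, closed loops for \<open>P\<close> and \<open>P\<^sub>k\<close> driven by the same noise differ by the solution of a linear
  equation whose input is of order \<open>norm (P\<^sub>k - P)\<close>.  An energy estimate makes the difference of the controls of
  that order (\<open>feedback_difference\<close>), and \<open>error_le_increment\<close> converts it to the squared increment.
\<close>

section \<open>Adjoints and quadratic forms\<close>

text \<open>
  The codomain may be an infinite-dimensional space without second countability (it is where the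
  output \<open>C\<close> lives), so existence of the adjoint is obtained from an orthonormal basis of the domain.
\<close>

lemma adjoint_inner:
  fixes f :: "'a::euclidean_space \<Rightarrow> 'b::real_inner"
  assumes "linear f"
  shows "x \<bullet> adjoint f y = f x \<bullet> y"
proof -
  have "\<forall>x y. f x \<bullet> y = x \<bullet> (\<Sum>i\<in>Basis. (f i \<bullet> y) *\<^sub>R i)"
  proof (intro allI)
    fix x y
    have "f x \<bullet> y = f (\<Sum>i\<in>Basis. (x \<bullet> i) *\<^sub>R i) \<bullet> y" by (simp add: euclidean_representation)
    also have "\<dots> = (\<Sum>i\<in>Basis. (x \<bullet> i) * (f i \<bullet> y))"
      by (simp add: linear_sum[OF assms] linear_cmul[OF assms] inner_sum_left)
    also have "\<dots> = x \<bullet> (\<Sum>i\<in>Basis. (f i \<bullet> y) *\<^sub>R i)"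
      by (simp add: inner_sum_right mult.commute)
    finally show "f x \<bullet> y = x \<bullet> (\<Sum>i\<in>Basis. (f i \<bullet> y) *\<^sub>R i)" .
  qed
  then have "\<exists>f'. \<forall>x y. f x \<bullet> y = x \<bullet> f' y" by (intro exI)
  from someI_ex[OF this] show ?thesis unfolding adjoint_def by metis
qed

lemma inner_adj:
  fixes S :: "'a::euclidean_space \<Rightarrow>\<^sub>L 'b::real_inner"
  shows "x \<bullet> adj S y = S x \<bullet> y"
proof -
  let ?g = "adjoint (blinfun_apply S)"
  have *: "x \<bullet> ?g y = S x \<bullet> y" for x y
    by (rule adjoint_inner) (rule bounded_linear.linear[OF blinfun.bounded_linear_right])
  have "bounded_linear ?g"
  proof (rule bounded_linear_intro[where K = "norm S"])
    show "?g (x + y) = ?g x + ?g y" for x y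
      by (rule vector_eq_ldot[THEN iffD1]) (simp add: * inner_add_right)
    show "?g (r *\<^sub>R x) = r *\<^sub>R ?g x" for r x
      by (rule vector_eq_ldot[THEN iffD1]) (simp add: *)
    show "norm (?g x) \<le> norm x * norm S" for x
    proof -
      have "(norm (?g x))\<^sup>2 = S (?g x) \<bullet> x"
        by (simp add: power2_norm_eq_inner *)
      also have "\<dots> \<le> norm S * norm (?g x) * norm x"
        by (meson norm_blinfun norm_cauchy_schwarz norm_ge_zero mult_right_mono order_trans)
      finally show ?thesis
        by (cases "norm (?g x) = 0") (auto simp: power2_eq_square mult_ac)
    qed
  qed
  then show ?thesis
    by (simp add: adj_def bounded_linear_Blinfun_apply *)
qed

lemma inner_adj_left:
  fixes S :: "'a::euclidean_space \<Rightarrow>\<^sub>L 'b::real_inner"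
  shows "adj S y \<bullet> x = y \<bullet> S x"
  by (metis inner_adj inner_commute)

lemma blinfun_eq_iff_inner:
  fixes S T :: "'a::real_normed_vector \<Rightarrow>\<^sub>L 'b::real_inner"
  shows "S = T \<longleftrightarrow> (\<forall>x y. x \<bullet> S y = x \<bullet> T y)"
  by (metis blinfun_eqI vector_eq_ldot)

lemma norm_adj_le:
  fixes S :: "'a::euclidean_space \<Rightarrow>\<^sub>L 'b::real_inner"
  shows "norm (adj S) \<le> norm S"
proof (rule norm_blinfun_bound)
  fix x
  have "(norm (adj S x))\<^sup>2 = S (adj S x) \<bullet> x"
    by (simp add: power2_norm_eq_inner inner_adj)
  also have "\<dots> \<le> norm S * norm (adj S x) * norm x"
    by (meson norm_blinfun norm_cauchy_schwarz norm_ge_zero mult_right_mono order_trans)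
  finally show "norm (adj S x) \<le> norm S * norm x"
    by (cases "norm (adj S x) = 0") (auto simp: power2_eq_square mult_ac)
qed simp

lemma bounded_linear_adj:
  "bounded_linear (adj :: ('a::euclidean_space \<Rightarrow>\<^sub>L 'b::real_inner) \<Rightarrow> _)"
proof (rule bounded_linear_intro[where K = 1])
  show "adj (S + T) = adj S + adj T" for S T :: "'a \<Rightarrow>\<^sub>L 'b"
    by (simp add: blinfun_eq_iff_inner inner_adj blinfun.add_left inner_add)
  show "adj (r *\<^sub>R S) = r *\<^sub>R adj S" for r and S :: "'a \<Rightarrow>\<^sub>L 'b"
    by (simp add: blinfun_eq_iff_inner inner_adj blinfun.scaleR_left)
qed (simp add: norm_adj_le)

lemma matrix_op_apply [simp]: "matrix_op R v = R *v v"
  unfolding matrix_op_def by (simp add: bounded_linear_Blinfun_apply matrix_vector_mul_bounded_linear)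

lemma pos_semidef_cauchy_schwarz:
  fixes D :: "'a::euclidean_space \<Rightarrow>\<^sub>L 'a"
  assumes "pos_semidef D"
  shows "(x \<bullet> D y)\<^sup>2 \<le> (x \<bullet> D x) * (y \<bullet> D y)"
proof -
  define a b c where "a = y \<bullet> D y" and "b = x \<bullet> D y" and "c = x \<bullet> D x"
  have sym: "y \<bullet> D x = b"
    using assms inner_adj[of y D x] by (simp add: pos_semidef_def b_def inner_commute)
  have ac: "a \<ge> 0" "c \<ge> 0" using assms by (auto simp: pos_semidef_def a_def c_def)
  have q: "0 \<le> s\<^sup>2 * c + 2 * s * t * b + t\<^sup>2 * a" for s t
  proof -
    have "0 \<le> (s *\<^sub>R x + t *\<^sub>R y) \<bullet> D (s *\<^sub>R x + t *\<^sub>R y)"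
      using assms by (auto simp: pos_semidef_def)
    also have "\<dots> = s\<^sup>2 * c + 2 * s * t * b + t\<^sup>2 * a"
      by (simp add: blinfun.bilinear_simps inner_add sym a_def[symmetric] b_def[symmetric]
          c_def[symmetric] power2_eq_square algebra_simps)
    finally show ?thesis .
  qed
  have "b\<^sup>2 \<le> c * a"
  proof (cases "a = 0")
    case True
    have "b = 0"
    proof (cases "c = 0")
      case True
      then have "b\<^sup>2 \<le> 0" using q[of 1 "-b"] \<open>a = 0\<close> by (simp add: power2_eq_square)
      then show ?thesis by simp
    next
      case False
      then have "c > 0" using ac by simp
      moreover have "0 \<le> - (b\<^sup>2 * c)" using q[of "-b" c] True by (simp add: power2_eq_square)
      ultimately show ?thesis by (simp add: mult_le_0_iff)
    qed
    then show ?thesis using True by simp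
  next
    case False
    then have "a > 0" using ac by simp
    moreover have "0 \<le> a * (c * a - b\<^sup>2)"
      using q[of a "-b"] by (simp add: power2_eq_square algebra_simps)
    ultimately show ?thesis by (simp add: zero_le_mult_iff)
  qed
  then show ?thesis by (simp add: a_def b_def c_def)
qed

text \<open>
  The operator norm is monotone on positive semidefinite operators.  This turns the operator order
  into norm estimates, both for convergence of the iterates and for the quadratic rate.
\<close>

lemma norm_le_of_quadratic_form_le:
  fixes D D' :: "'a::euclidean_space \<Rightarrow>\<^sub>L 'a"
  assumes D: "pos_semidef D" and le: "\<And>x. x \<bullet> D x \<le> x \<bullet> D' x"
  shows "norm D \<le> norm D'"
proof (rule norm_blinfun_bound)
  fix y
  have u: "x \<bullet> D x \<le> norm D' * (norm x)\<^sup>2" for x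
  proof -
    have "x \<bullet> D' x \<le> norm x * (norm D' * norm x)"
      by (meson norm_blinfun norm_cauchy_schwarz norm_ge_zero mult_left_mono order_trans)
    then show ?thesis using le[of x] by (simp add: power2_eq_square mult_ac)
  qed
  have "((norm (D y))\<^sup>2)\<^sup>2 = (D y \<bullet> D y)\<^sup>2" by (simp add: power2_norm_eq_inner)
  also have "\<dots> \<le> (D y \<bullet> D (D y)) * (y \<bullet> D y)" by (rule pos_semidef_cauchy_schwarz[OF D])
  also have "\<dots> \<le> (norm D' * (norm (D y))\<^sup>2) * (norm D' * (norm y)\<^sup>2)"
    using D by (intro mult_mono u) (auto simp: pos_semidef_def)
  finally have "((norm (D y))\<^sup>2)\<^sup>2 \<le> (norm (D y))\<^sup>2 * (norm D' * norm y)\<^sup>2"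
    by (simp add: power_mult_distrib power2_eq_square mult_ac)
  then have "(norm (D y))\<^sup>2 * (norm (D y))\<^sup>2 \<le> (norm (D y))\<^sup>2 * (norm D' * norm y)\<^sup>2"
    by (simp only: power2_eq_square[of "(norm (D y))\<^sup>2"])
  then have "(norm (D y))\<^sup>2 \<le> (norm D' * norm y)\<^sup>2"
    by (cases "norm (D y) = 0") (simp, metis mult_left_le_imp_le zero_less_power norm_ge_zero order_le_less)
  then show "norm (D y) \<le> norm D' * norm y"
    by (rule power2_le_imp_le) simp
qed simp

section \<open>The operator exponential\<close>

text \<open>
  A copy of the endomorphisms carrying the structure of a Banach algebra; it only serves to
  transport the theory of \<open>exp\<close> in Banach algebras to \<open>op_exp\<close>.
\<close>

typedef (overloaded) 'a endo = "UNIV :: ('a::euclidean_space \<Rightarrow>\<^sub>L 'a) set" by simp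
setup_lifting type_definition_endo

instantiation endo :: (euclidean_space) real_normed_algebra_1
begin
lift_definition zero_endo :: "'a endo" is 0 .
lift_definition one_endo :: "'a endo" is id_blinfun .
lift_definition plus_endo :: "'a endo \<Rightarrow> 'a endo \<Rightarrow> 'a endo" is "(+)" .
lift_definition minus_endo :: "'a endo \<Rightarrow> 'a endo \<Rightarrow> 'a endo" is "(-)" .
lift_definition uminus_endo :: "'a endo \<Rightarrow> 'a endo" is "uminus" .
lift_definition times_endo :: "'a endo \<Rightarrow> 'a endo \<Rightarrow> 'a endo" is "(o\<^sub>L)" .
lift_definition scaleR_endo :: "real \<Rightarrow> 'a endo \<Rightarrow> 'a endo" is "scaleR" .
lift_definition norm_endo :: "'a endo \<Rightarrow> real" is norm .
definition dist_endo :: "'a endo \<Rightarrow> 'a endo \<Rightarrow> real" where "dist_endo x y = norm (x - y)"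
definition sgn_endo :: "'a endo \<Rightarrow> 'a endo" where "sgn_endo x = scaleR (inverse (norm x)) x"
definition uniformity_endo :: "('a endo \<times> 'a endo) filter"
  where "uniformity_endo = (INF e\<in>{0 <..}. principal {(x, y). dist x y < e})"
definition open_endo :: "'a endo set \<Rightarrow> bool"
  where "open_endo U = (\<forall>x\<in>U. \<forall>\<^sub>F (x', y) in uniformity. x' = x \<longrightarrow> y \<in> U)"
instance
proof
  fix a b c :: "'a endo" and r s :: real
  show "a + b + c = a + (b + c)" "a + b = b + a" "0 + a = a" "- a + a = 0" "a - b = a + - b"
    by (transfer; simp)+
  show "r *\<^sub>R (a + b) = r *\<^sub>R a + r *\<^sub>R b" "(r + s) *\<^sub>R a = r *\<^sub>R a + s *\<^sub>R a"
    "r *\<^sub>R s *\<^sub>R a = (r * s) *\<^sub>R a" "1 *\<^sub>R a = a"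
    by (transfer; simp add: scaleR_add_right scaleR_add_left)+
  show "a * b * c = a * (b * c)" "1 * a = a" "a * 1 = a" by (transfer; rule blinfun_eqI; simp)+
  show "(a + b) * c = a * c + b * c" "a * (b + c) = a * b + a * c"
    by (transfer; rule blinfun_eqI; simp add: blinfun.bilinear_simps)+
  show "r *\<^sub>R a * b = r *\<^sub>R (a * b)" "a * r *\<^sub>R b = r *\<^sub>R (a * b)"
    by (transfer; rule blinfun_eqI; simp add: blinfun.bilinear_simps)+
  show "norm a = 0 \<longleftrightarrow> a = 0" "norm (a + b) \<le> norm a + norm b" "norm (r *\<^sub>R a) = \<bar>r\<bar> * norm a"
    by (transfer; simp add: norm_triangle_ineq)+
  show "norm (a * b) \<le> norm a * norm b" by (transfer; rule norm_blinfun_compose)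
  show "norm (1 :: 'a endo) = 1" by transfer simp
  have "norm (1 :: 'a endo) = 1" by transfer simp
  moreover have "norm (0 :: 'a endo) = 0" by transfer simp
  ultimately show "(0 :: 'a endo) \<noteq> 1" by auto
  show "dist a b = norm (a - b)" "sgn a = inverse (norm a) *\<^sub>R a"
    by (simp_all add: dist_endo_def sgn_endo_def)
qed (rule uniformity_endo_def open_endo_def)+
end

instance endo :: (euclidean_space) banach
proof
  fix X :: "nat \<Rightarrow> 'a endo" assume "Cauchy X"
  have d: "dist (Rep_endo a) (Rep_endo b) = dist a b" for a b :: "'a endo"
    by (simp add: dist_endo_def dist_norm norm_endo.rep_eq minus_endo.rep_eq)
  from \<open>Cauchy X\<close> have "Cauchy (\<lambda>n. Rep_endo (X n))" unfolding Cauchy_def d .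
  then obtain l where "(\<lambda>n. Rep_endo (X n)) \<longlonglongrightarrow> l" using convergent_eq_Cauchy by blast
  then have "(\<lambda>n. Rep_endo (X n)) \<longlonglongrightarrow> Rep_endo (Abs_endo l)" by (simp add: Abs_endo_inverse)
  then have "X \<longlonglongrightarrow> Abs_endo l" unfolding tendsto_iff d .
  then show "convergent X" by (rule convergentI)
qed

lemma bounded_linear_Rep_endo: "bounded_linear Rep_endo"
  by (rule bounded_linear_intro[where K = 1])
    (simp_all add: plus_endo.rep_eq scaleR_endo.rep_eq norm_endo.rep_eq)

lemma Rep_endo_power: "Rep_endo (a ^ n) = ((\<lambda>Q. Rep_endo a o\<^sub>L Q) ^^ n) id_blinfun"
  by (induction n) (simp_all add: one_endo.rep_eq times_endo.rep_eq)

lemma op_exp_eq_exp: "op_exp S = Rep_endo (exp (Abs_endo S))"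
proof -
  have "Rep_endo (exp (Abs_endo S)) = (\<Sum>n. Rep_endo (Abs_endo S ^ n /\<^sub>R fact n))"
    unfolding exp_def
    by (subst bounded_linear.suminf[OF bounded_linear_Rep_endo summable_exp_generic]) (rule refl)
  also have "\<dots> = op_exp S"
    unfolding op_exp_def
    by (simp add: scaleR_endo.rep_eq Rep_endo_power Abs_endo_inverse divide_inverse)
  finally show ?thesis by simp
qed

lemma scaleR_Abs_endo: "t *\<^sub>R Abs_endo S = Abs_endo (t *\<^sub>R S)"
  by (metis Abs_endo_inverse Rep_endo_inject UNIV_I scaleR_endo.rep_eq)

lemma op_exp_zero [simp]: "op_exp (0 :: 'a::euclidean_space \<Rightarrow>\<^sub>L 'a) = id_blinfun"
  unfolding op_exp_eq_exp zero_endo.abs_eq[symmetric] by (simp add: one_endo.rep_eq)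

lemma op_exp_add:
  fixes S :: "'a::euclidean_space \<Rightarrow>\<^sub>L 'a"
  shows "op_exp ((s + t) *\<^sub>R S) = op_exp (s *\<^sub>R S) o\<^sub>L op_exp (t *\<^sub>R S)"
  unfolding op_exp_eq_exp scaleR_Abs_endo[symmetric] times_endo.rep_eq[symmetric]
  by (subst exp_add_commuting[symmetric]) (simp_all add: scaleR_add_left)

lemma op_exp_commute:
  fixes S :: "'a::euclidean_space \<Rightarrow>\<^sub>L 'a"
  shows "op_exp (t *\<^sub>R S) o\<^sub>L S = S o\<^sub>L op_exp (t *\<^sub>R S)"
proof -
  have "exp (t *\<^sub>R Abs_endo S) * Abs_endo S = Abs_endo S * exp (t *\<^sub>R Abs_endo S)"
    using exp_times_arg_commute[of "t *\<^sub>R Abs_endo S"] by (cases "t = 0") simp_all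
  then have "Rep_endo (exp (t *\<^sub>R Abs_endo S) * Abs_endo S) = Rep_endo (Abs_endo S * exp (t *\<^sub>R Abs_endo S))"
    by simp
  then show ?thesis
    by (simp add: op_exp_eq_exp scaleR_Abs_endo times_endo.rep_eq Abs_endo_inverse)
qed

lemma op_exp_has_vector_derivative:
  fixes S :: "'a::euclidean_space \<Rightarrow>\<^sub>L 'a"
  shows
  "((\<lambda>t. op_exp (t *\<^sub>R S)) has_vector_derivative (S o\<^sub>L op_exp (t *\<^sub>R S))) (at t within T)"
proof -
  have "((\<lambda>t. Rep_endo (exp (t *\<^sub>R Abs_endo S))) has_vector_derivative
      Rep_endo (exp (t *\<^sub>R Abs_endo S) * Abs_endo S)) (at t within T)"
    by (rule bounded_linear.has_vector_derivative[OF bounded_linear_Rep_endo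
          exp_scaleR_has_vector_derivative_right])
  moreover have "Rep_endo (exp (t *\<^sub>R Abs_endo S)) = op_exp (t *\<^sub>R S)" for t
    by (simp add: op_exp_eq_exp scaleR_Abs_endo)
  ultimately show ?thesis
    by (simp add: times_endo.rep_eq Abs_endo_inverse op_exp_commute)
qed

section \<open>Stability and Lyapunov equations\<close>

definition stable :: "('a::euclidean_space \<Rightarrow>\<^sub>L 'a) \<Rightarrow> bool" where
  "stable S \<longleftrightarrow> ((\<lambda>t. op_exp (t *\<^sub>R S)) \<longlongrightarrow> 0) at_top"

definition lyap_op :: "('a::euclidean_space \<Rightarrow>\<^sub>L 'a) \<Rightarrow> ('a \<Rightarrow>\<^sub>L 'a) \<Rightarrow> ('a \<Rightarrow>\<^sub>L 'a)" where
  "lyap_op S X = (adj S o\<^sub>L X) + (X o\<^sub>L S)"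

lemma inner_lyap_op: "x \<bullet> lyap_op S X y = S x \<bullet> X y + x \<bullet> X (S y)"
  by (simp add: lyap_op_def blinfun.bilinear_simps inner_add inner_adj)

lemma bounded_linear_lyap_op: "bounded_linear (lyap_op S)"
  unfolding lyap_op_def
  by (intro bounded_linear_add bounded_bilinear.bounded_linear_left[OF bounded_bilinear_blinfun_compose]
      bounded_bilinear.bounded_linear_right[OF bounded_bilinear_blinfun_compose])

lemma adj_adj [simp]: 
  fixes X :: "'a::euclidean_space \<Rightarrow>\<^sub>L 'b::euclidean_space"
  shows "adj (adj X) = X"
  by (simp add: blinfun_eq_iff_inner inner_adj inner_adj_left)

lemma lyap_op_adj: "lyap_op S (adj X) = adj (lyap_op S X)"
proof -
  have "x \<bullet> lyap_op S (adj X) y = x \<bullet> adj (lyap_op S X) y" for x y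
    by (simp add: inner_lyap_op inner_adj inner_commute[of _ y] inner_commute[of _ "S y"])
  then show ?thesis unfolding blinfun_eq_iff_inner by blast
qed

text \<open>
  The source of everything known here about the Lyapunov operator \<open>X \<mapsto> S\<^sup>* X + X S\<close>: along the flow
  it is the time derivative of the form of \<open>X\<close>.
\<close>

lemma quadratic_form_flow_derivative:
  fixes t :: real and S X :: "'a::euclidean_space \<Rightarrow>\<^sub>L 'a"
  shows "((\<lambda>t. op_exp (t *\<^sub>R S) x \<bullet> X (op_exp (t *\<^sub>R S) y)) has_real_derivative
     op_exp (t *\<^sub>R S) x \<bullet> lyap_op S X (op_exp (t *\<^sub>R S) y)) (at (t::real) within T)"
proof -
  have E: "((\<lambda>t. op_exp (t *\<^sub>R S) z) has_vector_derivative S (op_exp (t *\<^sub>R S) z)) (at (t::real) within T)" for z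
    using bounded_linear.has_vector_derivative[OF blinfun.bounded_linear_left[of z] op_exp_has_vector_derivative[of S t T]]
    by simp
  have XE: "((\<lambda>t. X (op_exp (t *\<^sub>R S) z)) has_vector_derivative X (S (op_exp (t *\<^sub>R S) z))) (at (t::real) within T)" for z
    by (rule bounded_linear.has_vector_derivative[OF blinfun.bounded_linear_right E])
  show ?thesis
    unfolding has_real_derivative_iff_has_vector_derivative inner_lyap_op
    using bounded_bilinear.has_vector_derivative[OF bounded_bilinear_inner E[of x] XE[of y]]
    by (simp add: add.commute)
qed

lemma stable_quadratic_form_tendsto:
  fixes S X :: "'a::euclidean_space \<Rightarrow>\<^sub>L 'a"
  assumes "stable S"
  shows "((\<lambda>t. op_exp (t *\<^sub>R S) x \<bullet> X (op_exp (t *\<^sub>R S) y)) \<longlongrightarrow> 0) at_top"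
proof -
  have *: "((\<lambda>t. op_exp (t *\<^sub>R S) z) \<longlongrightarrow> 0) at_top" for z
    using blinfun.tendsto[OF assms[unfolded stable_def] tendsto_const[of z]]
    by (simp add: blinfun.zero_left)
  show ?thesis
    using tendsto_inner[OF *[of x] blinfun.tendsto[OF tendsto_const[of X] *[of y]]]
    by (simp add: blinfun.zero_right)
qed

lemma quadratic_form_flow_antimono:
  fixes s t :: real
  assumes "\<And>x. x \<bullet> lyap_op S X x \<le> 0" and le: "s \<le> t"
  shows "op_exp (t *\<^sub>R S) x \<bullet> X (op_exp (t *\<^sub>R S) x) \<le> op_exp (s *\<^sub>R S) x \<bullet> X (op_exp (s *\<^sub>R S) x)"
  by (rule DERIV_nonpos_imp_nonincreasing[OF le])
     (use quadratic_form_flow_derivative assms(1) in blast)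

text \<open>
  The form of \<open>X\<close> does not increase along the flow and tends to \<open>0\<close>, so it cannot start below \<open>0\<close>.
\<close>

lemma lyapunov_positive:
  assumes "stable S" and "\<And>x. x \<bullet> lyap_op S X x \<le> 0"
  shows "0 \<le> x \<bullet> X x"
proof (rule tendsto_le[OF _ tendsto_const stable_quadratic_form_tendsto[OF assms(1), of x X x]])
  show "\<forall>\<^sub>F t in at_top. op_exp (t *\<^sub>R S) x \<bullet> X (op_exp (t *\<^sub>R S) x) \<le> x \<bullet> X x"
    using quadratic_form_flow_antimono[OF assms(2), of 0 _ x]
    by (intro eventually_mono[OF eventually_ge_at_top[of 0]]) auto
qed simp

lemma lyap_op_injective:
  assumes "stable S" and "lyap_op S X = lyap_op S Y"
  shows "X = Y"
proof -
  define D where "D = X - Y"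
  have D0: "lyap_op S D = 0"
    using assms(2) linear_diff[OF bounded_linear.linear[OF bounded_linear_lyap_op], of S X Y] by (simp add: D_def)
  have "x \<bullet> D y = 0" for x y
  proof -
    define f where "f t = op_exp (t *\<^sub>R S) x \<bullet> D (op_exp (t *\<^sub>R S) y)" for t
    have "(f has_real_derivative 0) (at t)" for t
      unfolding f_def using quadratic_form_flow_derivative[of S x D y t UNIV] by (simp add: D0 blinfun.zero_left)
    then have "f t = f 0" for t using DERIV_isconst_all[of f] by blast
    then have "f = (\<lambda>_. f 0)" by auto
    moreover have "(f \<longlongrightarrow> 0) at_top" unfolding f_def by (rule stable_quadratic_form_tendsto[OF assms(1)])
    ultimately have "((\<lambda>_. f 0) \<longlongrightarrow> 0) (at_top :: real filter)" by metis
    then have "f 0 = 0" by (simp add: tendsto_const_iff)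
    then show ?thesis by (simp add: f_def)
  qed
  then have "D = 0" by (metis blinfun_eqI blinfun.zero_left inner_eq_zero_iff)
  then show ?thesis by (simp add: D_def)
qed

text \<open>
  The familiar solution is \<open>\<integral>\<^sub>0\<^sup>\<infinity> e\<^sup>t\<^sup>S\<^sup>* Q e\<^sup>t\<^sup>S dt\<close>.  The improper integral is avoided by choosing a time
  \<open>t\<^sub>0\<close> at which the flow is a contraction: if \<open>Q' - e\<^sup>*Q' e = Q\<close> with \<open>e = exp (t\<^sub>0 S)\<close>, then the integral over
  \<open>[0, t\<^sub>0]\<close> with \<open>Q'\<close> in place of \<open>Q\<close> solves the equation, because its image under the Lyapunov operator is
  the difference of the boundary values.
\<close>

lemma lyapunov_solvable:
  fixes S Q :: "'a::euclidean_space \<Rightarrow>\<^sub>L 'a"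
  assumes "stable S"
  shows "\<exists>X. lyap_op S X = - Q"
proof -
  let ?E = "\<lambda>t. op_exp (t *\<^sub>R S)"
  have "\<forall>\<^sub>F t in at_top. norm (?E t) < 1 \<and> t > 0"
    using order_tendstoD(2)[OF tendsto_norm_zero[OF assms[unfolded stable_def]], of 1]
    by (intro eventually_conj) (simp_all add: eventually_gt_at_top)
  then obtain t0 where t0: "norm (?E t0) < 1" "t0 > 0"
    using eventually_happens'[OF trivial_limit_at_top_linorder] by blast
  define f where "f X = Q + (adj (?E t0) o\<^sub>L X o\<^sub>L ?E t0)" for X
  let ?c = "norm (?E t0) * norm (?E t0)"
  \<comment> \<open>a fixed point of \<open>f\<close> is the \<open>Q'\<close> described above; \<open>f\<close> contracts since \<open>norm (?E t0) < 1\<close>\<close>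
  have "\<exists>!X\<in>UNIV. f X = X"
  proof (rule Banach_fix)
    show "0 \<le> ?c" by simp
    show "?c < 1" using t0 by (metis mult_strict_mono' mult_1 norm_ge_zero)
    show "dist (f X) (f Y) \<le> ?c * dist X Y" for X Y
    proof -
      have "f X - f Y = (adj (?E t0) o\<^sub>L (X - Y) o\<^sub>L ?E t0)"
        by (rule blinfun_eqI) (simp add: f_def blinfun.bilinear_simps)
      then have "norm (f X - f Y) \<le> norm (adj (?E t0) o\<^sub>L (X - Y)) * norm (?E t0)"
        by (simp add: norm_blinfun_compose)
      also have "\<dots> \<le> norm (adj (?E t0)) * norm (X - Y) * norm (?E t0)"
        by (intro mult_right_mono norm_blinfun_compose) simp
      also have "\<dots> \<le> norm (?E t0) * norm (X - Y) * norm (?E t0)"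
        by (intro mult_right_mono norm_adj_le) auto
      finally show ?thesis by (simp add: dist_norm mult_ac)
    qed
  qed (auto simp: complete_UNIV)
  then obtain Q' where Q': "f Q' = Q'" by blast
  define F where "F t = (adj (?E t) o\<^sub>L Q' o\<^sub>L ?E t)" for t
  have F': "(F has_vector_derivative lyap_op S (F t)) (at (t::real) within T)" for t T
  proof -
    note comp = bounded_bilinear.has_vector_derivative[OF bounded_bilinear_blinfun_compose]
    have a: "((\<lambda>t. adj (?E t)) has_vector_derivative adj (S o\<^sub>L ?E t)) (at (t::real) within T)"
      by (rule bounded_linear.has_vector_derivative[OF bounded_linear_adj op_exp_has_vector_derivative])
    have "(F has_vector_derivative
       (adj (?E t) o\<^sub>L Q' o\<^sub>L (S o\<^sub>L ?E t)) + ((adj (?E t) o\<^sub>L 0) + (adj (S o\<^sub>L ?E t) o\<^sub>L Q') o\<^sub>L ?E t)) (at (t::real) within T)"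
      unfolding F_def
      by (rule comp[OF comp[OF a has_vector_derivative_const] op_exp_has_vector_derivative])
    moreover have "(adj (?E t) o\<^sub>L Q' o\<^sub>L (S o\<^sub>L ?E t)) + ((adj (?E t) o\<^sub>L 0) + (adj (S o\<^sub>L ?E t) o\<^sub>L Q') o\<^sub>L ?E t)
        = lyap_op S (F t)"
      unfolding blinfun_eq_iff_inner inner_lyap_op
    proof (intro allI)
      fix x y
      have "S (?E t z) = ?E t (S z)" for z
        using arg_cong[OF op_exp_commute[of t S], of "\<lambda>X. blinfun_apply X z"] by simp
      then show "x \<bullet> ((adj (?E t) o\<^sub>L Q' o\<^sub>L (S o\<^sub>L ?E t)) + ((adj (?E t) o\<^sub>L 0) + (adj (S o\<^sub>L ?E t) o\<^sub>L Q') o\<^sub>L ?E t)) y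
          = S x \<bullet> F t y + x \<bullet> F t (S y)"
        by (simp add: F_def blinfun.bilinear_simps inner_adj inner_add)
    qed
    ultimately show ?thesis by simp
  qed
  have cont: "continuous_on {0..t0} F"
    by (intro continuous_at_imp_continuous_on ballI has_vector_derivative_continuous[OF F'])
  define X where "X = integral {0..t0} F"
  have "(F has_integral X) {0..t0}"
    unfolding X_def by (rule integrable_integral[OF integrable_continuous_real[OF cont]])
  then have "((lyap_op S \<circ> F) has_integral lyap_op S X) {0..t0}"
    by (rule has_integral_linear[OF _ bounded_linear_lyap_op])
  moreover have "((\<lambda>t. lyap_op S (F t)) has_integral F t0 - F 0) {0..t0}"
    by (rule fundamental_theorem_of_calculus) (use t0 F' in auto)
  ultimately have "lyap_op S X = F t0 - F 0"
    by (intro has_integral_unique) (auto simp: o_def)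
  also have "F 0 = Q'"
    by (simp add: F_def blinfun_eq_iff_inner inner_adj)
  also have "F t0 - Q' = - Q"
  proof -
    have "Q + F t0 = Q'" using Q' by (simp add: f_def F_def)
    then have "F t0 = Q' - Q" by (metis add_diff_cancel_left')
    then show ?thesis by simp
  qed
  finally show ?thesis by blast
qed

lemma pos_def_imp_pos_semidef: "pos_def P \<Longrightarrow> pos_semidef P"
  unfolding pos_def_def pos_semidef_def by (metis inner_zero_left less_eq_real_def)

lemma pos_def_lower_bound:
  fixes P :: "'a::euclidean_space \<Rightarrow>\<^sub>L 'a"
  assumes "\<And>x. x \<noteq> 0 \<Longrightarrow> 0 < x \<bullet> P x"
  obtains p where "p > 0" "\<And>x. p * (norm x)\<^sup>2 \<le> x \<bullet> P x"
proof -
  have ne: "sphere (0::'a) 1 \<noteq> {}" by simp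
  have "continuous_on (sphere (0::'a) 1) (\<lambda>x. x \<bullet> P x)" by (intro continuous_intros)
  from continuous_attains_inf[OF compact_sphere ne this]
  obtain e where e: "norm e = 1" "\<And>x. norm x = 1 \<Longrightarrow> e \<bullet> P e \<le> x \<bullet> P x" by auto
  have "e \<noteq> 0" using e by auto
  then have "0 < e \<bullet> P e" using assms by auto
  moreover have "(e \<bullet> P e) * (norm x)\<^sup>2 \<le> x \<bullet> P x" for x
  proof (cases "x = 0")
    case False
    have "e \<bullet> P e \<le> sgn x \<bullet> P (sgn x)" using False by (intro e) (simp add: norm_sgn)
    also have "\<dots> = (x \<bullet> P x) / (norm x)\<^sup>2"
      by (simp add: sgn_div_norm blinfun.scaleR_right power2_eq_square divide_inverse)
    finally show ?thesis using False by (simp add: field_simps)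
  qed (simp add: blinfun.zero_right)
  ultimately show ?thesis by (rule that)
qed

lemma quadratic_form_le_norm: "x \<bullet> (P :: 'a::real_inner \<Rightarrow>\<^sub>L 'a) x \<le> norm P * (norm x)\<^sup>2"
proof -
  have "x \<bullet> P x \<le> norm x * (norm P * norm x)"
    by (meson norm_blinfun norm_cauchy_schwarz norm_ge_zero mult_left_mono order_trans)
  then show ?thesis by (simp add: power2_eq_square mult_ac)
qed

text \<open>
  A LaSalle argument.  The form of \<open>P\<close> strictly decreases over the unit time interval for every nonzero
  initial state, because equality would make its derivative vanish throughout.  By compactness of the
  sphere the decrease is by a factor \<open>\<rho> < 1\<close>, uniformly in the state.
\<close>

lemma stable_of_strict_lyapunov:
  fixes S P :: "'a::euclidean_space \<Rightarrow>\<^sub>L 'a"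
  assumes P: "\<And>x. x \<noteq> 0 \<Longrightarrow> 0 < x \<bullet> P x"
    and le: "\<And>x. x \<bullet> lyap_op S P x \<le> 0"
    and strict: "\<And>x. (\<And>t. t \<in> {0<..<1} \<Longrightarrow>
        op_exp (t *\<^sub>R S) x \<bullet> lyap_op S P (op_exp (t *\<^sub>R S) x) = 0) \<Longrightarrow> x = 0"
  shows "stable S"
proof -
  let ?E = "\<lambda>t. op_exp (t *\<^sub>R S)"
  define V where "V x t = ?E t x \<bullet> P (?E t x)" for x t
  have V': "(V x has_real_derivative (?E t x \<bullet> lyap_op S P (?E t x))) (at t)" for x t
    unfolding V_def by (rule quadratic_form_flow_derivative)
  have anti: "V x t \<le> V x s" if "s \<le> t" for x s t
    unfolding V_def by (rule quadratic_form_flow_antimono[OF le that])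
  have V0: "V x 0 = x \<bullet> P x" for x by (simp add: V_def)
  have decr: "V x 1 < V x 0" if "x \<noteq> 0" for x
  proof (rule ccontr)
    assume "\<not> V x 1 < V x 0"
    then have const: "V x t = V x 0" if "t \<in> {0..1}" for t
      using anti[of 0 t x] anti[of t 1 x] that by auto
    have "?E t x \<bullet> lyap_op S P (?E t x) = 0" if "t \<in> {0<..<1}" for t
    proof (rule DERIV_local_const[OF V'])
      show "0 < min t (1 - t)" using that by auto
      show "\<forall>y. \<bar>t - y\<bar> < min t (1 - t) \<longrightarrow> V x t = V x y"
      proof (intro allI impI)
        fix y assume "\<bar>t - y\<bar> < min t (1 - t)"
        then have "y \<in> {0..1}" by (auto simp: abs_if split: if_splits)
        then show "V x t = V x y" using const[of y] const[of t] that by auto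
      qed
    qed
    from strict[OF this] that show False by blast
  qed
  \<comment> \<open>the decrease over one time unit is itself a positive definite form, hence bounded below\<close>
  define G where "G = P - (adj (?E 1) o\<^sub>L P o\<^sub>L ?E 1)"
  have G: "x \<bullet> G x = V x 0 - V x 1" for x
    by (simp add: G_def V0 blinfun.bilinear_simps inner_diff_right inner_adj) (simp add: V_def)
  obtain g where g: "g > 0" "\<And>x. g * (norm x)\<^sup>2 \<le> x \<bullet> G x"
    by (rule pos_def_lower_bound[of G]) (use G decr in auto)
  obtain p where p: "p > 0" "\<And>x. p * (norm x)\<^sup>2 \<le> x \<bullet> P x"
    by (rule pos_def_lower_bound[of P]) (use P in auto)
  define \<rho> where "\<rho> = max 0 (1 - g / (norm P + 1))"
  have \<rho>: "0 \<le> \<rho>" "\<rho> < 1" using g(1) by (auto simp: \<rho>_def divide_pos_pos add_nonneg_pos)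
  have contr: "V x 1 \<le> \<rho> * V x 0" for x
  proof -
    have nn: "norm P + 1 > 0" by (simp add: add_nonneg_pos)
    have V0nn: "0 \<le> V x 0" using p(2)[of x] p(1) order_trans[of 0 "p * (norm x)\<^sup>2" "V x 0"] by (simp add: V0)
    have "V x 0 \<le> (norm P + 1) * (norm x)\<^sup>2"
      using quadratic_form_le_norm[of x P] by (simp add: V0 distrib_right add_increasing2)
    then have "g / (norm P + 1) * V x 0 \<le> g / (norm P + 1) * ((norm P + 1) * (norm x)\<^sup>2)"
      using g(1) nn by (intro mult_left_mono) auto
    also have "\<dots> = g * (norm x)\<^sup>2" using nn by simp
    also have "\<dots> \<le> V x 0 - V x 1" using g(2)[of x] G by simp
    finally have "V x 1 \<le> (1 - g / (norm P + 1)) * V x 0" by (simp add: algebra_simps)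
    also have "\<dots> \<le> \<rho> * V x 0" using V0nn by (intro mult_right_mono) (auto simp: \<rho>_def)
    finally show ?thesis .
  qed
  have Vn: "V x (real n) \<le> \<rho> ^ n * V x 0" for x n
  proof (induction n)
    case (Suc n)
    have "V x (real (Suc n)) = V (?E (real n) x) 1"
      using op_exp_add[of 1 "real n" S] by (simp add: V_def)
    also have "\<dots> \<le> \<rho> * V (?E (real n) x) 0" by (rule contr)
    also have "V (?E (real n) x) 0 = V x (real n)" by (simp add: V0) (simp add: V_def)
    also have "\<rho> * V x (real n) \<le> \<rho> * (\<rho> ^ n * V x 0)" using Suc \<rho> by (intro mult_left_mono)
    finally show ?case by (simp add: mult_ac)
  qed simp
  have bound: "(norm (?E t))\<^sup>2 \<le> \<rho> ^ n * norm P / p" if "real n \<le> t" for n t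
  proof -
    let ?b = "\<rho> ^ n * norm P / p"
    have b: "0 \<le> ?b" using \<rho> p by simp
    have "norm (?E t) \<le> sqrt ?b"
    proof (rule norm_blinfun_bound)
      fix x
      have "p * (norm (?E t x))\<^sup>2 \<le> V x t" unfolding V_def by (rule p)
      also have "\<dots> \<le> V x (real n)" by (rule anti[OF that])
      also have "\<dots> \<le> \<rho> ^ n * V x 0" by (rule Vn)
      also have "\<dots> \<le> \<rho> ^ n * (norm P * (norm x)\<^sup>2)"
        unfolding V0 using \<rho> by (intro mult_left_mono quadratic_form_le_norm) auto
      finally have "(norm (?E t x))\<^sup>2 \<le> ?b * (norm x)\<^sup>2" using p(1) by (simp add: field_simps)
      then have "norm (?E t x) \<le> sqrt (?b * (norm x)\<^sup>2)" by (rule real_le_rsqrt)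
      then show "norm (?E t x) \<le> sqrt ?b * norm x" by (simp add: real_sqrt_mult real_sqrt_divide)
    qed (use b in simp)
    then show ?thesis using b
      by (metis norm_ge_zero power_mono real_sqrt_pow2)
  qed
  show "stable S" unfolding stable_def
  proof (rule tendstoI)
    fix e :: real assume "e > 0"
    have "(\<lambda>n. \<rho> ^ n * norm P / p) \<longlonglongrightarrow> 0 * norm P / p"
      using \<rho> p by (intro tendsto_intros LIMSEQ_realpow_zero) auto
    then have "\<forall>\<^sub>F n in sequentially. \<rho> ^ n * norm P / p < e\<^sup>2"
      by (rule order_tendstoD) (use \<open>e > 0\<close> in simp)
    then obtain n where n: "\<rho> ^ n * norm P / p < e\<^sup>2" by (auto simp: eventually_sequentially)
    show "\<forall>\<^sub>F t in at_top. dist (?E t) 0 < e"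
    proof (rule eventually_mono[OF eventually_ge_at_top[of "real n"]])
      fix t assume "real n \<le> t"
      from bound[OF this] n have "(norm (?E t))\<^sup>2 < e\<^sup>2" by linarith
      then show "dist (?E t) 0 < e" using \<open>e > 0\<close> by (simp add: power2_less_imp_less)
    qed
  qed
qed

lemma stable_of_exponential_bound:
  assumes "\<omega> > 0" and "\<And>t. t \<ge> 0 \<Longrightarrow> norm (op_exp (t *\<^sub>R S)) \<le> \<nu> * exp (- \<omega> * t)"
  shows "stable S"
  unfolding stable_def
proof (rule Lim_null_comparison)
  show "\<forall>\<^sub>F t in at_top. norm (op_exp (t *\<^sub>R S)) \<le> \<nu> * exp (- \<omega> * t)"
    using assms(2) by (rule eventually_mono[OF eventually_ge_at_top[of 0]])
  have "filterlim (\<lambda>t. \<omega> * t) at_top at_top"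
    using assms(1) by (intro filterlim_tendsto_pos_mult_at_top[OF tendsto_const]) (auto simp: filterlim_ident)
  then have "((\<lambda>t. exp (- (\<omega> * t))) \<longlongrightarrow> 0) at_top"
    by (intro filterlim_compose[OF exp_at_bot] filterlim_uminus_at_bot_at_top[THEN filterlim_compose])
  then show "((\<lambda>t. \<nu> * exp (- \<omega> * t)) \<longlongrightarrow> 0) at_top"
    using tendsto_mult_right_zero by fastforce
qed

text \<open>
  The solution \<open>Q\<close> for the right-hand side \<open>- id\<close> is a quadratic Lyapunov function.  It also
  quantifies the invertibility of the Lyapunov operator: \<open>norm (lyap_op S X) *\<^sub>R Q - X\<close> has a negative
  semidefinite image and is therefore positive.
\<close>

lemma lyapunov_function_exists:
  fixes S :: "'a::euclidean_space \<Rightarrow>\<^sub>L 'a"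
  assumes "stable S"
  obtains Q q where "adj Q = Q" and "\<And>x y. S x \<bullet> Q y + x \<bullet> Q (S y) = - (x \<bullet> y)"
    and "q > 0" and "\<And>x. q * (norm x)\<^sup>2 \<le> x \<bullet> Q x"
    and "\<And>X. pos_semidef X \<Longrightarrow> norm X \<le> norm Q * norm (lyap_op S X)"
proof -
  obtain Q where Q: "lyap_op S Q = - id_blinfun" using lyapunov_solvable[OF assms] by blast
  have Qxy: "S x \<bullet> Q y + x \<bullet> Q (S y) = - (x \<bullet> y)" for x y
    using inner_lyap_op[of x S Q y] by (simp add: Q blinfun.bilinear_simps)
  have "lyap_op S (adj Q) = lyap_op S Q"
    unfolding lyap_op_adj Q by (simp add: blinfun_eq_iff_inner inner_adj blinfun.bilinear_simps)
  then have adj: "adj Q = Q" by (rule lyap_op_injective[OF assms])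
  have nonneg: "0 \<le> x \<bullet> Q x" for x
    by (rule lyapunov_positive[OF assms]) (simp add: Q blinfun.bilinear_simps)
  have psd: "pos_semidef Q" using adj nonneg by (simp add: pos_semidef_def)
  have "0 < x \<bullet> Q x" if "x \<noteq> 0" for x
  proof (rule ccontr)
    assume "\<not> 0 < x \<bullet> Q x"
    then have z: "x \<bullet> Q x = 0" using nonneg[of x] by simp
    have "(y \<bullet> Q x)\<^sup>2 \<le> 0" for y using pos_semidef_cauchy_schwarz[OF psd, of y x] z by simp
    then have yQx: "y \<bullet> Q x = 0" for y by simp
    moreover have "x \<bullet> Q (S x) = 0"
      by (metis adj inner_adj inner_commute yQx)
    ultimately have "x \<bullet> x = 0" using Qxy[of x x] by simp
    then show False using that by simp
  qed
  from pos_def_lower_bound[OF this] obtain q where q: "q > 0" "\<And>x. q * (norm x)\<^sup>2 \<le> x \<bullet> Q x"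
    by blast
  have "norm X \<le> norm Q * norm (lyap_op S X)" if X: "pos_semidef X" for X
  proof -
    let ?n = "norm (lyap_op S X)"
    let ?D = "?n *\<^sub>R Q - X"
    have "x \<bullet> lyap_op S ?D x \<le> 0" for x
    proof -
      have "- (x \<bullet> lyap_op S X x) \<le> ?n * (norm x)\<^sup>2"
        using quadratic_form_le_norm[of x "- lyap_op S X"] by (simp add: blinfun.bilinear_simps)
      moreover have "lyap_op S ?D = ?n *\<^sub>R (- id_blinfun) - lyap_op S X"
        using linear_diff[OF bounded_linear.linear[OF bounded_linear_lyap_op], of S "?n *\<^sub>R Q" X]
          linear_cmul[OF bounded_linear.linear[OF bounded_linear_lyap_op], of S ?n Q] Q by simp
      ultimately show ?thesis
        by (simp add: blinfun.bilinear_simps inner_diff_right power2_norm_eq_inner)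
    qed
    from lyapunov_positive[OF assms this]
    have "x \<bullet> X x \<le> x \<bullet> (?n *\<^sub>R Q) x" for x by (simp add: blinfun.bilinear_simps inner_diff_right)
    from norm_le_of_quadratic_form_le[OF X this] show ?thesis by (simp add: mult.commute)
  qed
  with adj Qxy q show ?thesis by (rule that)
qed

section \<open>Observability\<close>

lemma op_exp_sums:
  fixes S :: "'a::euclidean_space \<Rightarrow>\<^sub>L 'a"
  shows "(\<lambda>n. (1 / fact n) *\<^sub>R (((\<lambda>Q. S o\<^sub>L Q) ^^ n) id_blinfun)) sums op_exp S"
proof -
  have "(\<lambda>n. Rep_endo (Abs_endo S ^ n /\<^sub>R fact n)) sums Rep_endo (exp (Abs_endo S))"
    by (rule bounded_linear.sums[OF bounded_linear_Rep_endo exp_converges])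
  then show ?thesis
    by (simp add: op_exp_eq_exp scaleR_endo.rep_eq Rep_endo_power Abs_endo_inverse divide_inverse)
qed

text \<open>
  Observability is used through its algebraic form: the output of \<open>e\<^sup>t\<^sup>A x\<close> is a power series in \<open>t\<close> with
  coefficients \<open>C A\<^sup>n x / n!\<close>.
\<close>

lemma observable_imp_zero:
  fixes A :: "'x::euclidean_space \<Rightarrow>\<^sub>L 'x" and C :: "'x \<Rightarrow>\<^sub>L 'h::real_normed_vector"
  assumes "observable A C" and "\<And>n. C ((blinfun_apply A ^^ n) x) = 0"
  shows "x = 0"
proof -
  have "C (op_exp (t *\<^sub>R A) x) = 0" for t
  proof -
    have pow: "((\<lambda>Q. (t *\<^sub>R A) o\<^sub>L Q) ^^ n) id_blinfun x = t ^ n *\<^sub>R (blinfun_apply A ^^ n) x" for n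
      by (induction n) (simp_all add: blinfun.bilinear_simps)
    let ?f = "\<lambda>n. (1 / fact n) *\<^sub>R (((\<lambda>Q. (t *\<^sub>R A) o\<^sub>L Q) ^^ n) id_blinfun)"
    have "(\<lambda>n. C (?f n x)) sums C (op_exp (t *\<^sub>R A) x)"
      by (rule bounded_linear.sums[OF blinfun.bounded_linear_right
            bounded_linear.sums[OF blinfun.bounded_linear_left op_exp_sums]])
    moreover have "C (?f n x) = 0" for n
      by (simp add: blinfun.bilinear_simps pow assms(2))
    ultimately have "(\<lambda>n. 0) sums C (op_exp (t *\<^sub>R A) x)" by simp
    then show ?thesis using sums_0 sums_unique2 by blast
  qed
  then have "\<forall>t\<ge>0. C (op_exp (t *\<^sub>R A) x) = C (op_exp (t *\<^sub>R A) 0)"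
    by (simp add: blinfun.zero_right)
  then show ?thesis using assms(1) unfolding observable_def by blast
qed

lemma psd_form_zero_imp_zero:
  fixes X :: "'a::euclidean_space \<Rightarrow>\<^sub>L 'a"
  assumes "pos_semidef X" and "x \<bullet> X x = 0"
  shows "X x = 0"
proof -
  have "(X x \<bullet> X x)\<^sup>2 \<le> 0"
    using pos_semidef_cauchy_schwarz[OF assms(1), of "X x" x] assms(2) by simp
  then show ?thesis by simp
qed

lemma lyap_op_bounded_below:
  assumes "stable S"
  obtains c where "c \<ge> 0" and "\<And>X. pos_semidef X \<Longrightarrow> norm X \<le> c * norm (lyap_op S X)"
proof (rule lyapunov_function_exists[OF assms])
  fix Q q
  assume "\<And>X. pos_semidef X \<Longrightarrow> norm X \<le> norm Q * norm (lyap_op S X)"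
  then show ?thesis by (rule that[OF norm_ge_zero])
qed

section \<open>The Riccati equation and the Newton iteration\<close>

locale lqr =
  fixes A :: "'x::euclidean_space \<Rightarrow>\<^sub>L 'x" and B :: "(real^'m) \<Rightarrow>\<^sub>L 'x"
    and C :: "'x \<Rightarrow>\<^sub>L 'h::real_inner" and R :: "real^'m^'m"
  assumes stable_A: "stable A" and observable: "observable A C" and R: "symmetric_pos_def_matrix R"
begin

definition cl :: "('x \<Rightarrow>\<^sub>L (real^'m)) \<Rightarrow> ('x \<Rightarrow>\<^sub>L 'x)" where "cl L = A - (B o\<^sub>L L)"

definition cost :: "('x \<Rightarrow>\<^sub>L (real^'m)) \<Rightarrow> ('x \<Rightarrow>\<^sub>L 'x)" where
  "cost L = (adj C o\<^sub>L C) + (adj L o\<^sub>L matrix_op R o\<^sub>L L)"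

definition residual :: "('x \<Rightarrow>\<^sub>L (real^'m)) \<Rightarrow> ('x \<Rightarrow>\<^sub>L 'x) \<Rightarrow> ('x \<Rightarrow>\<^sub>L 'x)" where
  "residual L X = lyap_op (cl L) X + cost L"

definition sq :: "('x \<Rightarrow>\<^sub>L (real^'m)) \<Rightarrow> ('x \<Rightarrow>\<^sub>L 'x)" where
  "sq L = (adj L o\<^sub>L matrix_op R o\<^sub>L L)"

lemma R_sym: "u \<bullet> (R *v v) = (R *v u) \<bullet> v"
  using R by (metis dot_lmul_matrix symmetric_pos_def_matrix_def vector_transpose_matrix)

lemma R_pos: "v \<noteq> 0 \<Longrightarrow> 0 < v \<bullet> (R *v v)" and R_nonneg: "0 \<le> v \<bullet> (R *v v)"
  using R by (auto simp: symmetric_pos_def_matrix_def) (cases "v = 0"; auto simp: less_imp_le)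

lemma R_inverse: "R *v (matrix_inv R *v v) = v"
proof -
  have "inj ((*v) R)"
  proof (rule injI)
    fix u v assume "R *v u = R *v v"
    then have "(u - v) \<bullet> (R *v (u - v)) = 0" by (simp add: matrix_vector_mult_diff_distrib)
    then show "u = v" using R_pos[of "u - v"] by auto
  qed
  then have "invertible R"
    using invertible_left_inverse matrix_left_invertible_injective by blast
  then have "R ** matrix_inv R = mat 1"
    unfolding invertible_def matrix_inv_def by (rule someI_ex[THEN conjunct1])
  then show ?thesis by (metis matrix_vector_mul_assoc matrix_vector_mul_lid)
qed

lemma R_gain: "R *v (gain B R X y) = adj B (X y)"
  by (simp add: gain_def R_inverse)

lemma gain_diff: "gain B R (X - Y) = gain B R X - gain B R Y"
  by (rule blinfun_eqI) (simp add: gain_def blinfun.bilinear_simps matrix_vector_mult_diff_distrib)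

lemma inner_sq: "x \<bullet> sq L y = L x \<bullet> (R *v L y)"
  by (simp add: sq_def inner_adj)

lemma inner_cost: "x \<bullet> cost L y = C x \<bullet> C y + L x \<bullet> (R *v L y)"
  by (simp add: cost_def blinfun.bilinear_simps inner_add inner_adj)

lemma cost_nonneg: "0 \<le> x \<bullet> cost L x" by (simp add: inner_cost R_nonneg)

lemma lyapunov_iff_residual: "lyapunov A B C R L X \<longleftrightarrow> residual L X = 0"
  by (simp add: lyapunov_def residual_def cl_def cost_def lyap_op_def Let_def add.assoc)

text \<open>
  The identity behind the whole iteration: as a function of the gain, the Lyapunov residual of a fixed
  symmetric \<open>X\<close> is quadratic with minimum at \<open>R\<^sup>-\<^sup>1 B\<^sup>* X\<close>, where it is the Riccati residual of \<open>X\<close>.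
\<close>

lemma completing_the_square:
  assumes "adj X = X"
  shows "residual L X = residual (gain B R X) X + sq (L - gain B R X)"
proof -
  let ?K = "gain B R X"
  have BX: "B u \<bullet> X y = u \<bullet> (R *v ?K y)" for u y by (simp add: R_gain inner_adj)
  have XB: "x \<bullet> X (B u) = ?K x \<bullet> (R *v u)" for x u
    using assms inner_adj[of x X "B u"] by (simp add: R_sym R_gain inner_adj_left)
  have "x \<bullet> residual L X y = x \<bullet> (residual ?K X + sq (L - ?K)) y" for x y
    by (simp add: residual_def blinfun.add_left blinfun.add_right blinfun.diff_left blinfun.diff_right
        inner_add_left inner_add_right inner_diff_left inner_diff_right inner_lyap_op inner_cost
        cl_def inner_sq matrix_vector_mult_diff_distrib BX XB)
  then show ?thesis unfolding blinfun_eq_iff_inner by blast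
qed

lemma riccati_iff_residual:
  assumes "adj P = P"
  shows "riccati A B C R P \<longleftrightarrow> residual (gain B R P) P = 0"
proof -
  let ?K = "gain B R P" 
  let ?r = "(adj A o\<^sub>L P) + (P o\<^sub>L A) + (adj C o\<^sub>L C)
       - (P o\<^sub>L B o\<^sub>L matrix_op (matrix_inv R) o\<^sub>L adj B o\<^sub>L P)"
  have BP: "B u \<bullet> P y = u \<bullet> (R *v ?K y)" for u y by (simp add: R_gain inner_adj)
  have PB: "x \<bullet> P (B u) = ?K x \<bullet> (R *v u)" for x u
    using assms inner_adj[of x P "B u"] by (simp add: R_sym R_gain inner_adj_left)
  have K: "matrix_inv R *v adj B (P y) = ?K y" for y by (simp add: gain_def)
  have "x \<bullet> ?r y = x \<bullet> residual ?K P y" for x y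
    by (simp add: residual_def blinfun.add_left blinfun.add_right blinfun.diff_left blinfun.diff_right
        inner_add_left inner_add_right inner_diff_left inner_diff_right inner_lyap_op inner_cost
        cl_def inner_adj K BP PB)
  then have "?r = residual ?K P" unfolding blinfun_eq_iff_inner by blast
  then show ?thesis by (simp add: riccati_def)
qed

lemma residual_diff: "residual L X - residual L Y = lyap_op (cl L) (X - Y)"
  using linear_diff[OF bounded_linear.linear[OF bounded_linear_lyap_op], of "cl L" X Y]
  by (simp add: residual_def)

lemma cost_zero_imp:
  assumes "x \<bullet> cost L x \<le> 0"
  shows "C x = 0" "L x = 0"
proof -
  have "(norm (C x))\<^sup>2 + L x \<bullet> (R *v L x) \<le> 0"
    using assms by (simp add: inner_cost power2_norm_eq_inner)
  then have "(norm (C x))\<^sup>2 = 0" "L x \<bullet> (R *v L x) = 0"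
    using R_nonneg[of "L x"] zero_le_power2[of "norm (C x)"] by linarith+
  then show "C x = 0" "L x = 0" using R_pos[of "L x"] by auto
qed

text \<open>
  If the form of \<open>X\<close> stays constant along a closed-loop trajectory on a time interval, then output and
  control vanish there, and so do all their derivatives.  Without control the closed loop coincides with
  the free dynamics, so observability of \<open>(A, C)\<close> forces the trajectory to be zero.
\<close>

lemma stable_of_lyapunov_inequality:
  assumes X: "pos_def X" and le: "\<And>x. x \<bullet> residual L X x \<le> 0"
  shows "stable (cl L)"
proof (rule stable_of_strict_lyapunov[where P = X])
  have lyap: "x \<bullet> lyap_op (cl L) X x \<le> - (x \<bullet> cost L x)" for x
    using le[of x] by (simp add: residual_def blinfun.bilinear_simps inner_add)
  show "0 < x \<bullet> X x" if "x \<noteq> 0" for x using X that by (simp add: pos_def_def)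
  show "x \<bullet> lyap_op (cl L) X x \<le> 0" for x using lyap[of x] cost_nonneg[of x L] by linarith
  fix x
  let ?E = "\<lambda>t. op_exp (t *\<^sub>R cl L)"
  assume "\<And>t. t \<in> {0<..<1} \<Longrightarrow> ?E t x \<bullet> lyap_op (cl L) X (?E t x) = 0"
  then have z: "C (?E t x) = 0 \<and> L (?E t x) = 0" if "t \<in> {0<..<1}" for t
    using cost_zero_imp[of "?E t x" L] lyap[of "?E t x"] that by auto
  have CL: "\<forall>t\<in>{0<..<1}. C ((blinfun_apply (cl L) ^^ n) (?E t x)) = 0 \<and> L ((blinfun_apply (cl L) ^^ n) (?E t x)) = 0" for n
  proof (induction n)
    case (Suc n)
    have pw: "\<exists>T. \<forall>z. (blinfun_apply (cl L) ^^ n) z = blinfun_apply T z"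
    proof (induction n)
      case 0
      show ?case by (rule exI[of _ id_blinfun]) simp
    next
      case (Suc n)
      then obtain T where "\<forall>z. (blinfun_apply (cl L) ^^ n) z = blinfun_apply T z" by blast
      then show ?case by (intro exI[of _ "cl L o\<^sub>L T"]) simp
    qed
    then obtain T where T: "\<And>z. (blinfun_apply (cl L) ^^ n) z = blinfun_apply T z" by blast
    have TS: "T (cl L z) = cl L (T z)" for z
      unfolding T[symmetric] by (simp add: funpow_swap1)
    have E: "((\<lambda>t. ?E t x) has_vector_derivative cl L (?E t x)) (at t)" for t
      using bounded_linear.has_vector_derivative[OF blinfun.bounded_linear_left[of x]
          op_exp_has_vector_derivative[of "cl L" t UNIV]] by simp
    have zero: "U (T (cl L (?E t x))) = 0" if t: "t \<in> {0<..<1}"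
      and U: "\<forall>t\<in>{0<..<1}. U (T (?E t x)) = 0" for t and U :: "'x \<Rightarrow>\<^sub>L 'y::real_normed_vector"
    proof -
      have "((\<lambda>t. (U o\<^sub>L T) (?E t x)) has_vector_derivative (U o\<^sub>L T) (cl L (?E t x))) (at t)"
        by (rule bounded_linear.has_vector_derivative[OF blinfun.bounded_linear_right E])
      moreover have "((\<lambda>t. (U o\<^sub>L T) (?E t x)) has_vector_derivative 0) (at t)"
        by (rule has_vector_derivative_transform_within_open[OF has_vector_derivative_const[of 0]
              open_greaterThanLessThan t]) (use U in simp)
      ultimately show ?thesis using vector_derivative_unique_at by fastforce
    qed
    show ?case
    proof
      fix t :: real assume t: "t \<in> {0<..<1}"
      show "C ((blinfun_apply (cl L) ^^ Suc n) (?E t x)) = 0 \<and> L ((blinfun_apply (cl L) ^^ Suc n) (?E t x)) = 0"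
        using zero[OF t, of C] zero[OF t, of L] Suc.IH by (simp add: T TS)
    qed
  qed (use z in simp)
  let ?z = "?E (1/2) x"
  have eq: "(blinfun_apply A ^^ n) ?z = (blinfun_apply (cl L) ^^ n) ?z" for n
  proof (induction n)
    case (Suc n)
    have "cl L y = A y" if "L y = 0" for y using that by (simp add: cl_def blinfun.bilinear_simps)
    then show ?case using Suc CL[of n, THEN bspec, of "1/2"] by simp
  qed simp
  have "?z = 0"
    by (rule observable_imp_zero[OF observable]) (use CL[THEN bspec, of "1/2"] eq in simp)
  moreover have "?E (-1/2) ?z = x"
    using arg_cong[OF op_exp_add[of "-1/2" "1/2" "cl L"], of "\<lambda>T. blinfun_apply T x"] by simp
  ultimately show "x = 0" by (metis blinfun.zero_right)
qed

text \<open>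
  The kernel of \<open>X\<close> is invariant under \<open>A\<close> and contained in the kernel of \<open>C\<close>, hence trivial by
  observability.
\<close>

lemma pos_def_of_residual_zero:
  assumes X: "pos_semidef X" and res: "residual L X = 0"
  shows "pos_def X"
proof -
  have lyap: "cl L x \<bullet> X y + x \<bullet> X (cl L y) = - (x \<bullet> cost L y)" for x y
  proof -
    have "x \<bullet> residual L X y = 0" by (simp add: res)
    then show ?thesis by (simp add: residual_def blinfun.bilinear_simps inner_add inner_lyap_op)
  qed
  have sym: "x \<bullet> X y = X x \<bullet> y" for x y using X inner_adj[of x X y] by (simp add: pos_semidef_def)
  have step: "C x = 0 \<and> X (A x) = 0" if "X x = 0" for x
  proof -
    have "x \<bullet> cost L x = 0" using lyap[of x x] that sym[of x "cl L x"] by simp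
    then have z: "C x = 0" "L x = 0" using cost_zero_imp[of x L] by auto
    have "y \<bullet> X (cl L x) = 0" for y
      using lyap[of y x] that z by (simp add: inner_cost)
    then have "X (cl L x) = 0" by (metis inner_eq_zero_iff)
    then show ?thesis using z by (simp add: cl_def blinfun.bilinear_simps)
  qed
  have "0 < x \<bullet> X x" if "x \<noteq> 0" for x
  proof (rule ccontr)
    assume "\<not> 0 < x \<bullet> X x"
    then have "x \<bullet> X x = 0" using X by (metis pos_semidef_def less_eq_real_def)
    then have "X x = 0" by (rule psd_form_zero_imp_zero[OF X])
    then have "X ((blinfun_apply A ^^ n) x) = 0" for n by (induction n) (use step in auto)
    then have "x = 0" by (intro observable_imp_zero[OF observable]) (use step in blast)
    then show False using that by simp
  qed
  then show ?thesis using X by (simp add: pos_def_def pos_semidef_def)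
qed

lemma adj_cost: "adj (cost L) = cost L"
proof -
  have "cost L x \<bullet> y = x \<bullet> cost L y" for x y
    using inner_cost[of y L x] inner_cost[of x L y] R_sym[of "L x" "L y"]
    by (simp add: inner_commute[of "cost L x"] inner_commute[of "C y"] inner_commute[of "L y"])
  then show ?thesis by (simp add: blinfun_eq_iff_inner inner_adj)
qed

lemma adj_residual_zero:
  assumes "stable (cl L)" and "residual L X = 0"
  shows "adj X = X"
proof (rule lyap_op_injective[OF assms(1)])
  have "lyap_op (cl L) X = - cost L" using assms(2) by (simp add: residual_def eq_neg_iff_add_eq_0)
  then show "lyap_op (cl L) (adj X) = lyap_op (cl L) X"
    by (simp add: lyap_op_adj linear_neg[OF bounded_linear.linear[OF bounded_linear_adj]] adj_cost)
qed

lemma lyapunov_sol: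
  assumes "stable (cl L)"
  shows "pos_def (lyapunov_sol A B C R L)" "residual L (lyapunov_sol A B C R L) = 0"
    and "\<And>Y. residual L Y = 0 \<Longrightarrow> Y = lyapunov_sol A B C R L"
proof -
  obtain X where "lyap_op (cl L) X = - cost L" using lyapunov_solvable[OF assms] by blast
  then have X: "residual L X = 0" by (simp add: residual_def)
  have unique: "Y = X" if "residual L Y = 0" for Y
    by (rule lyap_op_injective[OF assms]) (use that X in \<open>metis residual_def add_right_cancel\<close>)
  have "x \<bullet> lyap_op (cl L) X x \<le> 0" for x
    using X cost_nonneg[of x L] by (simp add: residual_def add_eq_0_iff2 blinfun.minus_left)
  then have "0 \<le> x \<bullet> X x" for x by (rule lyapunov_positive[OF assms])
  then have psd: "pos_semidef X" using adj_residual_zero[OF assms X] by (simp add: pos_semidef_def)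
  have sol: "lyapunov_sol A B C R L = X"
    unfolding lyapunov_sol_def
  proof (rule the_equality)
    show "pos_semidef X \<and> lyapunov A B C R L X" using psd X by (simp add: lyapunov_iff_residual)
    show "Y = X" if "pos_semidef Y \<and> lyapunov A B C R L Y" for Y
      using unique[of Y] that by (simp add: lyapunov_iff_residual)
  qed
  show "pos_def (lyapunov_sol A B C R L)" unfolding sol by (rule pos_def_of_residual_zero[OF psd X])
  show "residual L (lyapunov_sol A B C R L) = 0" unfolding sol by (rule X)
  show "\<And>Y. residual L Y = 0 \<Longrightarrow> Y = lyapunov_sol A B C R L" unfolding sol by (rule unique)
qed

abbreviation "Lk \<equiv> L_seq A B C R"
abbreviation "Pk \<equiv> P_seq A B C R"

lemma Lk_Suc: "Lk (Suc k) = gain B R (Pk k)" by (simp add: P_seq_def)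

declare L_seq.simps(2) [simp del]

lemma pos_def_sym: "pos_def X \<Longrightarrow> adj X = X" by (simp add: pos_def_def)

lemma residual_gain:
  assumes "adj X = X" and "residual L X = 0"
  shows "residual (gain B R X) X = - sq (L - gain B R X)"
  using completing_the_square[OF assms(1), of L] assms(2) by (simp add: eq_neg_iff_add_eq_0)

text \<open>
  By completing the square, \<open>P\<^sub>k\<close> satisfies the Lyapunov inequality for the next gain; being positive
  definite it certifies stability of the next closed loop.
\<close>

lemma stable_cl_Lk: "stable (cl (Lk k))"
proof (induction k)
  case 0
  have "cl (Lk 0) = A" by (rule blinfun_eqI) (simp add: cl_def blinfun.bilinear_simps)
  then show ?case using stable_A by simp
next
  case (Suc k)
  note P = lyapunov_sol(1,2)[OF Suc, folded P_seq_def]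
  show ?case unfolding Lk_Suc
  proof (rule stable_of_lyapunov_inequality[OF P(1)])
    show "x \<bullet> residual (gain B R (Pk k)) (Pk k) x \<le> 0" for x
      unfolding residual_gain[OF pos_def_sym[OF P(1)] P(2)]
      by (simp add: blinfun.bilinear_simps inner_sq[unfolded blinfun.bilinear_simps] inner_sq R_nonneg)
  qed
qed

lemmas Pk_pos_def = lyapunov_sol(1)[OF stable_cl_Lk, folded P_seq_def]
lemmas Pk_residual = lyapunov_sol(2)[OF stable_cl_Lk, folded P_seq_def]
lemmas Pk_unique = lyapunov_sol(3)[OF stable_cl_Lk, folded P_seq_def]
lemmas Pk_sym = pos_def_sym[OF Pk_pos_def]

lemma adj_diff: 
  fixes X Y :: "'x \<Rightarrow>\<^sub>L 'x"
  assumes "adj X = X" "adj Y = Y" 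
  shows "adj (X - Y) = X - Y"
  using assms by (simp add: linear_diff[OF bounded_linear.linear[OF bounded_linear_adj]])

lemma op_leI:
  assumes "stable (cl L)" "adj X = X" "adj Y = Y" "residual L Y = residual L X + sq D"
  shows "op_le Y X"
  unfolding op_le_def pos_semidef_def
proof
  show "adj (X - Y) = X - Y" by (rule adj_diff[OF assms(2,3)])
  have "lyap_op (cl L) (X - Y) = - sq D" using residual_diff[of L X Y] assms(4) by simp
  then have "x \<bullet> lyap_op (cl L) (X - Y) x \<le> 0" for x
    by (simp add: blinfun.minus_left inner_sq R_nonneg)
  then show "\<forall>x. 0 \<le> x \<bullet> (X - Y) x" using lyapunov_positive[OF assms(1)] by blast
qed

lemma Pk_decreasing: "op_le (Pk (Suc k)) (Pk k)"
proof -
  have "residual (Lk (Suc k)) (Pk k) = - sq (Lk k - gain B R (Pk k))"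
    unfolding Lk_Suc by (rule residual_gain[OF Pk_sym Pk_residual])
  then show ?thesis
    by (intro op_leI[OF stable_cl_Lk[of "Suc k"] Pk_sym Pk_sym, where D = "Lk k - gain B R (Pk k)"])
      (simp add: Pk_residual)
qed

lemma riccati_residual:
  assumes "pos_def P" "riccati A B C R P"
  shows "residual (gain B R P) P = 0"
  using assms riccati_iff_residual[OF pos_def_sym] by blast

lemma riccati_stable:
  assumes "pos_def P" "riccati A B C R P"
  shows "stable (cl (gain B R P))"
  by (rule stable_of_lyapunov_inequality[OF assms(1)])
     (simp add: riccati_residual[OF assms] blinfun.zero_left)

lemma riccati_le:
  assumes P: "pos_def P" "riccati A B C R P" and L: "stable (cl L)" "residual L X = 0"
  shows "op_le P X"
proof (rule op_leI[OF L(1)])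
  show "residual L P = residual L X + sq (L - gain B R P)"
    using completing_the_square[OF pos_def_sym[OF P(1)], of L] riccati_residual[OF P] L(2) by simp
qed (use adj_residual_zero[OF L] pos_def_sym[OF P(1)] in auto)

lemma op_le_antisym:
  fixes X Y :: "'x \<Rightarrow>\<^sub>L 'x"
  assumes "op_le X Y" "op_le Y X"
  shows "X = Y"
proof -
  have "norm (Y - X) \<le> norm (0 :: 'x \<Rightarrow>\<^sub>L 'x)"
    using assms by (intro norm_le_of_quadratic_form_le)
      (auto simp: op_le_def pos_semidef_def blinfun.bilinear_simps inner_diff_right)
  then show ?thesis by simp
qed

lemma riccati_unique:
  assumes "pos_def P" "riccati A B C R P" "pos_def P'" "riccati A B C R P'"
  shows "P = P'"
  using op_le_antisym riccati_le[OF assms(1,2) riccati_stable[OF assms(3,4)] riccati_residual[OF assms(3,4)]]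
    riccati_le[OF assms(3,4) riccati_stable[OF assms(1,2)] riccati_residual[OF assms(1,2)]] by blast

lemma Pk_antimono: "j \<le> k \<Longrightarrow> x \<bullet> Pk k x \<le> x \<bullet> Pk j x"
proof (rule lift_Suc_antimono_le[of "\<lambda>k. x \<bullet> Pk k x"])
  show "x \<bullet> Pk (Suc n) x \<le> x \<bullet> Pk n x" for n
    using Pk_decreasing[of n] by (simp add: op_le_def pos_semidef_def blinfun.bilinear_simps inner_diff_right)
qed

lemma tendsto_residual:
  assumes "L \<longlonglongrightarrow> L'" "X \<longlonglongrightarrow> X'"
  shows "(\<lambda>k. residual (L k) (X k)) \<longlonglongrightarrow> residual L' X'"
proof -
  have comp: "(\<lambda>k. f k o\<^sub>L g k) \<longlonglongrightarrow> (a o\<^sub>L b)" if "f \<longlonglongrightarrow> a" "g \<longlonglongrightarrow> b"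
    for f :: "nat \<Rightarrow> 'b::real_normed_vector \<Rightarrow>\<^sub>L 'c::real_normed_vector" and g :: "nat \<Rightarrow> 'a::real_normed_vector \<Rightarrow>\<^sub>L 'b" and a b
    using bounded_bilinear.tendsto[OF bounded_bilinear_blinfun_compose that] .
  note adj = bounded_linear.tendsto[OF bounded_linear_adj]
  show ?thesis unfolding residual_def lyap_op_def cl_def cost_def
    by (intro tendsto_add comp adj tendsto_diff tendsto_const assms)
qed

text \<open>
  The iterates decrease and are bounded below by \<open>0\<close>.  A subsequence converges by compactness, and
  monotonicity of the norm on positive operators upgrades this to convergence of the whole sequence.
  Passing to the limit in the Lyapunov equations gives the Riccati equation.
\<close>

lemma riccati_solution_exists:
  obtains X where "pos_def X" "riccati A B C R X" "Pk \<longlonglongrightarrow> X"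
proof -
  have psd: "pos_semidef (Pk k)" for k by (rule pos_def_imp_pos_semidef[OF Pk_pos_def])
  have "norm (Pk k) \<le> norm (Pk 0)" for k
    by (rule norm_le_of_quadratic_form_le[OF psd]) (rule Pk_antimono, simp)
  then have "bounded (range Pk)" by (auto simp: bounded_iff)
  then obtain X r where r: "strict_mono r" "(Pk \<circ> r) \<longlonglongrightarrow> X"
    using bounded_imp_convergent_subsequence by blast
  have "(\<lambda>j. adj ((Pk \<circ> r) j)) \<longlonglongrightarrow> adj X" by (rule bounded_linear.tendsto[OF bounded_linear_adj r(2)])
  then have adjX: "adj X = X" using r(2) by (simp add: o_def Pk_sym LIMSEQ_unique)
  have form: "(\<lambda>j. x \<bullet> (Pk \<circ> r) j x) \<longlonglongrightarrow> x \<bullet> X x" for x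
    by (intro tendsto_inner tendsto_const blinfun.tendsto r)
  have psdX: "pos_semidef X" unfolding pos_semidef_def
  proof (intro conjI allI adjX)
    show "0 \<le> x \<bullet> X x" for x
      by (rule LIMSEQ_le_const[OF form]) (use psd in \<open>auto simp: pos_semidef_def\<close>)
  qed
  have above: "x \<bullet> X x \<le> x \<bullet> Pk k x" for x k
  proof (rule LIMSEQ_le_const2[OF form], intro exI allI impI)
    fix j assume "k \<le> j"
    then show "x \<bullet> (Pk \<circ> r) j x \<le> x \<bullet> Pk k x"
      using seq_suble[OF r(1), of j] by (auto intro!: Pk_antimono)
  qed
  have mono: "norm (Pk k - X) \<le> norm (Pk j - X)" if "j \<le> k" for j k
  proof (rule norm_le_of_quadratic_form_le)
    show "pos_semidef (Pk k - X)" unfolding pos_semidef_def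
      using adj_diff[OF Pk_sym adjX] above by (auto simp: blinfun.bilinear_simps inner_diff_right)
  qed (use Pk_antimono[OF that] in \<open>auto simp: blinfun.bilinear_simps inner_diff_right\<close>)
  have lim: "Pk \<longlonglongrightarrow> X"
  proof (rule LIMSEQ_I)
    fix e :: real assume "e > 0"
    then obtain j where "norm ((Pk \<circ> r) j - X) < e" using LIMSEQ_D[OF r(2), of e] by blast
    then show "\<exists>no. \<forall>n\<ge>no. norm (Pk n - X) < e"
      by (intro exI[of _ "r j"]) (auto intro: le_less_trans[OF mono])
  qed
  have L: "(\<lambda>k. Lk (Suc k)) \<longlonglongrightarrow> gain B R X"
    unfolding Lk_Suc gain_def
    by (intro bounded_bilinear.tendsto[OF bounded_bilinear_blinfun_compose] tendsto_const lim)
  have "(\<lambda>k. residual (Lk (Suc k)) (Pk (Suc k))) \<longlonglongrightarrow> residual (gain B R X) X"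
    by (rule tendsto_residual[OF L LIMSEQ_Suc[OF lim]])
  then have res: "residual (gain B R X) X = 0" by (simp add: Pk_residual LIMSEQ_const_iff)
  show ?thesis
    by (rule that[OF pos_def_of_residual_zero[OF psdX res] _ lim])
       (use riccati_iff_residual[OF adjX] res in simp)
qed

lemma norm_sq_le: "norm (sq L) \<le> norm (matrix_op R) * (norm L)\<^sup>2"
proof -
  have "norm (sq L) \<le> norm (adj L) * norm (matrix_op R) * norm L"
    unfolding sq_def by (meson norm_blinfun_compose mult_right_mono norm_ge_zero order_trans)
  also have "\<dots> \<le> norm L * norm (matrix_op R) * norm L"
    by (intro mult_right_mono norm_adj_le) auto
  finally show ?thesis by (simp add: power2_eq_square mult_ac)
qed

lemma norm_gain_le: "norm (gain B R X) \<le> norm (matrix_op (matrix_inv R) o\<^sub>L adj B) * norm X"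
  unfolding gain_def by (rule norm_blinfun_compose)

context
  fixes P assumes P: "pos_def P" "riccati A B C R P"
begin

lemma Pk_tendsto: "Pk \<longlonglongrightarrow> P"
  by (metis P riccati_solution_exists riccati_unique)

lemma P_le_Pk: "op_le P (Pk k)"
  by (rule riccati_le[OF P stable_cl_Lk Pk_residual])

lemma error_norm_antimono: "norm (Pk (Suc k) - P) \<le> norm (Pk k - P)"
  by (rule norm_le_of_quadratic_form_le)
     (use P_le_Pk[of "Suc k"] Pk_antimono[of k "Suc k"] in
       \<open>auto simp: op_le_def blinfun.bilinear_simps inner_diff_right\<close>)

text \<open>
  The error \<open>E'\<close> of the next iterate solves \<open>S'\<^sup>* E' + E' S' = - D\<^sup>* R D\<close>, where \<open>D = R\<^sup>-\<^sup>1 B\<^sup>* E\<close> is linear in the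
  current error \<open>E\<close> and \<open>S'\<close> is the drift of the next closed loop.  Replacing \<open>S'\<close> by the fixed drift \<open>S\<close> of
  the limit costs a term of size \<open>norm D * norm E'\<close>, which is quadratic in \<open>E\<close> since \<open>norm E' \<le> norm E\<close>.  Thus one
  constant, that of \<open>S\<close>, serves all \<open>k\<close>.
\<close>

lemma quadratic_convergence:
  "\<exists>c>0. \<forall>k. norm (Pk (Suc k) - P) \<le> c * (norm (Pk k - P))\<^sup>2"
proof -
  let ?S = "cl (gain B R P)"
  obtain b where b: "b \<ge> 0" and Q: "\<And>X. pos_semidef X \<Longrightarrow> norm X \<le> b * norm (lyap_op ?S X)"
    by (rule lyap_op_bounded_below[OF riccati_stable[OF P]]) blast
  define g where "g = norm (matrix_op (matrix_inv R) o\<^sub>L adj B)"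
  define c where "c = b * (norm (matrix_op R) * g\<^sup>2 + 2 * norm B * g)"
  have "norm (Pk (Suc k) - P) \<le> c * (norm (Pk k - P))\<^sup>2" for k
  proof -
    let ?E' = "Pk (Suc k) - P" and ?E = "Pk k - P" and ?L = "Lk (Suc k)"
    define D where "D = gain B R ?E"
    have D: "?L = gain B R P + D" by (simp add: D_def gain_diff Lk_Suc)
    have nD: "norm D \<le> g * norm ?E" unfolding D_def g_def by (rule norm_gain_le)
    have "lyap_op (cl ?L) ?E' = - sq D"
      using residual_diff[of ?L "Pk (Suc k)" P] completing_the_square[OF pos_def_sym[OF P(1)], of ?L]
        riccati_residual[OF P] Pk_residual[of "Suc k"] by (simp add: D)
    moreover have "lyap_op ?S ?E' = lyap_op (cl ?L) ?E' + ((adj (B o\<^sub>L D) o\<^sub>L ?E') + (?E' o\<^sub>L (B o\<^sub>L D)))"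
      unfolding blinfun_eq_iff_inner inner_lyap_op D cl_def
      by (simp add: blinfun.bilinear_simps inner_add inner_diff inner_lyap_op inner_adj)
    ultimately have "norm (lyap_op ?S ?E') \<le> norm (sq D) + (norm (adj (B o\<^sub>L D) o\<^sub>L ?E') + norm (?E' o\<^sub>L (B o\<^sub>L D)))"
      by (metis norm_triangle_le norm_triangle_ineq add_left_mono norm_minus_cancel)
    also have "norm (adj (B o\<^sub>L D) o\<^sub>L ?E') \<le> norm (B o\<^sub>L D) * norm ?E'"
      by (meson norm_blinfun_compose mult_right_mono norm_ge_zero order_trans norm_adj_le)
    also have "norm (?E' o\<^sub>L (B o\<^sub>L D)) \<le> norm (B o\<^sub>L D) * norm ?E'"
      using norm_blinfun_compose[of ?E' "B o\<^sub>L D"] by (simp add: mult.commute)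
    also have "norm (B o\<^sub>L D) * norm ?E' + norm (B o\<^sub>L D) * norm ?E' \<le> 2 * (norm B * (g * norm ?E)) * norm ?E"
    proof -
      have "norm (B o\<^sub>L D) \<le> norm B * (g * norm ?E)"
        by (rule order_trans[OF norm_blinfun_compose mult_left_mono[OF nD]]) simp
      then have "norm (B o\<^sub>L D) * norm ?E' \<le> (norm B * (g * norm ?E)) * norm ?E"
        by (intro mult_mono error_norm_antimono) (auto intro: order_trans[OF norm_ge_zero])
      then show ?thesis by simp
    qed
    also have "norm (sq D) \<le> norm (matrix_op R) * (g * norm ?E)\<^sup>2"
      by (rule order_trans[OF norm_sq_le mult_left_mono[OF power_mono[OF nD]]]) auto
    finally have l: "norm (lyap_op ?S ?E') \<le> (norm (matrix_op R) * g\<^sup>2 + 2 * norm B * g) * (norm ?E)\<^sup>2"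
      by (simp add: power2_eq_square algebra_simps)
    have "norm ?E' \<le> b * norm (lyap_op ?S ?E')"
      by (rule Q[OF P_le_Pk[of "Suc k", unfolded op_le_def]])
    also have "\<dots> \<le> b * ((norm (matrix_op R) * g\<^sup>2 + 2 * norm B * g) * (norm ?E)\<^sup>2)"
      by (rule mult_left_mono[OF l b])
    finally show ?thesis by (simp add: c_def mult.assoc)
  qed
  then have "norm (Pk (Suc k) - P) \<le> (\<bar>c\<bar> + 1) * (norm (Pk k - P))\<^sup>2" for k
    by (rule order_trans) (intro mult_right_mono, auto)
  then show ?thesis by (intro exI[of _ "\<bar>c\<bar> + 1"]) (auto simp: add_nonneg_pos)
qed

text \<open>
  The Riccati residual of \<open>P\<^sub>k\<close> is minus the square of the last change of gain.  Compared with the Riccati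
  solution this gives \<open>S\<^sup>* E + E S = e\<^sup>* R e - d\<^sup>* R d\<close>, with \<open>e\<close> and \<open>d\<close> the gains of the error \<open>E = P\<^sub>k - P\<close> and of
  the increment \<open>P\<^sub>k - P\<^sub>k\<^sub>-\<^sub>1\<close>.  Once \<open>E\<close> is small, its square is absorbed into the left-hand side.
\<close>

lemma error_le_increment:
  "\<exists>c>0. \<exists>\<delta>>0. \<forall>k\<ge>1. norm (P - Pk k) < \<delta> \<longrightarrow> norm (Pk k - P) \<le> c * (norm (Pk k - Pk (k - 1)))\<^sup>2"
proof -
  let ?S = "cl (gain B R P)"
  obtain b where b: "b \<ge> 0" and Q: "\<And>X. pos_semidef X \<Longrightarrow> norm X \<le> b * norm (lyap_op ?S X)"
    by (rule lyap_op_bounded_below[OF riccati_stable[OF P]]) blast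
  define g where "g = norm (matrix_op (matrix_inv R) o\<^sub>L adj B)"
  define a where "a = b * norm (matrix_op R) * g\<^sup>2 + 1"
  have a: "a > 0" using b by (auto simp: a_def add_nonneg_pos)
  have "norm (Pk k - P) \<le> 2 * a * (norm (Pk k - Pk (k - 1)))\<^sup>2"
    if k: "k \<ge> 1" and near: "norm (P - Pk k) < 1 / (2 * a)" for k
  proof -
    let ?E = "Pk k - P" and ?d = "Pk k - Pk (k - 1)"
    have Lk: "Lk k = gain B R (Pk (k - 1))" using k Lk_Suc[of "k - 1"] by simp
    have "residual (gain B R (Pk k)) (Pk k) = - sq (- gain B R ?d)"
      unfolding residual_gain[OF Pk_sym Pk_residual] Lk by (simp add: gain_diff)
    then have "residual (gain B R P) (Pk k) = - sq (- gain B R ?d) + sq (- gain B R ?E)"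
      using completing_the_square[OF Pk_sym, of "gain B R P" k] by (simp add: gain_diff)
    then have "lyap_op ?S ?E = sq (- gain B R ?E) - sq (- gain B R ?d)"
      using residual_diff[of "gain B R P" "Pk k" P] riccati_residual[OF P] by simp
    then have "norm (lyap_op ?S ?E) \<le> norm (sq (- gain B R ?E)) + norm (sq (- gain B R ?d))"
      by (metis norm_triangle_ineq4)
    also have "\<dots> \<le> norm (matrix_op R) * (g * norm ?E)\<^sup>2 + norm (matrix_op R) * (g * norm ?d)\<^sup>2"
      unfolding g_def
      by (intro add_mono order_trans[OF norm_sq_le] mult_left_mono power_mono) (auto simp: norm_gain_le)
    finally have l: "norm (lyap_op ?S ?E) \<le> norm (matrix_op R) * g\<^sup>2 * ((norm ?E)\<^sup>2 + (norm ?d)\<^sup>2)"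
      by (simp add: power_mult_distrib algebra_simps)
    have "norm ?E \<le> b * norm (lyap_op ?S ?E)" by (rule Q[OF P_le_Pk[unfolded op_le_def]])
    also have "\<dots> \<le> b * (norm (matrix_op R) * g\<^sup>2 * ((norm ?E)\<^sup>2 + (norm ?d)\<^sup>2))"
      by (rule mult_left_mono[OF l b])
    also have "\<dots> = (b * norm (matrix_op R) * g\<^sup>2) * ((norm ?E)\<^sup>2 + (norm ?d)\<^sup>2)"
      by (simp add: mult_ac)
    also have "\<dots> \<le> a * ((norm ?E)\<^sup>2 + (norm ?d)\<^sup>2)" by (intro mult_right_mono) (auto simp: a_def)
    finally have 1: "norm ?E \<le> a * (norm ?E)\<^sup>2 + a * (norm ?d)\<^sup>2" by (simp add: distrib_left)
    have "a * norm ?E \<le> 1 / 2" using near a by (simp add: norm_minus_commute field_simps)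
    then have "a * norm ?E * norm ?E \<le> 1 / 2 * norm ?E" by (rule mult_right_mono) simp
    then have "a * (norm ?E)\<^sup>2 \<le> norm ?E / 2" by (simp add: power2_eq_square mult_ac)
    with 1 show ?thesis by simp
  qed
  then show ?thesis using a by (intro exI[of _ "2 * a"] conjI exI[of _ "1 / (2 * a)"]) auto
qed

end
end

section \<open>Absolutely continuous paths\<close>

text \<open>
  Integration by parts for indefinite Lebesgue integrals.  The controls are merely square integrable,
  so the paths need not be differentiable at every time; Fubini on the two triangles \<open>s \<le> t\<close> and \<open>t < s\<close>
  replaces the fundamental theorem of calculus.
\<close>

lemma ac_product_rule:
  fixes f g F G :: "real \<Rightarrow> real"
  assumes T: "0 \<le> T" and f: "set_integrable lborel {0..T} f" and g: "set_integrable lborel {0..T} g"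
    and F: "\<And>t. t \<in> {0..T} \<Longrightarrow> F t = F 0 + (LBINT s:{0..t}. f s)"
    and G: "\<And>t. t \<in> {0..T} \<Longrightarrow> G t = G 0 + (LBINT s:{0..t}. g s)"
  shows "set_integrable lborel {0..T} (\<lambda>t. f t * G t + F t * g t)"
    and "F T * G T = F 0 * G 0 + (LBINT t:{0..T}. f t * G t + F t * g t)"
proof -
  define f' g' where "f' s = indicat_real {0..T} s * f s" and "g' s = indicat_real {0..T} s * g s" for s
  have f'[measurable]: "integrable lborel f'" and g'[measurable]: "integrable lborel g'"
    using f g by (simp_all add: set_integrable_def f'_def[abs_def] g'_def[abs_def])
  note [measurable] = borel_measurable_integrable[OF f'] borel_measurable_integrable[OF g']
  let ?P = "lborel \<Otimes>\<^sub>M (lborel :: real measure)"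
  have prod: "integrable ?P (\<lambda>(s, t). f' s * g' t)"
  proof (rule lborel_pair.Fubini_integrable)
    show "integrable lborel (\<lambda>s. \<integral>t. norm (case (s, t) of (s, t) \<Rightarrow> f' s * g' t) \<partial>lborel)"
      using f' g' by (simp add: abs_mult)
    show "AE s in lborel. integrable lborel (\<lambda>t. case (s, t) of (s, t) \<Rightarrow> f' s * g' t)"
      using g' by simp
  qed measurable
  define h1 h2 where "h1 s t = (if s \<le> t then f' s * g' t else 0)"
    and "h2 s t = (if t < s then f' s * g' t else 0)" for s t
  have h1: "integrable ?P (case_prod h1)"
    by (rule Bochner_Integration.integrable_bound[OF prod]) (auto simp: h1_def[abs_def] split_beta)
  have h2: "integrable ?P (case_prod h2)"
    by (rule Bochner_Integration.integrable_bound[OF prod]) (auto simp: h2_def[abs_def] split_beta)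
  have i1: "(\<integral>s. h1 s t \<partial>lborel) = g' t * (F t - F 0)" for t
  proof (cases "t \<in> {0..T}")
    case True
    have "(\<integral>s. h1 s t \<partial>lborel) = (\<integral>s. g' t * (indicat_real {0..t} s * f s) \<partial>lborel)"
      using True by (intro Bochner_Integration.integral_cong) (auto simp: h1_def f'_def indicator_def)
    then show ?thesis using F[OF True] by (simp add: set_lebesgue_integral_def)
  next
    case False
    then have "g' t = 0" by (simp add: g'_def)
    then show ?thesis by (simp add: h1_def cong: if_cong)
  qed
  have i2: "(\<integral>t. h2 s t \<partial>lborel) = f' s * (G s - G 0)" for s
  proof (cases "s \<in> {0..T}")
    case True
    have "(\<integral>t. h2 s t \<partial>lborel) = (\<integral>t. f' s * (indicat_real {0..<s} t * g t) \<partial>lborel)"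
      using True by (intro Bochner_Integration.integral_cong) (auto simp: h2_def g'_def indicator_def)
    also have "\<dots> = f' s * (LBINT t:{0..<s}. g t)" by (simp add: set_lebesgue_integral_def)
    also have "(LBINT t:{0..<s}. g t) = (LBINT t:{0..s}. g t)"
      by (rule set_integral_discrete_difference[where X = "{s}"]) (use True in auto)
    finally show ?thesis using G[OF True] by simp
  next
    case False
    then have "f' s = 0" by (simp add: f'_def)
    then show ?thesis by (simp add: h2_def cong: if_cong)
  qed
  have I1: "integrable lborel (\<lambda>t. g' t * (F t - F 0))"
    "integral\<^sup>L ?P (case_prod h1) = (\<integral>t. g' t * (F t - F 0) \<partial>lborel)"
    using lborel_pair.integrable_snd[OF h1] lborel_pair.integral_snd[OF h1] by (simp_all add: i1)
  have I2: "integrable lborel (\<lambda>s. f' s * (G s - G 0))"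
    "integral\<^sup>L ?P (case_prod h2) = (\<integral>s. f' s * (G s - G 0) \<partial>lborel)"
    using lborel_pair.integrable_fst[OF h2] lborel_pair.integral_fst[OF h2]
    by (simp_all add: i2)
  have ends: "(\<integral>s. f' s \<partial>lborel) = F T - F 0" "(\<integral>s. g' s \<partial>lborel) = G T - G 0"
    using F[of T] G[of T] T by (simp_all add: set_lebesgue_integral_def f'_def g'_def)
  have "(F T - F 0) * (G T - G 0) = integral\<^sup>L ?P (\<lambda>(s, t). f' s * g' t)"
    using lborel_pair.integral_fst[OF prod] by (simp add: ends)
  also have "\<dots> = integral\<^sup>L ?P (\<lambda>x. case_prod h1 x + case_prod h2 x)"
    by (rule Bochner_Integration.integral_cong) (auto simp: h1_def h2_def)
  also have "\<dots> = (\<integral>t. g' t * (F t - F 0) \<partial>lborel) + (\<integral>s. f' s * (G s - G 0) \<partial>lborel)"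
    using h1 h2 by (simp add: I1 I2)
  finally have eq: "(F T - F 0) * (G T - G 0) = (\<integral>t. g' t * (F t - F 0) \<partial>lborel) + (\<integral>s. f' s * (G s - G 0) \<partial>lborel)" .
  have int: "integrable lborel (\<lambda>t. (g' t * (F t - F 0) + f' t * (G t - G 0)) + (G 0 * f' t + F 0 * g' t))"
    by (intro Bochner_Integration.integrable_add I1 I2 integrable_mult_right f' g')
  have same: "(g' t * (F t - F 0) + f' t * (G t - G 0)) + (G 0 * f' t + F 0 * g' t)
      = indicat_real {0..T} t *\<^sub>R (f t * G t + F t * g t)" for t
    by (simp add: f'_def g'_def algebra_simps)
  show "set_integrable lborel {0..T} (\<lambda>t. f t * G t + F t * g t)"
    using int unfolding set_integrable_def same .
  have "(LBINT t:{0..T}. f t * G t + F t * g t)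
      = ((\<integral>t. g' t * (F t - F 0) \<partial>lborel) + (\<integral>s. f' s * (G s - G 0) \<partial>lborel))
        + (G 0 * (\<integral>s. f' s \<partial>lborel) + F 0 * (\<integral>s. g' s \<partial>lborel))"
    unfolding set_lebesgue_integral_def same[symmetric]
    using I1 I2 f' g' by simp
  then show "F T * G T = F 0 * G 0 + (LBINT t:{0..T}. f t * G t + F t * g t)"
    unfolding eq[symmetric] ends by (simp add: algebra_simps)
qed

lemma set_integrable_bounded_linear:
  fixes f :: "real \<Rightarrow> 'a::euclidean_space"
  assumes "bounded_linear T" "set_integrable lborel A f"
  shows "set_integrable lborel A (\<lambda>s. T (f s) :: 'b::euclidean_space)"
    and "(LINT s:A|lborel. T (f s)) = T (LINT s:A|lborel. f s)"
proof -
  interpret bounded_linear T by fact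
  have "(\<lambda>s. indicator A s *\<^sub>R T (f s)) = (\<lambda>s. T (indicator A s *\<^sub>R f s))" by (simp add: scaleR)
  then show "set_integrable lborel A (\<lambda>s. T (f s))" "(LINT s:A|lborel. T (f s)) = T (LINT s:A|lborel. f s)"
    using integrable_bounded_linear[OF assms(1), of lborel "\<lambda>s. indicator A s *\<^sub>R f s"]
      integral_bounded_linear[OF assms(1), of lborel "\<lambda>s. indicator A s *\<^sub>R f s"] assms(2)
    by (simp_all add: set_integrable_def set_lebesgue_integral_def)
qed

lemma ac_inner_product_rule:
  fixes f g F G :: "real \<Rightarrow> 'a::euclidean_space"
  assumes T: "0 \<le> T" and f: "set_integrable lborel {0..T} f" and g: "set_integrable lborel {0..T} g"
    and F: "\<And>t. t \<in> {0..T} \<Longrightarrow> F t = F 0 + (LBINT s:{0..t}. f s)"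
    and G: "\<And>t. t \<in> {0..T} \<Longrightarrow> G t = G 0 + (LBINT s:{0..t}. g s)"
  shows "set_integrable lborel {0..T} (\<lambda>t. f t \<bullet> G t + F t \<bullet> g t)"
    and "F T \<bullet> G T = F 0 \<bullet> G 0 + (LBINT t:{0..T}. f t \<bullet> G t + F t \<bullet> g t)"
proof -
  have comp: "H t \<bullet> i = H 0 \<bullet> i + (LBINT s:{0..t}. h s \<bullet> i)"
    if "t \<in> {0..T}" "set_integrable lborel {0..T} h"
      "H t = H 0 + (LBINT s:{0..t}. h s)" for H h :: "real \<Rightarrow> 'a" and t i
  proof -
    have "set_integrable lborel {0..t} h" using that by (auto intro: set_integrable_subset)
    from set_integrable_bounded_linear(2)[OF bounded_linear_inner_left this]
    show ?thesis using that(3) by (simp add: inner_add_left)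
  qed
  have fi: "set_integrable lborel {0..T} (\<lambda>s. h s \<bullet> i)" if "set_integrable lborel {0..T} h"
    for h :: "real \<Rightarrow> 'a" and i
    by (rule set_integrable_bounded_linear(1)[OF bounded_linear_inner_left that])
  have Fi: "F t \<bullet> i = F 0 \<bullet> i + (LBINT s:{0..t}. f s \<bullet> i)" if "t \<in> {0..T}" for t i
    by (rule comp[OF that f F[OF that]])
  have Gi: "G t \<bullet> i = G 0 \<bullet> i + (LBINT s:{0..t}. g s \<bullet> i)" if "t \<in> {0..T}" for t i
    by (rule comp[OF that g G[OF that]])
  note R = ac_product_rule[OF T fi[OF f] fi[OF g] Fi Gi]
  have e: "f t \<bullet> G t + F t \<bullet> g t = (\<Sum>i\<in>Basis. (f t \<bullet> i) * (G t \<bullet> i) + (F t \<bullet> i) * (g t \<bullet> i))" for t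
    unfolding euclidean_inner[of "f t" "G t"] euclidean_inner[of "F t" "g t"] by (simp add: sum.distrib)
  show "set_integrable lborel {0..T} (\<lambda>t. f t \<bullet> G t + F t \<bullet> g t)"
    unfolding e set_integrable_def scaleR_sum_right
    by (intro Bochner_Integration.integrable_sum R(1)[unfolded set_integrable_def])
  have "(LBINT t:{0..T}. f t \<bullet> G t + F t \<bullet> g t)
     = (\<Sum>i\<in>Basis. LBINT t:{0..T}. (f t \<bullet> i) * (G t \<bullet> i) + (F t \<bullet> i) * (g t \<bullet> i))"
    unfolding e set_lebesgue_integral_def scaleR_sum_right
    by (intro Bochner_Integration.integral_sum R(1)[unfolded set_integrable_def])
  also have "\<dots> = (\<Sum>i\<in>Basis. (F T \<bullet> i) * (G T \<bullet> i) - (F 0 \<bullet> i) * (G 0 \<bullet> i))"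
    by (intro sum.cong refl) (use R(2) in simp)
  also have "\<dots> = F T \<bullet> G T - F 0 \<bullet> G 0"
    unfolding euclidean_inner[of "F T" "G T"] euclidean_inner[of "F 0" "G 0"] by (simp add: sum_subtractf)
  finally show "F T \<bullet> G T = F 0 \<bullet> G 0 + (LBINT t:{0..T}. f t \<bullet> G t + F t \<bullet> g t)" by simp
qed

lemma set_integrable_of_square:
  fixes h :: "real \<Rightarrow> 'a::euclidean_space"
  assumes "set_borel_measurable lborel {0..T} h" "set_integrable lborel {0..T} (\<lambda>s. (norm (h s))\<^sup>2)"
  shows "set_integrable lborel {0..T} h"
proof -
  have "integrable lborel (indicat_real {0..T})" by (auto simp: integrable_indicator_iff emeasure_lborel_Icc_eq)
  then have "integrable lborel (\<lambda>s. indicat_real {0..T} s + indicat_real {0..T} s * (norm (h s))\<^sup>2)"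
    using assms(2) by (simp add: set_integrable_def)
  then show ?thesis unfolding set_integrable_def
  proof (rule Bochner_Integration.integrable_bound)
    have le: "norm (h s) \<le> 1 + (norm (h s))\<^sup>2" for s
    proof -
      have "2 * norm (h s) \<le> (norm (h s))\<^sup>2 + 1" using sum_squares_bound[of "norm (h s)" 1] by simp
      then show ?thesis using norm_ge_zero[of "h s"] by linarith
    qed
    show "AE s in lborel. norm (indicat_real {0..T} s *\<^sub>R h s)
        \<le> norm (indicat_real {0..T} s + indicat_real {0..T} s * (norm (h s))\<^sup>2)"
      using le by (intro AE_I2) (auto simp: indicator_def)
  qed (use assms(1) in \<open>simp add: set_borel_measurable_def\<close>)
qed

lemma two_inner_le:
  fixes h y :: "'a::euclidean_space" and Q :: "'a \<Rightarrow>\<^sub>L 'a"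
  shows "2 * (h \<bullet> Q y) \<le> (norm y)\<^sup>2 / 2 + 2 * (norm Q)\<^sup>2 * (norm h)\<^sup>2"
proof -
  have "h \<bullet> Q y \<le> norm h * (norm Q * norm y)"
    by (meson norm_blinfun norm_cauchy_schwarz norm_ge_zero mult_left_mono order_trans)
  moreover have "2 * (norm h * (norm Q * norm y)) \<le> (norm y)\<^sup>2 / 2 + 2 * (norm Q)\<^sup>2 * (norm h)\<^sup>2"
    using zero_le_power2[of "norm y / 2 - norm Q * norm h"]
    by (simp add: power2_eq_square algebra_simps)
  ultimately show ?thesis by linarith
qed

text \<open>
  With the Lyapunov function \<open>Q\<close> the derivative of \<open>y \<bullet> Q y\<close> is \<open>- y \<bullet> y + 2 (h \<bullet> Q y)\<close>, and Young's inequality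
  moves half of the first term against the second.
\<close>

lemma energy_estimate:
  fixes y h :: "real \<Rightarrow> 'a::euclidean_space" and S Q :: "'a \<Rightarrow>\<^sub>L 'a"
  assumes T: "0 \<le> T" and adj: "adj Q = Q"
    and Q: "\<And>x y. S x \<bullet> Q y + x \<bullet> Q (S y) = - (x \<bullet> y)"
    and y: "continuous_on {0..T} y"
    and h: "set_borel_measurable lborel {0..T} h" "set_integrable lborel {0..T} (\<lambda>s. (norm (h s))\<^sup>2)"
    and eq: "\<And>t. t \<in> {0..T} \<Longrightarrow> y t = y 0 + (LBINT s:{0..t}. S (y s) + h s)"
  shows "y T \<bullet> Q (y T) + (LBINT s:{0..T}. (norm (y s))\<^sup>2) / 2
     \<le> y 0 \<bullet> Q (y 0) + 2 * (norm Q)\<^sup>2 * (LBINT s:{0..T}. (norm (h s))\<^sup>2)"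
proof -
  let ?b = "\<lambda>s. S (y s) + h s"
  have "set_integrable lborel {0..T} (\<lambda>s. S (y s))"
    by (rule borel_integrable_atLeastAtMost') (intro continuous_intros y)
  then have b: "set_integrable lborel {0..T} ?b"
    by (intro set_integral_add set_integrable_of_square[OF h])
  note bl = blinfun.bounded_linear_right
  have Qy: "Q (y t) = Q (y 0) + (LBINT s:{0..t}. Q (?b s))" if "t \<in> {0..T}" for t
  proof -
    have "set_integrable lborel {0..t} ?b" using that b by (auto intro: set_integrable_subset)
    from set_integrable_bounded_linear(2)[OF bl this, of Q]
    show ?thesis using eq[OF that] by (simp add: blinfun.add_right)
  qed
  note R = ac_inner_product_rule[OF T b set_integrable_bounded_linear(1)[OF bl b] eq Qy]
  have ysq: "set_integrable lborel {0..T} (\<lambda>s. (norm (y s))\<^sup>2)"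
    by (rule borel_integrable_atLeastAtMost') (intro continuous_intros y)
  have pw: "?b s \<bullet> Q (y s) + y s \<bullet> Q (?b s) \<le> - (1/2) * (norm (y s))\<^sup>2 + 2 * (norm Q)\<^sup>2 * (norm (h s))\<^sup>2" for s
  proof -
    have "y s \<bullet> Q (h s) = h s \<bullet> Q (y s)" using inner_adj[of "y s" Q "h s"] adj by (simp add: inner_commute)
    then have "?b s \<bullet> Q (y s) + y s \<bullet> Q (?b s) = - (norm (y s))\<^sup>2 + 2 * (h s \<bullet> Q (y s))"
      using Q[of "y s" "y s"] by (simp add: inner_add blinfun.add_right power2_norm_eq_inner)
    then show ?thesis using two_inner_le[of "h s" Q "y s"] by simp
  qed
  have "(LBINT s:{0..T}. ?b s \<bullet> Q (y s) + y s \<bullet> Q (?b s))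
     \<le> (LBINT s:{0..T}. - (1/2) * (norm (y s))\<^sup>2 + 2 * (norm Q)\<^sup>2 * (norm (h s))\<^sup>2)"
    by (rule set_integral_mono[OF R(1)]) (use pw in \<open>auto intro!: set_integral_add ysq h\<close>)
  also have "\<dots> = - (1/2) * (LBINT s:{0..T}. (norm (y s))\<^sup>2)
      + 2 * (norm Q)\<^sup>2 * (LBINT s:{0..T}. (norm (h s))\<^sup>2)"
    using set_integral_add(2)[OF set_integrable_mult_right[of "- (1/2)"] set_integrable_mult_right, OF ysq h(2)]
    by (simp only: set_integral_mult_right)
  finally show ?thesis using R(2) by simp
qed

text \<open>
  The noise enters through \<open>w\<close> itself rather than its differential, since \<open>z - w\<close> solves the classical
  equation \<open>y' = S (y + w)\<close>.
\<close>

lemma variation_of_constants: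
  fixes w :: "real \<Rightarrow> 'a::euclidean_space" and x :: 'a and S :: "'a \<Rightarrow>\<^sub>L 'a"
  assumes w: "continuous_on {0..} w"
  defines "z \<equiv> \<lambda>t. op_exp (t *\<^sub>R S) (x + (LBINT s:{0..t}. op_exp ((- s) *\<^sub>R S) (S (w s)))) + w t"
  shows "continuous_on {0..} z"
    and "\<And>t. t \<ge> 0 \<Longrightarrow> z t = x + (LBINT s:{0..t}. S (z s)) + w t"
proof -
  let ?E = "\<lambda>t. op_exp (t *\<^sub>R S)"
  let ?g = "\<lambda>s. ?E (- s) (S (w s))"
  let ?J = "\<lambda>t. LBINT s:{0..t}. ?g s"
  define y where "y t = ?E t (x + ?J t)" for t
  have contE: "continuous_on A ?E" for A
    by (rule continuous_on_vector_derivative[OF op_exp_has_vector_derivative])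
  have g: "continuous_on {0..t} ?g" for t
    by (intro continuous_intros continuous_on_compose2[OF contE[of UNIV]]) (auto intro: continuous_on_subset[OF w])
  have J: "(?J has_vector_derivative ?g t) (at t within {0..T})" if "t \<in> {0..T}" for t T
  proof -
    have "((\<lambda>u. integral {0..u} ?g) has_vector_derivative ?g t) (at t within {0..T})"
      by (rule integral_has_vector_derivative[OF g that])
    moreover have "integral {0..u} ?g = ?J u" for u
      by (rule set_borel_integral_eq_integral(2)[symmetric]) (rule borel_integrable_atLeastAtMost'[OF g])
    ultimately show ?thesis by simp
  qed
  have inv: "?E t (?E (- t) v) = v" for t v
    using arg_cong[OF op_exp_add[of t "- t" S], of "\<lambda>X. blinfun_apply X v"] by simp
  have y': "(y has_vector_derivative S (y t + w t)) (at t within {0..T})" if "t \<in> {0..T}" for t T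
  proof -
    have "((\<lambda>t. x + ?J t) has_vector_derivative 0 + ?g t) (at t within {0..T})"
      by (rule has_vector_derivative_add[OF has_vector_derivative_const J[OF that]])
    from bounded_bilinear.has_vector_derivative[OF bounded_bilinear_blinfun_apply
        op_exp_has_vector_derivative[of S t "{0..T}"] this]
    show ?thesis unfolding y_def[abs_def] by (simp add: inv[unfolded scaleR_minus_left] blinfun.add_right add_ac)
  qed
  have z: "z t = y t + w t" for t by (simp add: z_def y_def)
  have ycont: "continuous_on {0..T} y" for T
    by (rule continuous_on_vector_derivative[OF y'])
  have zc: "continuous_on {0..T} z" for T
    unfolding z using ycont by (intro continuous_on_add continuous_on_subset[OF w]) auto
  show "continuous_on {0..} z"
    unfolding continuous_on_eq_continuous_within
  proof
    fix t :: real assume "t \<in> {0..}"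
    then have "continuous (at t within {0..t + 1}) z"
      using zc[of "t + 1"] by (simp add: continuous_on_eq_continuous_within)
    moreover have "at t within {0..} = at t within {0..t + 1}"
      by (rule at_within_nhd[of _ "{..<t + 1}"]) auto
    ultimately show "continuous (at t within {0..}) z" by simp
  qed
  show "z t = x + (LBINT s:{0..t}. S (z s)) + w t" if "t \<ge> 0" for t
  proof -
    have "(LBINT s:{0..t}. S (z s)) = y t - y 0"
      unfolding set_lebesgue_integral_def
      by (rule integral_FTC_atLeastAtMost[OF that])
        (use y'[of _ t] z zc[of t] in \<open>auto intro!: continuous_intros\<close>)
    moreover have "y 0 = x"
    proof -
      have "?J 0 = 0"
        using set_integral_discrete_difference[of "{0::real}" "{0..0}" "{}" lborel ?g] by (simp add: set_lebesgue_integral_def)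
      then show ?thesis by (simp add: y_def)
    qed
    ultimately show ?thesis by (simp add: z)
  qed
qed

section \<open>The noise\<close>

lemma measurable_blinfun_apply [measurable (raw)]:
  fixes S :: "'a::euclidean_space \<Rightarrow>\<^sub>L 'b::euclidean_space"
  assumes "f \<in> borel_measurable M"
  shows "(\<lambda>x. S (f x)) \<in> borel_measurable M"
proof -
  have "blinfun_apply S \<in> borel_measurable borel"
    by (intro borel_measurable_continuous_onI continuous_intros)
  from measurable_compose[OF assms this] show ?thesis .
qed

lemma measurable_op_exp_apply [measurable (raw)]:
  fixes S :: "'a::euclidean_space \<Rightarrow>\<^sub>L 'a"
  assumes g: "g \<in> borel_measurable M" and f: "f \<in> borel_measurable M"
  shows "(\<lambda>x. op_exp (g x *\<^sub>R S) (f x)) \<in> borel_measurable M"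
proof -
  have "(\<lambda>t. op_exp (t *\<^sub>R S) i) \<in> borel_measurable borel" for i
    by (intro borel_measurable_continuous_onI continuous_intros
        continuous_on_vector_derivative[OF op_exp_has_vector_derivative])
  from measurable_compose[OF g this]
  have [measurable]: "(\<lambda>x. op_exp (g x *\<^sub>R S) i) \<in> borel_measurable M" for i .
  have "op_exp (g x *\<^sub>R S) (f x) = (\<Sum>i\<in>Basis. (f x \<bullet> i) *\<^sub>R op_exp (g x *\<^sub>R S) i)" for x
  proof -
    have "op_exp (g x *\<^sub>R S) (f x) = op_exp (g x *\<^sub>R S) (\<Sum>i\<in>Basis. (f x \<bullet> i) *\<^sub>R i)"
      by (simp add: euclidean_representation)
    then show ?thesis by (simp add: blinfun.sum_right blinfun.scaleR_right)
  qed
  moreover have "(\<lambda>x. \<Sum>i\<in>Basis. (f x \<bullet> i) *\<^sub>R op_exp (g x *\<^sub>R S) i) \<in> borel_measurable M"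
    using f by measurable
  ultimately show ?thesis by simp
qed

definition dyadic_floor :: "nat \<Rightarrow> real \<Rightarrow> real" where
  "dyadic_floor n s = real_of_int \<lfloor>2 ^ n * s\<rfloor> / 2 ^ n"

text \<open>
  The filtration need not be complete, so the paths of \<open>W\<close> may be arbitrary on a null set that is invisible
  to it.  The limit along dyadic times, with the junk value of \<open>lim\<close> where it does not exist, is
  measurable for every sub-\<open>\<sigma>\<close>-algebra that makes the dyadic values measurable, and agrees with \<open>W\<close> on
  continuous paths.  Rounding down keeps it adapted.
\<close>

definition dyadic_modification :: "(real \<Rightarrow> 'w \<Rightarrow> 'b) \<Rightarrow> real \<Rightarrow> 'w \<Rightarrow> 'b::t2_space" where
  "dyadic_modification W s \<omega> = lim (\<lambda>n. W (dyadic_floor n s) \<omega>)"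

lemma dyadic_floor_bounds: "s - 1 / 2 ^ n \<le> dyadic_floor n s" "dyadic_floor n s \<le> s" "0 \<le> s \<Longrightarrow> 0 \<le> dyadic_floor n s"
proof -
  have "2 ^ n * s - 1 \<le> real_of_int \<lfloor>2 ^ n * s\<rfloor>" "real_of_int \<lfloor>2 ^ n * s\<rfloor> \<le> 2 ^ n * s" by linarith+
  then have "(2 ^ n * s - 1) / 2 ^ n \<le> dyadic_floor n s" "dyadic_floor n s \<le> (2 ^ n * s) / 2 ^ n"
    unfolding dyadic_floor_def by (intro divide_right_mono; simp)+
  then show "s - 1 / 2 ^ n \<le> dyadic_floor n s" "dyadic_floor n s \<le> s"
    by (simp_all add: diff_divide_distrib)
qed (simp add: dyadic_floor_def)

lemma dyadic_floor_tendsto: "(\<lambda>n. dyadic_floor n s) \<longlonglongrightarrow> s"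
proof (rule real_tendsto_sandwich[OF _ _ _ tendsto_const])
  have "(\<lambda>n. s - (1 / 2) ^ n) \<longlonglongrightarrow> s - 0"
    by (intro tendsto_diff tendsto_const LIMSEQ_realpow_zero) auto
  then show "(\<lambda>n. s - 1 / 2 ^ n) \<longlonglongrightarrow> s" by (simp add: power_divide)
qed (auto intro!: always_eventually dyadic_floor_bounds)

lemma dyadic_modification_eq:
  fixes W :: "real \<Rightarrow> 'w \<Rightarrow> 'b::t2_space"
  assumes "continuous_on {0..} (\<lambda>t. W t \<omega>)" and "s \<ge> 0"
  shows "dyadic_modification W s \<omega> = W s \<omega>"
  unfolding dyadic_modification_def
  by (intro limI continuous_on_tendsto_compose[OF assms(1) dyadic_floor_tendsto])
     (use assms(2) dyadic_floor_bounds(3) in auto)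

lemma measurable_dyadic_modification:
  fixes W :: "real \<Rightarrow> 'w \<Rightarrow> 'b::euclidean_space"
  assumes W: "\<And>r. r \<in> D \<Longrightarrow> W r \<in> borel_measurable N"
    and h: "h \<in> borel_measurable borel" and D: "\<And>n s. dyadic_floor n (h s) \<in> D"
  shows "(\<lambda>(s, \<omega>). dyadic_modification W (h s) \<omega>) \<in> borel_measurable (lborel \<Otimes>\<^sub>M N)"
proof -
  have "(\<lambda>x. W (dyadic_floor n (h (fst x))) (snd x)) \<in> borel_measurable (lborel \<Otimes>\<^sub>M N)" for n
  proof -
    let ?f = "\<lambda>k x. if real_of_int k / 2 ^ n \<in> D then W (real_of_int k / 2 ^ n) (snd x) else 0"
    have "(\<lambda>x. ?f \<lfloor>2 ^ n * h (fst x)\<rfloor> x) \<in> borel_measurable (lborel \<Otimes>\<^sub>M N)"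
    proof (rule measurable_compose_countable[where f = ?f])
      show "?f k \<in> borel_measurable (lborel \<Otimes>\<^sub>M N)" for k
        using measurable_compose[OF measurable_snd W, of "real_of_int k / 2 ^ n" lborel]
        by (cases "real_of_int k / 2 ^ n \<in> D") simp_all
      show "(\<lambda>x. \<lfloor>2 ^ n * h (fst x)\<rfloor>) \<in> measurable (lborel \<Otimes>\<^sub>M N) (count_space UNIV)"
        using h by measurable
    qed
    then show ?thesis using D by (simp add: dyadic_floor_def)
  qed
  then show ?thesis unfolding dyadic_modification_def split_beta' by (rule borel_measurable_lim_metric)
qed

text \<open>
  All that the argument uses of the process \<open>w = K W\<close>: measurability strong enough for Fubini, continuity,
  and orthogonal increments whose second moment is at most linear in the elapsed time.  The clipped times make the measurability conditions
  meaningful on the whole real line.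
\<close>

locale noise = prob_space M
  for M :: "'w measure" and F :: "real \<Rightarrow> 'w measure" and w :: "real \<Rightarrow> 'w \<Rightarrow> 'x::euclidean_space"
    and \<kappa> :: real +
  assumes filtration: "filtration_on M F"
    and progressive: "\<And>t. t \<ge> 0 \<Longrightarrow> (\<lambda>(s, \<omega>). w (max 0 (min s t)) \<omega>) \<in> borel_measurable (lborel \<Otimes>\<^sub>M F t)"
    and joint: "(\<lambda>(s, \<omega>). w (max 0 s) \<omega>) \<in> borel_measurable (lborel \<Otimes>\<^sub>M M)"
    and continuous: "AE \<omega> in M. continuous_on {0..} (\<lambda>t. w t \<omega>) \<and> w 0 \<omega> = 0"
    and increment_square: "\<And>s t. 0 \<le> s \<Longrightarrow> s \<le> t \<Longrightarrow> integrable M (\<lambda>\<omega>. (norm (w t \<omega> - w s \<omega>))\<^sup>2)"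
      "\<And>s t. 0 \<le> s \<Longrightarrow> s \<le> t \<Longrightarrow> (\<integral>\<omega>. (norm (w t \<omega> - w s \<omega>))\<^sup>2 \<partial>M) \<le> \<kappa> * (t - s)"
    and increment_orthogonal: "\<And>s t X. 0 \<le> s \<Longrightarrow> s \<le> t \<Longrightarrow> X \<in> borel_measurable (F s)
      \<Longrightarrow> integrable M (\<lambda>\<omega>. (norm (X \<omega>))\<^sup>2) \<Longrightarrow> (\<integral>\<omega>. X \<omega> \<bullet> (w t \<omega> - w s \<omega>) \<partial>M) = 0"

lemma filtration_onD:
  assumes "filtration_on M F"
  shows "space (F t) = space M" "sets (F t) \<subseteq> sets M" "s \<le> t \<Longrightarrow> sets (F s) \<subseteq> sets (F t)"
  using assms by (auto simp: filtration_on_def subalgebra_def filtration_def)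

lemma filtration_measurable_mono:
  assumes "filtration_on M F" "f \<in> measurable (F s) N" "s \<le> t"
  shows "f \<in> measurable (F t) N"
  by (rule measurable_mono[THEN subsetD, OF order_refl _ _ _ assms(2)])
     (use filtration_onD[OF assms(1)] assms(3) in auto)

lemma filtration_measurable_M:
  assumes "filtration_on M F" "f \<in> measurable (F s) N"
  shows "f \<in> measurable M N"
  by (rule measurable_mono[THEN subsetD, OF order_refl _ _ _ assms(2)])
     (use filtration_onD[OF assms(1)] in auto)

lemma (in prob_space) square_integrable_imp_integrable:
  fixes X :: "'a \<Rightarrow> 'b::euclidean_space"
  assumes X: "X \<in> borel_measurable M" and sq: "integrable M (\<lambda>\<omega>. (norm (X \<omega>))\<^sup>2)"
  shows "integrable M X"
proof (rule Bochner_Integration.integrable_bound)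
  show "integrable M (\<lambda>\<omega>. 1 + (norm (X \<omega>))\<^sup>2)" using sq by simp
  have "norm (X \<omega>) \<le> 1 + (norm (X \<omega>))\<^sup>2" for \<omega>
  proof -
    have "2 * norm (X \<omega>) \<le> (norm (X \<omega>))\<^sup>2 + 1" using sum_squares_bound[of "norm (X \<omega>)" 1] by simp
    then show ?thesis using norm_ge_zero[of "X \<omega>"] by linarith
  qed
  then show "AE \<omega> in M. norm (X \<omega>) \<le> norm (1 + (norm (X \<omega>))\<^sup>2)" by simp
qed (use X in simp)

lemma integrable_inner_of_square:
  fixes X Y :: "'a \<Rightarrow> 'b::euclidean_space"
  assumes [measurable]: "X \<in> borel_measurable M" "Y \<in> borel_measurable M"
    and X: "integrable M (\<lambda>\<omega>. (norm (X \<omega>))\<^sup>2)" and Y: "integrable M (\<lambda>\<omega>. (norm (Y \<omega>))\<^sup>2)"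
  shows "integrable M (\<lambda>\<omega>. X \<omega> \<bullet> Y \<omega>)"
proof (rule Bochner_Integration.integrable_bound)
  show "integrable M (\<lambda>\<omega>. (norm (X \<omega>))\<^sup>2 + (norm (Y \<omega>))\<^sup>2)" using X Y by simp
  have "\<bar>X \<omega> \<bullet> Y \<omega>\<bar> \<le> (norm (X \<omega>))\<^sup>2 + (norm (Y \<omega>))\<^sup>2" for \<omega>
  proof -
    have "\<bar>X \<omega> \<bullet> Y \<omega>\<bar> \<le> norm (X \<omega>) * norm (Y \<omega>)" by (rule Cauchy_Schwarz_ineq2)
    also have "\<dots> \<le> (norm (X \<omega>))\<^sup>2 + (norm (Y \<omega>))\<^sup>2"
      using sum_squares_bound[of "norm (X \<omega>)" "norm (Y \<omega>)"] mult_nonneg_nonneg[OF norm_ge_zero norm_ge_zero, of "X \<omega>" "Y \<omega>"]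
      by linarith
    finally show ?thesis .
  qed
  then show "AE \<omega> in M. norm (X \<omega> \<bullet> Y \<omega>) \<le> norm ((norm (X \<omega>))\<^sup>2 + (norm (Y \<omega>))\<^sup>2)" by simp
qed measurable

lemma integrable_square_mono:
  fixes X :: "'a \<Rightarrow> 'b::euclidean_space"
  assumes [measurable]: "X \<in> borel_measurable M" and Y: "integrable M Y" and le: "AE \<omega> in M. (norm (X \<omega>))\<^sup>2 \<le> Y \<omega>"
  shows "integrable M (\<lambda>\<omega>. (norm (X \<omega>))\<^sup>2)"
  by (rule Bochner_Integration.integrable_bound[OF Y]) (use le in \<open>auto elim!: eventually_mono\<close>)

lemma norm_blinfun_square_le: "(norm (S v))\<^sup>2 \<le> (norm S)\<^sup>2 * (norm v)\<^sup>2"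
  for S :: "'a::real_normed_vector \<Rightarrow>\<^sub>L 'b::real_normed_vector"
  using power_mono[OF norm_blinfun[of S v], of 2] by (simp add: power_mult_distrib)

lemma norm_add_square_le: "(norm (u + v))\<^sup>2 \<le> 2 * (norm u)\<^sup>2 + 2 * (norm v)\<^sup>2" for u v :: "'a::real_inner"
proof -
  have "(norm (u + v))\<^sup>2 + (norm (u - v))\<^sup>2 = 2 * (norm u)\<^sup>2 + 2 * (norm v)\<^sup>2"
    by (simp add: power2_norm_eq_inner inner_add inner_diff inner_commute)
  then show ?thesis using zero_le_power2[of "norm (u - v)"] by linarith
qed

lemma integrable_square_linear:
  fixes S :: "'b::euclidean_space \<Rightarrow>\<^sub>L 'c::euclidean_space"
  assumes "X \<in> borel_measurable M" "integrable M (\<lambda>\<omega>. (norm (X \<omega>))\<^sup>2)"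
  shows "integrable M (\<lambda>\<omega>. (norm (S (X \<omega>)))\<^sup>2)"
  by (rule integrable_square_mono[OF measurable_blinfun_apply[OF assms(1)] integrable_mult_right[of "(norm S)\<^sup>2", OF assms(2)]])
     (intro AE_I2 norm_blinfun_square_le)

lemma integrable_square_add:
  fixes X Y :: "'a \<Rightarrow> 'b::euclidean_space"
  assumes "X \<in> borel_measurable M" "integrable M (\<lambda>\<omega>. (norm (X \<omega>))\<^sup>2)"
    and "Y \<in> borel_measurable M" "integrable M (\<lambda>\<omega>. (norm (Y \<omega>))\<^sup>2)"
  shows "integrable M (\<lambda>\<omega>. (norm (X \<omega> + Y \<omega>))\<^sup>2)" "integrable M (\<lambda>\<omega>. (norm (X \<omega> - Y \<omega>))\<^sup>2)"
proof -
  have i: "integrable M (\<lambda>\<omega>. 2 * (norm (X \<omega>))\<^sup>2 + 2 * (norm (Y \<omega>))\<^sup>2)" using assms by simp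
  show "integrable M (\<lambda>\<omega>. (norm (X \<omega> + Y \<omega>))\<^sup>2)"
    by (rule integrable_square_mono[OF borel_measurable_add[OF assms(1,3)] i]) (intro AE_I2 norm_add_square_le)
  show "integrable M (\<lambda>\<omega>. (norm (X \<omega> - Y \<omega>))\<^sup>2)"
    by (rule integrable_square_mono[OF borel_measurable_diff[OF assms(1,3)] i])
       (use norm_add_square_le[of "X _" "- Y _"] in \<open>auto intro!: AE_I2\<close>)
qed

text \<open>
  Each coordinate of the increment is independent of the past and centred, so the expectation of its
  product with an earlier square-integrable variable factorises.
\<close>

lemma wiener_increment:
  fixes W :: "real \<Rightarrow> 'w \<Rightarrow> real^'d"
  assumes "prob_space M" "filtration_on M F" "wiener_process M F W" and st: "0 \<le> s" "s < t"
  shows "integrable M (\<lambda>\<omega>. (norm (W t \<omega> - W s \<omega>))\<^sup>2)"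
    and "(\<integral>\<omega>. (norm (W t \<omega> - W s \<omega>))\<^sup>2 \<partial>M) = real CARD('d) * (t - s)"
    and "\<And>X. X \<in> borel_measurable (F s) \<Longrightarrow> integrable M (\<lambda>\<omega>. (norm (X \<omega>))\<^sup>2)
      \<Longrightarrow> (\<integral>\<omega>. X \<omega> \<bullet> (W t \<omega> - W s \<omega>) \<partial>M) = 0"
proof -
  interpret prob_space M by fact
  let ?Y = "\<lambda>i \<omega>. (W t \<omega> - W s \<omega>) $ i"
  note Wp = assms(3)[unfolded wiener_process_def]
  note inc = conjunct2[OF conjunct2[OF conjunct2[OF Wp]], rule_format, OF conjI[OF st]]
  have D: "distributed M lborel (?Y i) (normal_density 0 (sqrt (t - s)))" for i
    using conjunct1[OF conjunct2[OF inc]] by (rule spec)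
  have ind: "indep_set (sets (F s)) (sets (vimage_algebra (space M) (\<lambda>\<omega>. W t \<omega> - W s \<omega>) borel))"
    by (rule conjunct2[OF conjunct2[OF inc]])
  have \<sigma>: "0 < sqrt (t - s)" using st by simp
  have sq: "integrable M (\<lambda>\<omega>. (?Y i \<omega>)\<^sup>2)" for i
  proof -
    have "integrable lborel (\<lambda>x. normal_density 0 (sqrt (t - s)) x * x\<^sup>2)"
      using normal_moment_even[OF \<sigma>, of 0 1] by (simp add: has_bochner_integral_iff)
    then show ?thesis using distributed_integrable[OF D, of "\<lambda>x. x\<^sup>2"] by simp
  qed
  have E0: "expectation (?Y i) = 0" for i by (rule normal_distributed_expectation[OF \<sigma> D])
  have E2: "expectation (\<lambda>\<omega>. (?Y i \<omega>)\<^sup>2) = t - s" for i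
    using normal_distributed_variance[OF \<sigma> D[of i]] st by (simp add: E0[simplified])
  have nsq: "(norm v)\<^sup>2 = (\<Sum>i\<in>UNIV. (v $ i)\<^sup>2)" for v :: "real^'d"
    unfolding power2_norm_eq_inner inner_vec_def by (simp add: power2_eq_square)
  show "integrable M (\<lambda>\<omega>. (norm (W t \<omega> - W s \<omega>))\<^sup>2)"
    unfolding nsq by (intro Bochner_Integration.integrable_sum sq)
  show "(\<integral>\<omega>. (norm (W t \<omega> - W s \<omega>))\<^sup>2 \<partial>M) = real CARD('d) * (t - s)"
    unfolding nsq by (subst Bochner_Integration.integral_sum) (use sq E2 in auto)
  fix X :: "'w \<Rightarrow> real^'d"
  assume X: "X \<in> borel_measurable (F s)" and Xsq: "integrable M (\<lambda>\<omega>. (norm (X \<omega>))\<^sup>2)"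
  have XM: "X \<in> borel_measurable M" by (rule filtration_measurable_M[OF assms(2) X])
  have Yi: "integrable M (?Y i)" for i
    by (rule square_integrable_imp_integrable)
       (use distributed_measurable[OF D[of i]] sq[of i] in auto)
  have Xi: "integrable M (\<lambda>\<omega>. X \<omega> $ i)" for i
    using integrable_bounded_linear[OF bounded_linear_vec_nth square_integrable_imp_integrable[OF XM Xsq]] .
  have iv: "indep_var borel (\<lambda>\<omega>. X \<omega> $ i) borel (?Y i)" for i
    unfolding indep_var_eq
  proof (intro conjI)
    have XiF: "(\<lambda>\<omega>. X \<omega> $ i) \<in> borel_measurable (F s)"
      using measurable_compose[OF X borel_measurable_nth] by simp
    let ?A = "{(\<lambda>\<omega>. X \<omega> $ i) -` A \<inter> space M |A. A \<in> sets borel}"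
    let ?B = "{?Y i -` A \<inter> space M |A. A \<in> sets borel}"
    have A: "sigma_sets (space M) ?A \<subseteq> sets (F s)"
    proof -
      have "?A \<subseteq> sets (F s)" using measurable_sets[OF XiF] filtration_onD(1)[OF assms(2)] by auto
      then show ?thesis using sets.sigma_sets_subset[of ?A "F s"] filtration_onD(1)[OF assms(2)] by simp
    qed
    have B: "sigma_sets (space M) ?B \<subseteq> sets (vimage_algebra (space M) (\<lambda>\<omega>. W t \<omega> - W s \<omega>) borel)"
      (is "_ \<subseteq> sets ?V")
    proof -
      have "(\<lambda>\<omega>. W t \<omega> - W s \<omega>) \<in> borel_measurable ?V" by (rule measurable_vimage_algebra1) simp
      from measurable_compose[OF this borel_measurable_nth] have "?Y i \<in> borel_measurable ?V" .
      then have "?B \<subseteq> sets ?V" using measurable_sets[of "?Y i" ?V borel] by auto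
      then show ?thesis using sets.sigma_sets_subset[of ?B ?V] by simp
    qed
    show "indep_set (sigma_sets (space M) ?A) (sigma_sets (space M) ?B)"
      using ind A B unfolding indep_sets2_eq by blast
  qed (use Xi Yi in auto)
  have "(\<integral>\<omega>. X \<omega> \<bullet> (W t \<omega> - W s \<omega>) \<partial>M) = (\<integral>\<omega>. (\<Sum>i\<in>UNIV. X \<omega> $ i * ?Y i \<omega>) \<partial>M)"
    by (simp add: inner_vec_def)
  also have "\<dots> = (\<Sum>i\<in>UNIV. \<integral>\<omega>. X \<omega> $ i * ?Y i \<omega> \<partial>M)"
    by (rule Bochner_Integration.integral_sum) (rule indep_var_integrable[OF iv Xi Yi])
  also have "\<dots> = 0"
    using indep_var_lebesgue_integral[OF iv Xi Yi] E0 by simp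
  finally show "(\<integral>\<omega>. X \<omega> \<bullet> (W t \<omega> - W s \<omega>) \<partial>M) = 0" .
qed

lemma wiener_imp_noise:
  fixes W :: "real \<Rightarrow> 'w \<Rightarrow> real^'d" and K :: "(real^'d) \<Rightarrow>\<^sub>L 'x::euclidean_space"
  assumes "prob_space M" "filtration_on M F" "wiener_process M F W"
  defines "w \<equiv> \<lambda>t \<omega>. K (dyadic_modification W t \<omega>)"
  shows "noise M F w ((norm K)\<^sup>2 * CARD('d))"
    and "AE \<omega> in M. \<forall>t\<ge>0. w t \<omega> = K (W t \<omega>)"
proof -
  interpret prob_space M by fact
  note Wp = assms(3)[unfolded wiener_process_def]
  have meas: "W r \<in> borel_measurable (F t)" if "r \<in> {0..t}" for r t
    using conjunct1[OF Wp] filtration_measurable_mono[OF assms(2), of "W r" r borel t] that by simp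
  have measM: "W r \<in> borel_measurable M" if "r \<ge> 0" for r
    using filtration_measurable_M[OF assms(2) meas, of r r] that by auto
  have cont: "AE \<omega> in M. continuous_on {0..} (\<lambda>t. W t \<omega>)"
    by (rule conjunct1[OF conjunct2[OF conjunct2[OF Wp]]])
  show eq: "AE \<omega> in M. \<forall>t\<ge>0. w t \<omega> = K (W t \<omega>)"
    using cont by eventually_elim (simp add: w_def dyadic_modification_eq)
  have prog: "(\<lambda>(s, \<omega>). w (max 0 (min s t)) \<omega>) \<in> borel_measurable (lborel \<Otimes>\<^sub>M F t)" if "t \<ge> 0" for t
  proof -
    have "(\<lambda>(s, \<omega>). dyadic_modification W (max 0 (min s t)) \<omega>) \<in> borel_measurable (lborel \<Otimes>\<^sub>M F t)"
    proof (rule measurable_dyadic_modification[where D = "{0..t}"])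
      show "dyadic_floor n (max 0 (min s t)) \<in> {0..t}" for n s
        using dyadic_floor_bounds(2,3)[where s = "max 0 (min s t)" and n = n] that by auto
    qed (auto intro: meas)
    then show ?thesis unfolding w_def split_beta' by measurable
  qed
  have joint: "(\<lambda>(s, \<omega>). w (max 0 s) \<omega>) \<in> borel_measurable (lborel \<Otimes>\<^sub>M M)"
  proof -
    have "(\<lambda>(s, \<omega>). dyadic_modification W (max 0 s) \<omega>) \<in> borel_measurable (lborel \<Otimes>\<^sub>M M)"
      by (rule measurable_dyadic_modification[where D = "{0..}"]) (auto intro: measM dyadic_floor_bounds)
    then show ?thesis unfolding w_def split_beta' by measurable
  qed
  have wt: "w t \<in> borel_measurable M" if "t \<ge> 0" for t
    using measurable_compose[OF measurable_Pair1'[of t lborel M] joint] that by (simp add: max_def)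
  have incr: "AE \<omega> in M. w t \<omega> - w s \<omega> = K (W t \<omega> - W s \<omega>)" if "0 \<le> s" "s \<le> t" for s t
    using eq by eventually_elim (use that in \<open>simp add: blinfun.diff_right\<close>)
  have Winc: "integrable M (\<lambda>\<omega>. (norm (W t \<omega> - W s \<omega>))\<^sup>2)"
    "(\<integral>\<omega>. (norm (W t \<omega> - W s \<omega>))\<^sup>2 \<partial>M) = real CARD('d) * (t - s)" if "0 \<le> s" "s \<le> t" for s t :: real
    using wiener_increment(1,2)[OF assms(1-3) that(1), of t] that by (cases "s = t"; simp)+
  have sqle: "AE \<omega> in M. (norm (w t \<omega> - w s \<omega>))\<^sup>2 \<le> (norm K)\<^sup>2 * (norm (W t \<omega> - W s \<omega>))\<^sup>2"
    if "0 \<le> s" "s \<le> t" for s t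
    using incr[OF that] by eventually_elim (simp add: norm_blinfun_square_le)
  have int: "integrable M (\<lambda>\<omega>. (norm (w t \<omega> - w s \<omega>))\<^sup>2)" if "0 \<le> s" "s \<le> t" for s t
  proof (rule integrable_square_mono[OF _ integrable_mult_right[OF Winc(1)[OF that]] sqle[OF that]])
    show "(\<lambda>\<omega>. w t \<omega> - w s \<omega>) \<in> borel_measurable M"
      using wt that by (intro borel_measurable_diff) auto
  qed
  show "noise M F w ((norm K)\<^sup>2 * CARD('d))"
  proof
    show "filtration_on M F" by fact
    show "AE \<omega> in M. continuous_on {0..} (\<lambda>t. w t \<omega>) \<and> w 0 \<omega> = 0"
    proof -
      have "AE \<omega> in M. W 0 \<omega> = 0" by (rule conjunct1[OF conjunct2[OF Wp]])
      with eq cont show ?thesis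
      proof eventually_elim
        case (elim \<omega>)
        have "continuous_on {0..} (\<lambda>t. K (W t \<omega>))" using elim by (intro continuous_intros) auto
        then have "continuous_on {0..} (\<lambda>t. w t \<omega>)"
          using elim by (subst continuous_on_cong[OF refl, of _ _ "\<lambda>t. K (W t \<omega>)"]) auto
        then show ?case using elim by (simp add: blinfun.zero_right)
      qed
    qed
    fix s t :: real assume st: "0 \<le> s" "s \<le> t"
    show "integrable M (\<lambda>\<omega>. (norm (w t \<omega> - w s \<omega>))\<^sup>2)" by (rule int[OF st])
    have "(\<integral>\<omega>. (norm (w t \<omega> - w s \<omega>))\<^sup>2 \<partial>M) \<le> (\<integral>\<omega>. (norm K)\<^sup>2 * (norm (W t \<omega> - W s \<omega>))\<^sup>2 \<partial>M)"
      by (rule integral_mono_AE[OF int[OF st] integrable_mult_right[OF Winc(1)[OF st]] sqle[OF st]])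
    then show "(\<integral>\<omega>. (norm (w t \<omega> - w s \<omega>))\<^sup>2 \<partial>M) \<le> (norm K)\<^sup>2 * real CARD('d) * (t - s)"
      by (simp add: Winc(2)[OF st] mult.assoc)
    fix X :: "'w \<Rightarrow> 'x"
    assume X: "X \<in> borel_measurable (F s)" and Xsq: "integrable M (\<lambda>\<omega>. (norm (X \<omega>))\<^sup>2)"
    have KX: "(\<lambda>\<omega>. adj K (X \<omega>)) \<in> borel_measurable (F s)" using X by measurable
    have KXsq: "integrable M (\<lambda>\<omega>. (norm (adj K (X \<omega>)))\<^sup>2)"
      by (rule integrable_square_linear[OF filtration_measurable_M[OF assms(2) X] Xsq])
    have "(\<integral>\<omega>. X \<omega> \<bullet> (w t \<omega> - w s \<omega>) \<partial>M) = (\<integral>\<omega>. adj K (X \<omega>) \<bullet> (W t \<omega> - W s \<omega>) \<partial>M)"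
    proof (rule integral_cong_AE)
      show "AE \<omega> in M. X \<omega> \<bullet> (w t \<omega> - w s \<omega>) = adj K (X \<omega>) \<bullet> (W t \<omega> - W s \<omega>)"
        using incr[OF st] by eventually_elim (simp add: inner_adj_left)
      have [measurable]: "X \<in> borel_measurable M" "w t \<in> borel_measurable M" "w s \<in> borel_measurable M"
        "W t \<in> borel_measurable M" "W s \<in> borel_measurable M"
        using st wt measM filtration_measurable_M[OF assms(2) X] by auto
      show "(\<lambda>\<omega>. X \<omega> \<bullet> (w t \<omega> - w s \<omega>)) \<in> borel_measurable M"
        "(\<lambda>\<omega>. adj K (X \<omega>) \<bullet> (W t \<omega> - W s \<omega>)) \<in> borel_measurable M" by measurable
    qed
    also have "\<dots> = 0"
      using wiener_increment(3)[OF assms(1-3) st(1) _ KX KXsq, of t] st by (cases "s = t") auto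
    finally show "(\<integral>\<omega>. X \<omega> \<bullet> (w t \<omega> - w s \<omega>) \<partial>M) = 0" .
  qed (use prog joint in auto)
qed

context noise
begin

lemma adapted: "t \<ge> 0 \<Longrightarrow> w t \<in> borel_measurable (F t)"
  using measurable_compose[OF measurable_Pair1'[of t lborel "F t"] progressive[of t]] by (simp add: max_def)

lemma measurable_w: "t \<ge> 0 \<Longrightarrow> w t \<in> borel_measurable M"
  by (rule filtration_measurable_M[OF filtration adapted])

text \<open>
  The explicit solution by variation of constants is measurable because it is an integral of the
  progressively measurable noise.
\<close>

lemma path_solution_exists:
  fixes \<xi> :: "'w \<Rightarrow> 'x" and S :: "'x \<Rightarrow>\<^sub>L 'x"
  assumes \<xi>: "\<xi> \<in> borel_measurable (F 0)"
  obtains Z where "adapted F Z" and "jointly_measurable M Z"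
    and "AE \<omega> in M. continuous_on {0..} (\<lambda>t. Z t \<omega>) \<and>
      (\<forall>t\<ge>0. Z t \<omega> = \<xi> \<omega> + (LBINT s:{0..t}. S (Z s \<omega>)) + w t \<omega>)"
proof -
  define Z where "Z t \<omega> = op_exp (t *\<^sub>R S) (\<xi> \<omega> + (LBINT s:{0..t}. op_exp ((- s) *\<^sub>R S) (S (w s \<omega>)))) + w t \<omega>"
    for t \<omega>
  have ad: "Z t \<in> borel_measurable (F t)" if t: "t \<ge> 0" for t
  proof -
    have [measurable]: "(\<lambda>(s, \<omega>). w (max 0 (min s t)) \<omega>) \<in> borel_measurable (lborel \<Otimes>\<^sub>M F t)"
      by (rule progressive[OF t])
    have m: "(\<lambda>(\<omega>, s). w (max 0 (min s t)) \<omega>) \<in> borel_measurable (F t \<Otimes>\<^sub>M lborel)" by measurable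
    have "(\<lambda>(\<omega>, s). indicat_real {0..t} s *\<^sub>R op_exp ((- s) *\<^sub>R S) (S (w (max 0 (min s t)) \<omega>)))
        \<in> borel_measurable (F t \<Otimes>\<^sub>M lborel)"
      using m unfolding split_beta' by measurable
    from lborel.borel_measurable_lebesgue_integral[OF this]
    have "(\<lambda>\<omega>. LINT s|lborel. indicat_real {0..t} s *\<^sub>R op_exp ((- s) *\<^sub>R S) (S (w (max 0 (min s t)) \<omega>)))
        \<in> borel_measurable (F t)" .
    also have "(\<lambda>\<omega>. LINT s|lborel. indicat_real {0..t} s *\<^sub>R op_exp ((- s) *\<^sub>R S) (S (w (max 0 (min s t)) \<omega>)))
      = (\<lambda>\<omega>. LBINT s:{0..t}. op_exp ((- s) *\<^sub>R S) (S (w s \<omega>)))"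
      unfolding set_lebesgue_integral_def
      by (intro ext Bochner_Integration.integral_cong) (auto simp: indicator_def max_def min_def)
    finally have [measurable]: "(\<lambda>\<omega>. LBINT s:{0..t}. op_exp ((- s) *\<^sub>R S) (S (w s \<omega>))) \<in> borel_measurable (F t)" .
    have [measurable]: "\<xi> \<in> borel_measurable (F t)" "w t \<in> borel_measurable (F t)"
      using filtration_measurable_mono[OF filtration \<xi> t] adapted[OF t] by auto
    show ?thesis unfolding Z_def by measurable
  qed
  have jm: "(\<lambda>(\<omega>, t). Z t \<omega>) \<in> borel_measurable (Omega_T M T)" for T
  proof -
    have [measurable]: "(\<lambda>(s, \<omega>). w (max 0 s) \<omega>) \<in> borel_measurable (lborel \<Otimes>\<^sub>M M)" by (rule joint)
    have [measurable]: "\<xi> \<in> borel_measurable M" by (rule filtration_measurable_M[OF filtration \<xi>])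
    have mw: "(\<lambda>(\<omega>, s). w (max 0 s) \<omega>) \<in> borel_measurable (M \<Otimes>\<^sub>M lborel)" by measurable
    have "(\<lambda>(x, s). (if 0 \<le> s \<and> s \<le> snd x then op_exp ((- s) *\<^sub>R S) (S (w (max 0 s) (fst x))) else 0))
        \<in> borel_measurable ((M \<Otimes>\<^sub>M lborel) \<Otimes>\<^sub>M lborel)"
    proof -
      have "(\<lambda>x. w (max 0 (snd x)) (fst (fst x))) \<in> borel_measurable ((M \<Otimes>\<^sub>M lborel) \<Otimes>\<^sub>M lborel)"
        using measurable_compose[OF _ mw, of "\<lambda>x. (fst (fst x), snd x)" "(M \<Otimes>\<^sub>M lborel) \<Otimes>\<^sub>M lborel"] by simp
      then show ?thesis unfolding split_beta' by measurable
    qed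
    from lborel.borel_measurable_lebesgue_integral[OF this]
    have "(\<lambda>x. LINT s|lborel. (if 0 \<le> s \<and> s \<le> snd x then op_exp ((- s) *\<^sub>R S) (S (w (max 0 s) (fst x))) else 0))
        \<in> borel_measurable (M \<Otimes>\<^sub>M lborel)" .
    also have "(\<lambda>x. LINT s|lborel. (if 0 \<le> s \<and> s \<le> snd x then op_exp ((- s) *\<^sub>R S) (S (w (max 0 s) (fst x))) else 0))
      = (\<lambda>x. LBINT s:{0..snd x}. op_exp ((- s) *\<^sub>R S) (S (w s (fst x))))"
      unfolding set_lebesgue_integral_def
      by (intro ext Bochner_Integration.integral_cong) (auto simp: indicator_def max_def)
    finally have [measurable]: "(\<lambda>x. LBINT s:{0..snd x}. op_exp ((- s) *\<^sub>R S) (S (w s (fst x)))) \<in> borel_measurable (M \<Otimes>\<^sub>M lborel)" .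
    define Y where "Y x = op_exp (snd x *\<^sub>R S) (\<xi> (fst x) + (LBINT s:{0..snd x}. op_exp ((- s) *\<^sub>R S) (S (w s (fst x)))))
       + w (max 0 (snd x)) (fst x)" for x
    have Y: "Y \<in> borel_measurable (M \<Otimes>\<^sub>M lborel)"
      unfolding Y_def[abs_def] using mw unfolding split_beta' by measurable
    have "(\<lambda>x. x) \<in> measurable (Omega_T M T) (M \<Otimes>\<^sub>M lborel)"
    proof -
      have "(\<lambda>x. (fst x, snd x)) \<in> measurable (Omega_T M T) (M \<Otimes>\<^sub>M lborel)"
        unfolding Omega_T_def
        by (intro measurable_Pair measurable_fst measurable_compose[OF measurable_snd] measurable_restrict_space1) auto
      then show ?thesis by simp
    qed
    from measurable_compose[OF this Y] have YO: "Y \<in> borel_measurable (Omega_T M T)" .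
    have "(\<lambda>(\<omega>, t). Z t \<omega>) \<in> borel_measurable (Omega_T M T) \<longleftrightarrow> Y \<in> borel_measurable (Omega_T M T)"
    proof (rule measurable_cong)
      fix x assume "x \<in> space (Omega_T M T)"
      then have "0 < snd x" by (auto simp: Omega_T_def space_pair_measure space_restrict_space)
      then show "(case x of (\<omega>, t) \<Rightarrow> Z t \<omega>) = Y x" by (simp add: split_beta Z_def Y_def max_def)
    qed
    then show ?thesis using YO by simp
  qed
  have "AE \<omega> in M. continuous_on {0..} (\<lambda>t. Z t \<omega>) \<and>
      (\<forall>t\<ge>0. Z t \<omega> = \<xi> \<omega> + (LBINT s:{0..t}. S (Z s \<omega>)) + w t \<omega>)"
    using continuous
  proof eventually_elim
    case (elim \<omega>)
    then have c: "continuous_on {0..} (\<lambda>t. w t \<omega>)" by blast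
    show ?case using variation_of_constants[OF c, where S = S and x = "\<xi> \<omega>"] unfolding Z_def by blast
  qed
  then show ?thesis by (intro that[of Z]) (use ad jm in \<open>auto simp: adapted_def jointly_measurable_def\<close>)
qed

end

section \<open>Square-integrable processes\<close>

lemma integrable_restrict_interval:
  fixes f :: "real \<Rightarrow> 'b::euclidean_space"
  shows "integrable (restrict_space lborel {0<..<T}) f \<longleftrightarrow> set_integrable lborel {0..T} f"
    and "integral\<^sup>L (restrict_space lborel {0<..<T}) f = (LBINT t:{0..T}. f t)"
proof -
  have "integrable lborel (\<lambda>t. indicat_real {0<..<T} t *\<^sub>R f t) \<longleftrightarrow> integrable lborel (\<lambda>t. indicat_real {0..T} t *\<^sub>R f t)"
    by (rule integrable_discrete_difference[where X = "{0, T}"]) (auto simp: indicator_def)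
  then show "integrable (restrict_space lborel {0<..<T}) f \<longleftrightarrow> set_integrable lborel {0..T} f"
    by (simp add: integrable_restrict_space set_integrable_def)
  have "integral\<^sup>L lborel (\<lambda>t. indicat_real {0<..<T} t *\<^sub>R f t) = integral\<^sup>L lborel (\<lambda>t. indicat_real {0..T} t *\<^sub>R f t)"
    by (rule integral_discrete_difference[where X = "{0, T}"]) (auto simp: indicator_def)
  then show "integral\<^sup>L (restrict_space lborel {0<..<T}) f = (LBINT t:{0..T}. f t)"
    by (simp add: integral_restrict_space set_lebesgue_integral_def)
qed

lemma set_borel_measurable_restrict_interval:
  fixes f :: "real \<Rightarrow> 'b::euclidean_space"
  assumes "f \<in> borel_measurable (restrict_space lborel {0<..<T})"
  shows "set_borel_measurable lborel {0..T} f"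
proof -
  have "(\<lambda>t. indicat_real {0<..<T} t *\<^sub>R f t) \<in> borel_measurable lborel"
    using assms by (simp add: borel_measurable_restrict_space_iff)
  then show ?thesis unfolding set_borel_measurable_def
    by (rule measurable_discrete_difference[where X = "{0, T}"]) (auto simp: indicator_def)
qed

definition square_integrable :: "'w measure \<Rightarrow> real \<Rightarrow> (real \<Rightarrow> 'w \<Rightarrow> 'b::euclidean_space) \<Rightarrow> bool" where
  "square_integrable M T X \<longleftrightarrow> (\<lambda>(\<omega>, t). X t \<omega>) \<in> borel_measurable (Omega_T M T) \<and>
     integrable (Omega_T M T) (\<lambda>(\<omega>, t). (norm (X t \<omega>))\<^sup>2)"

context prob_space
begin

lemma Omega_T_Fubini:
  fixes f :: "real \<Rightarrow> 'a \<Rightarrow> 'b::euclidean_space"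
  assumes "integrable (Omega_T M T) (\<lambda>(\<omega>, t). f t \<omega>)"
  shows "AE \<omega> in M. set_integrable lborel {0..T} (\<lambda>t. f t \<omega>)"
    and "integrable M (\<lambda>\<omega>. LBINT t:{0..T}. f t \<omega>)"
    and "(\<integral>\<omega>. (LBINT t:{0..T}. f t \<omega>) \<partial>M) = integral\<^sup>L (Omega_T M T) (\<lambda>(\<omega>, t). f t \<omega>)"
    and "AE t in restrict_space lborel {0<..<T}. integrable M (f t)"
    and "set_integrable lborel {0..T} (\<lambda>t. \<integral>\<omega>. f t \<omega> \<partial>M)"
    and "(LBINT t:{0..T}. (\<integral>\<omega>. f t \<omega> \<partial>M)) = integral\<^sup>L (Omega_T M T) (\<lambda>(\<omega>, t). f t \<omega>)"
proof -
  interpret R: sigma_finite_measure "restrict_space lborel {0<..<T}"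
    by (rule sigma_finite_measure_restrict_space) (auto intro: sigma_finite_lborel)
  interpret pair_sigma_finite M "restrict_space lborel {0<..<T}" ..
  note i = assms[unfolded Omega_T_def]
  show "AE \<omega> in M. set_integrable lborel {0..T} (\<lambda>t. f t \<omega>)"
    using AE_integrable_fst[OF i] by (simp add: integrable_restrict_interval)
  show "integrable M (\<lambda>\<omega>. LBINT t:{0..T}. f t \<omega>)"
    using integrable_fst[OF i] by (simp add: integrable_restrict_interval)
  show "(\<integral>\<omega>. (LBINT t:{0..T}. f t \<omega>) \<partial>M) = integral\<^sup>L (Omega_T M T) (\<lambda>(\<omega>, t). f t \<omega>)"
    using integral_fst[OF i] by (simp add: integrable_restrict_interval Omega_T_def)
  show "AE t in restrict_space lborel {0<..<T}. integrable M (f t)"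
    by (rule AE_integrable_snd[OF i])
  show "set_integrable lborel {0..T} (\<lambda>t. \<integral>\<omega>. f t \<omega> \<partial>M)"
    using integrable_snd[OF i] by (simp add: integrable_restrict_interval)
  show "(LBINT t:{0..T}. (\<integral>\<omega>. f t \<omega> \<partial>M)) = integral\<^sup>L (Omega_T M T) (\<lambda>(\<omega>, t). f t \<omega>)"
    using integral_snd[OF i] by (simp add: integrable_restrict_interval Omega_T_def)
qed

lemma square_integrable_of_bound:
  fixes X :: "real \<Rightarrow> 'a \<Rightarrow> 'b::euclidean_space"
  assumes meas: "(\<lambda>(\<omega>, t). X t \<omega>) \<in> borel_measurable (Omega_T M T)"
    and int: "\<And>t. 0 < t \<Longrightarrow> t < T \<Longrightarrow> integrable M (\<lambda>\<omega>. (norm (X t \<omega>))\<^sup>2)"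
    and bound: "\<And>t. 0 < t \<Longrightarrow> t < T \<Longrightarrow> (\<integral>\<omega>. (norm (X t \<omega>))\<^sup>2 \<partial>M) \<le> c"
  shows "square_integrable M T X"
proof -
  let ?R = "restrict_space lborel {0<..<T}"
  interpret R: sigma_finite_measure ?R
    by (rule sigma_finite_measure_restrict_space) (auto intro: sigma_finite_lborel)
  interpret P: pair_sigma_finite M ?R ..
  interpret Q: pair_sigma_finite ?R M ..
  have sp: "space ?R = {0<..<T}" by (simp add: space_restrict_space)
  have m: "(\<lambda>(\<omega>, t). (norm (X t \<omega>))\<^sup>2) \<in> borel_measurable (M \<Otimes>\<^sub>M ?R)"
    using meas unfolding Omega_T_def split_beta' by measurable
  then have [measurable]: "(\<lambda>(t, \<omega>). (norm (X t \<omega>))\<^sup>2) \<in> borel_measurable (?R \<Otimes>\<^sub>M M)"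
    by measurable
  have "integrable (?R \<Otimes>\<^sub>M M) (\<lambda>(t, \<omega>). (norm (X t \<omega>))\<^sup>2)"
  proof (rule Q.Fubini_integrable)
    have "integrable ?R (\<lambda>t. \<integral>\<omega>. (norm (X t \<omega>))\<^sup>2 \<partial>M)"
    proof (rule Bochner_Integration.integrable_bound)
      have "set_integrable lborel {0..T} (\<lambda>_. c)"
        by (rule borel_integrable_atLeastAtMost') (rule continuous_on_const)
      then show "integrable ?R (\<lambda>_. c)" by (simp add: integrable_restrict_interval)
      show "AE t in ?R. norm (\<integral>\<omega>. (norm (X t \<omega>))\<^sup>2 \<partial>M) \<le> norm c"
      proof (rule AE_I2)
        fix t assume "t \<in> space ?R"
        then have "(\<integral>\<omega>. (norm (X t \<omega>))\<^sup>2 \<partial>M) \<le> c" using bound by (simp add: sp)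
        moreover have "0 \<le> (\<integral>\<omega>. (norm (X t \<omega>))\<^sup>2 \<partial>M)" by simp
        ultimately show "norm (\<integral>\<omega>. (norm (X t \<omega>))\<^sup>2 \<partial>M) \<le> norm c" by simp
      qed
    qed measurable
    then show "integrable ?R (\<lambda>t. \<integral>\<omega>. norm (case (t, \<omega>) of (t, \<omega>) \<Rightarrow> (norm (X t \<omega>))\<^sup>2) \<partial>M)" by simp
    show "AE t in ?R. integrable M (\<lambda>\<omega>. case (t, \<omega>) of (t, \<omega>) \<Rightarrow> (norm (X t \<omega>))\<^sup>2)"
      using int by (intro AE_I2) (simp add: sp)
  qed measurable
  from Q.integrable_product_swap[OF this]
  show ?thesis using meas by (simp add: square_integrable_def Omega_T_def split_beta')
qed

lemma square_integrable_linear: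
  fixes S :: "'b::euclidean_space \<Rightarrow>\<^sub>L 'c::euclidean_space"
  assumes "square_integrable M T X"
  shows "square_integrable M T (\<lambda>t \<omega>. S (X t \<omega>))"
proof -
  have X: "(\<lambda>(\<omega>, t). X t \<omega>) \<in> borel_measurable (Omega_T M T)"
    "integrable (Omega_T M T) (\<lambda>x. (norm (case x of (\<omega>, t) \<Rightarrow> X t \<omega>))\<^sup>2)"
    using assms by (simp_all add: square_integrable_def split_beta')
  show ?thesis
    using measurable_blinfun_apply[OF X(1), of S] integrable_square_linear[OF X, of S]
    by (simp add: square_integrable_def split_beta')
qed

lemma square_integrable_add:
  fixes X Y :: "real \<Rightarrow> 'a \<Rightarrow> 'b::euclidean_space"
  assumes "square_integrable M T X" "square_integrable M T Y"
  shows "square_integrable M T (\<lambda>t \<omega>. X t \<omega> + Y t \<omega>)" "square_integrable M T (\<lambda>t \<omega>. X t \<omega> - Y t \<omega>)"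
proof -
  have X: "(\<lambda>(\<omega>, t). X t \<omega>) \<in> borel_measurable (Omega_T M T)"
    "integrable (Omega_T M T) (\<lambda>x. (norm (case x of (\<omega>, t) \<Rightarrow> X t \<omega>))\<^sup>2)"
    and Y: "(\<lambda>(\<omega>, t). Y t \<omega>) \<in> borel_measurable (Omega_T M T)"
    "integrable (Omega_T M T) (\<lambda>x. (norm (case x of (\<omega>, t) \<Rightarrow> Y t \<omega>))\<^sup>2)"
    using assms by (simp_all add: square_integrable_def split_beta')
  show "square_integrable M T (\<lambda>t \<omega>. X t \<omega> + Y t \<omega>)" "square_integrable M T (\<lambda>t \<omega>. X t \<omega> - Y t \<omega>)"
    using borel_measurable_add[OF X(1) Y(1)] borel_measurable_diff[OF X(1) Y(1)] integrable_square_add[OF X Y]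
    by (simp_all add: square_integrable_def split_beta')
qed

lemmas square_integrable_diff = square_integrable_add(2)

lemma square_integrable_inner:
  fixes X Y :: "real \<Rightarrow> 'a \<Rightarrow> 'b::euclidean_space"
  assumes "square_integrable M T X" "square_integrable M T Y"
  shows "integrable (Omega_T M T) (\<lambda>(\<omega>, t). X t \<omega> \<bullet> Y t \<omega>)"
  using integrable_inner_of_square[of "\<lambda>(\<omega>, t). X t \<omega>" "Omega_T M T" "\<lambda>(\<omega>, t). Y t \<omega>"] assms
  by (simp add: square_integrable_def split_beta')

lemma square_integrable_path_measurable:
  fixes X :: "real \<Rightarrow> 'a \<Rightarrow> 'b::euclidean_space"
  assumes "square_integrable M T X" "\<omega> \<in> space M"
  shows "set_borel_measurable lborel {0..T} (\<lambda>t. X t \<omega>)"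
proof -
  have "(\<lambda>(\<omega>, t). X t \<omega>) \<in> borel_measurable (M \<Otimes>\<^sub>M restrict_space lborel {0<..<T})"
    using assms(1) by (simp add: square_integrable_def Omega_T_def)
  from measurable_compose[OF measurable_Pair1'[OF assms(2)] this]
  show ?thesis by (intro set_borel_measurable_restrict_interval) simp
qed

lemma square_integrable_of_time_independent:
  fixes X :: "'a \<Rightarrow> 'b::euclidean_space"
  assumes "X \<in> borel_measurable M" "integrable M (\<lambda>\<omega>. (norm (X \<omega>))\<^sup>2)"
  shows "square_integrable M T (\<lambda>t. X)"
proof (rule square_integrable_of_bound)
  show "(\<lambda>(\<omega>, t). X \<omega>) \<in> borel_measurable (Omega_T M T)"
    using assms(1) unfolding Omega_T_def by measurable
qed (use assms in auto)

end

section \<open>Second moments of processes driven by the noise\<close>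

context noise
begin

definition evolves :: "(real \<Rightarrow> 'w \<Rightarrow> 'x) \<Rightarrow> ('w \<Rightarrow> 'x) \<Rightarrow> (real \<Rightarrow> 'w \<Rightarrow> 'x) \<Rightarrow> bool" where
  "evolves b \<eta> y \<longleftrightarrow> (AE \<omega> in M. \<forall>t\<ge>0. set_integrable lborel {0..t} (\<lambda>s. b s \<omega>) \<and>
     y t \<omega> = \<eta> \<omega> + (LBINT s:{0..t}. b s \<omega>))"

lemma evolves_0:
  assumes "evolves b \<eta> y"
  shows "AE \<omega> in M. y 0 \<omega> = \<eta> \<omega>"
  using assms unfolding evolves_def
proof eventually_elim
  case (elim \<omega>)
  have "(LBINT s:{0..0}. b s \<omega>) = 0"
    using set_integral_discrete_difference[of "{0::real}" "{0..0}" "{}" lborel "\<lambda>s. b s \<omega>"]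
    by (simp add: set_lebesgue_integral_def)
  then show ?case using elim by (metis add.right_neutral order_refl)
qed

lemma evolves_linear:
  fixes P :: "'x \<Rightarrow>\<^sub>L 'x"
  assumes "evolves b \<eta> y"
  shows "evolves (\<lambda>t \<omega>. P (b t \<omega>)) (\<lambda>\<omega>. P (\<eta> \<omega>)) (\<lambda>t \<omega>. blinfun_apply P (y t \<omega>))"
  using assms unfolding evolves_def
proof eventually_elim
  case (elim \<omega>)
  then show ?case
    using set_integrable_bounded_linear[OF blinfun.bounded_linear_right[of P], where f = "\<lambda>s. b s \<omega>"]
    by (auto simp: blinfun.add_right)
qed

lemma w_square: "t \<ge> 0 \<Longrightarrow> integrable M (\<lambda>\<omega>. (norm (w t \<omega>))\<^sup>2)"
  "t \<ge> 0 \<Longrightarrow> (\<integral>\<omega>. (norm (w t \<omega>))\<^sup>2 \<partial>M) \<le> \<kappa> * t"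
proof -
  assume t: "t \<ge> 0"
  note [measurable] = measurable_w[OF t] measurable_w[of 0]
  have ae: "AE \<omega> in M. (norm (w t \<omega> - w 0 \<omega>))\<^sup>2 = (norm (w t \<omega>))\<^sup>2"
    using continuous by eventually_elim simp
  show "integrable M (\<lambda>\<omega>. (norm (w t \<omega>))\<^sup>2)"
    using increment_square(1)[of 0 t] t integrable_cong_AE[OF _ _ ae] by simp
  show "(\<integral>\<omega>. (norm (w t \<omega>))\<^sup>2 \<partial>M) \<le> \<kappa> * t"
    using increment_square(2)[of 0 t] t integral_cong_AE[OF _ _ ae] by simp
qed

lemma \<kappa>_nonneg: "0 \<le> \<kappa>"
  using w_square(2)[of 1] order_trans[of 0 "\<integral>\<omega>. (norm (w 1 \<omega>))\<^sup>2 \<partial>M"] by simp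

lemma w_joint_Omega_T: "(\<lambda>(\<omega>, t). w t \<omega>) \<in> borel_measurable (Omega_T M T)"
proof -
  have "(\<lambda>x. (snd x, fst x)) \<in> measurable (Omega_T M T) (lborel \<Otimes>\<^sub>M M)"
    unfolding Omega_T_def
    by (intro measurable_Pair measurable_fst measurable_compose[OF measurable_snd] measurable_restrict_space1) auto
  from measurable_compose[OF this joint]
  have "(\<lambda>x. w (max 0 (snd x)) (fst x)) \<in> borel_measurable (Omega_T M T)" by simp
  moreover have "(\<lambda>x. w (max 0 (snd x)) (fst x)) \<in> borel_measurable (Omega_T M T) \<longleftrightarrow>
    (\<lambda>(\<omega>, t). w t \<omega>) \<in> borel_measurable (Omega_T M T)"
    by (rule measurable_cong) (auto simp: Omega_T_def space_pair_measure space_restrict_space max_def)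
  ultimately show ?thesis by simp
qed

lemma square_integrable_w: "square_integrable M T w"
proof (rule square_integrable_of_bound[OF w_joint_Omega_T w_square(1)])
  fix t assume "0 < t" "t < T"
  then show "(\<integral>\<omega>. (norm (w t \<omega>))\<^sup>2 \<partial>M) \<le> \<kappa> * T"
    using w_square(2)[of t] \<kappa>_nonneg mult_left_mono[of t T \<kappa>] by simp
qed simp

lemma mean_product_rule:
  assumes T: "T > 0" and y1: "evolves b1 \<eta>1 y1" and y2: "evolves b2 \<eta>2 y2"
    and sq: "square_integrable M T b1" "square_integrable M T y1" "square_integrable M T b2" "square_integrable M T y2"
    and \<eta>: "integrable M (\<lambda>\<omega>. \<eta>1 \<omega> \<bullet> \<eta>2 \<omega>)"
    and m: "y1 T \<in> borel_measurable M" "y2 T \<in> borel_measurable M"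
  shows "(\<integral>\<omega>. y1 T \<omega> \<bullet> y2 T \<omega> \<partial>M) = (\<integral>\<omega>. \<eta>1 \<omega> \<bullet> \<eta>2 \<omega> \<partial>M)
     + integral\<^sup>L (Omega_T M T) (\<lambda>(\<omega>, t). b1 t \<omega> \<bullet> y2 t \<omega>) + integral\<^sup>L (Omega_T M T) (\<lambda>(\<omega>, t). y1 t \<omega> \<bullet> b2 t \<omega>)"
proof -
  note i1 = square_integrable_inner[OF sq(1,4)] and i2 = square_integrable_inner[OF sq(2,3)]
  have ae: "AE \<omega> in M. y1 T \<omega> \<bullet> y2 T \<omega> = \<eta>1 \<omega> \<bullet> \<eta>2 \<omega> +
     ((LBINT t:{0..T}. b1 t \<omega> \<bullet> y2 t \<omega>) + (LBINT t:{0..T}. y1 t \<omega> \<bullet> b2 t \<omega>))"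
    using y1[unfolded evolves_def] y2[unfolded evolves_def] evolves_0[OF y1] evolves_0[OF y2]
      Omega_T_Fubini(1)[OF i1] Omega_T_Fubini(1)[OF i2]
  proof eventually_elim
    case (elim \<omega>)
    have "y1 T \<omega> \<bullet> y2 T \<omega> = y1 0 \<omega> \<bullet> y2 0 \<omega> + (LBINT t:{0..T}. b1 t \<omega> \<bullet> y2 t \<omega> + y1 t \<omega> \<bullet> b2 t \<omega>)"
      by (rule ac_inner_product_rule(2)[where F = "\<lambda>t. y1 t \<omega>" and G = "\<lambda>t. y2 t \<omega>"])
         (use elim T in auto)
    then show ?case using elim by simp
  qed
  have "(\<integral>\<omega>. y1 T \<omega> \<bullet> y2 T \<omega> \<partial>M) = (\<integral>\<omega>. \<eta>1 \<omega> \<bullet> \<eta>2 \<omega> +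
     ((LBINT t:{0..T}. b1 t \<omega> \<bullet> y2 t \<omega>) + (LBINT t:{0..T}. y1 t \<omega> \<bullet> b2 t \<omega>)) \<partial>M)"
    by (rule integral_cong_AE[OF _ _ ae])
       (use m \<eta> Omega_T_Fubini(2)[OF i1] Omega_T_Fubini(2)[OF i2] in auto)
  then show ?thesis
    using \<eta> Omega_T_Fubini(2,3)[OF i1] Omega_T_Fubini(2,3)[OF i2] by simp
qed

text \<open>
  The substitute for Ito's formula.  Writing \<open>y\<^sub>T\<close> as \<open>\<eta> + \<integral> b\<^sub>t dt\<close>, the product \<open>b\<^sub>t \<bullet> w\<^sub>T\<close> has the same expectation
  as \<open>b\<^sub>t \<bullet> w\<^sub>t\<close>, because \<open>b\<^sub>t\<close> is known at time \<open>t\<close> and the later increment is orthogonal to it.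
\<close>

lemma mean_product_noise:
  assumes T: "T > 0" and y: "evolves b \<eta> y" and \<eta>: "\<eta> \<in> borel_measurable (F 0)" "integrable M (\<lambda>\<omega>. (norm (\<eta> \<omega>))\<^sup>2)"
    and b: "adapted F b" "square_integrable M T b" and m: "y T \<in> borel_measurable M"
  shows "(\<integral>\<omega>. y T \<omega> \<bullet> w T \<omega> \<partial>M) = integral\<^sup>L (Omega_T M T) (\<lambda>(\<omega>, t). b t \<omega> \<bullet> w t \<omega>)"
proof -
  note [measurable] = m measurable_w[OF less_imp_le[OF T]] measurable_w[OF order_refl]
    filtration_measurable_M[OF filtration \<eta>(1)]
  note wT = square_integrable_of_time_independent[OF measurable_w w_square(1), OF less_imp_le less_imp_le, OF T T, of T]
  note i1 = square_integrable_inner[OF b(2) square_integrable_w]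
  note i2 = square_integrable_inner[OF b(2) square_integrable_diff[OF wT square_integrable_w]]
  have \<eta>0: "integrable M (\<lambda>\<omega>. \<eta> \<omega> \<bullet> w T \<omega>)"
    by (rule integrable_inner_of_square) (use \<eta>(2) w_square(1)[of T] T in auto)
  have "(\<integral>\<omega>. \<eta> \<omega> \<bullet> w T \<omega> \<partial>M) = (\<integral>\<omega>. \<eta> \<omega> \<bullet> (w T \<omega> - w 0 \<omega>) \<partial>M)"
  proof (rule integral_cong_AE)
    show "AE \<omega> in M. \<eta> \<omega> \<bullet> w T \<omega> = \<eta> \<omega> \<bullet> (w T \<omega> - w 0 \<omega>)"
      using continuous by eventually_elim simp
  qed measurable
  also have "\<dots> = 0" by (rule increment_orthogonal) (use \<eta> T in auto)
  finally have \<eta>1: "(\<integral>\<omega>. \<eta> \<omega> \<bullet> w T \<omega> \<partial>M) = 0" .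
  have "AE t in restrict_space lborel {0<..<T}. (\<integral>\<omega>. b t \<omega> \<bullet> (w T \<omega> - w t \<omega>) \<partial>M) = 0"
    using Omega_T_Fubini(4)[OF conjunct2[OF b(2)[unfolded square_integrable_def]]] AE_space
  proof eventually_elim
    case (elim t)
    then have "0 < t" "t < T" by (auto simp: space_restrict_space)
    then show ?case using b(1) elim by (intro increment_orthogonal) (auto simp: adapted_def)
  qed
  then have "integral\<^sup>L (restrict_space lborel {0<..<T}) (\<lambda>t. \<integral>\<omega>. b t \<omega> \<bullet> (w T \<omega> - w t \<omega>) \<partial>M) = 0"
    by (rule integral_eq_zero_AE)
  then have zero: "(\<integral>\<omega>. (LBINT t:{0..T}. b t \<omega> \<bullet> (w T \<omega> - w t \<omega>)) \<partial>M) = 0"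
    using Omega_T_Fubini(3)[OF i2] Omega_T_Fubini(6)[OF i2] by (simp add: integrable_restrict_interval)
  have ae: "AE \<omega> in M. y T \<omega> \<bullet> w T \<omega> = \<eta> \<omega> \<bullet> w T \<omega> + ((LBINT t:{0..T}. b t \<omega> \<bullet> w t \<omega>)
     + (LBINT t:{0..T}. b t \<omega> \<bullet> (w T \<omega> - w t \<omega>)))"
    using y[unfolded evolves_def] Omega_T_Fubini(1)[OF i1] Omega_T_Fubini(1)[OF i2]
  proof eventually_elim
    case (elim \<omega>)
    have "y T \<omega> = \<eta> \<omega> + (LBINT s:{0..T}. b s \<omega>)" and bi: "set_integrable lborel {0..T} (\<lambda>s. b s \<omega>)"
      using elim T by auto
    then have "y T \<omega> \<bullet> w T \<omega> = \<eta> \<omega> \<bullet> w T \<omega> + (LBINT s:{0..T}. b s \<omega> \<bullet> w T \<omega>)"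
      using set_integrable_bounded_linear(2)[OF bounded_linear_inner_left bi] by (simp add: inner_add_left)
    also have "(LBINT s:{0..T}. b s \<omega> \<bullet> w T \<omega>)
       = (LBINT s:{0..T}. b s \<omega> \<bullet> w s \<omega> + b s \<omega> \<bullet> (w T \<omega> - w s \<omega>))"
      by (simp add: inner_diff_right)
    also have "\<dots> = (LBINT t:{0..T}. b t \<omega> \<bullet> w t \<omega>) + (LBINT t:{0..T}. b t \<omega> \<bullet> (w T \<omega> - w t \<omega>))"
      by (rule set_integral_add(2)) (use elim in auto)
    finally show ?case .
  qed
  have "(\<integral>\<omega>. y T \<omega> \<bullet> w T \<omega> \<partial>M) = (\<integral>\<omega>. \<eta> \<omega> \<bullet> w T \<omega> + ((LBINT t:{0..T}. b t \<omega> \<bullet> w t \<omega>)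
     + (LBINT t:{0..T}. b t \<omega> \<bullet> (w T \<omega> - w t \<omega>))) \<partial>M)"
    by (rule integral_cong_AE[OF _ _ ae])
       (use \<eta>0 Omega_T_Fubini(2)[OF i1] Omega_T_Fubini(2)[OF i2] in auto)
  also have "\<dots> = (\<integral>\<omega>. \<eta> \<omega> \<bullet> w T \<omega> \<partial>M) + ((\<integral>\<omega>. (LBINT t:{0..T}. b t \<omega> \<bullet> w t \<omega>) \<partial>M)
     + (\<integral>\<omega>. (LBINT t:{0..T}. b t \<omega> \<bullet> (w T \<omega> - w t \<omega>)) \<partial>M))"
    using \<eta>0 Omega_T_Fubini(2)[OF i1] Omega_T_Fubini(2)[OF i2] by simp
  finally show ?thesis using \<eta>1 zero Omega_T_Fubini(3)[OF i1] by simp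
qed

text \<open>
  The product rule in the mean for an absolutely continuous process against one driven by the noise:
  the martingale part contributes nothing.
\<close>

lemma mean_pairing:
  assumes T: "T > 0" and y1: "evolves b1 \<eta>1 y1" and y2: "evolves b2 \<eta>2 (\<lambda>t \<omega>. Z t \<omega> - w t \<omega>)"
    and sq: "square_integrable M T b1" "square_integrable M T y1" "square_integrable M T b2" "square_integrable M T Z"
    and \<eta>1: "\<eta>1 \<in> borel_measurable (F 0)" "integrable M (\<lambda>\<omega>. (norm (\<eta>1 \<omega>))\<^sup>2)"
    and \<eta>: "integrable M (\<lambda>\<omega>. \<eta>1 \<omega> \<bullet> \<eta>2 \<omega>)" and b1: "adapted F b1"
    and y1T: "y1 T \<in> borel_measurable M" "integrable M (\<lambda>\<omega>. (norm (y1 T \<omega>))\<^sup>2)"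
    and ZT: "Z T \<in> borel_measurable M" "integrable M (\<lambda>\<omega>. (norm (Z T \<omega>))\<^sup>2)"
  shows "(\<integral>\<omega>. y1 T \<omega> \<bullet> Z T \<omega> \<partial>M) = (\<integral>\<omega>. \<eta>1 \<omega> \<bullet> \<eta>2 \<omega> \<partial>M)
     + integral\<^sup>L (Omega_T M T) (\<lambda>(\<omega>, t). b1 t \<omega> \<bullet> Z t \<omega>) + integral\<^sup>L (Omega_T M T) (\<lambda>(\<omega>, t). y1 t \<omega> \<bullet> b2 t \<omega>)"
proof -
  have T0: "0 \<le> T" using T by simp
  note wT = measurable_w[OF T0] w_square(1)[OF T0]
  note sqy = square_integrable_diff[OF sq(4) square_integrable_w]
  note ym = borel_measurable_diff[OF ZT(1) wT(1)] and ysq = integrable_square_add(2)[OF ZT wT]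
  have "(\<integral>\<omega>. y1 T \<omega> \<bullet> Z T \<omega> \<partial>M) = (\<integral>\<omega>. y1 T \<omega> \<bullet> (Z T \<omega> - w T \<omega>) + y1 T \<omega> \<bullet> w T \<omega> \<partial>M)"
    by (simp add: inner_diff_right)
  also have "\<dots> = (\<integral>\<omega>. y1 T \<omega> \<bullet> (Z T \<omega> - w T \<omega>) \<partial>M) + (\<integral>\<omega>. y1 T \<omega> \<bullet> w T \<omega> \<partial>M)"
    by (rule Bochner_Integration.integral_add[OF integrable_inner_of_square[OF y1T(1) ym y1T(2) ysq]
          integrable_inner_of_square[OF y1T(1) wT(1) y1T(2) wT(2)]])
  also have "(\<integral>\<omega>. y1 T \<omega> \<bullet> (Z T \<omega> - w T \<omega>) \<partial>M) = (\<integral>\<omega>. \<eta>1 \<omega> \<bullet> \<eta>2 \<omega> \<partial>M)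
     + integral\<^sup>L (Omega_T M T) (\<lambda>(\<omega>, t). b1 t \<omega> \<bullet> (Z t \<omega> - w t \<omega>)) + integral\<^sup>L (Omega_T M T) (\<lambda>(\<omega>, t). y1 t \<omega> \<bullet> b2 t \<omega>)"
    by (rule mean_product_rule[OF T y1 y2 sq(1-3) sqy \<eta> y1T(1) ym])
  also have "(\<integral>\<omega>. y1 T \<omega> \<bullet> w T \<omega> \<partial>M) = integral\<^sup>L (Omega_T M T) (\<lambda>(\<omega>, t). b1 t \<omega> \<bullet> w t \<omega>)"
    by (rule mean_product_noise[OF T y1 \<eta>1 b1 sq(1) y1T(1)])
  finally show ?thesis
    using Bochner_Integration.integral_add[OF square_integrable_inner[OF sq(1) sqy]
        square_integrable_inner[OF sq(1) square_integrable_w]]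
    by (simp add: split_beta' inner_diff_right)
qed

end

text \<open>
  An input-to-state bound for \<open>y' = S y + h\<close>, pathwise and with a constant that does not depend on the
  horizon.
\<close>

definition path_gain :: "('a::euclidean_space \<Rightarrow>\<^sub>L 'a) \<Rightarrow> real \<Rightarrow> bool" where
  "path_gain S c \<longleftrightarrow> (\<forall>(T::real) y h. 0 \<le> T \<longrightarrow> continuous_on {0..T} y \<longrightarrow>
    set_borel_measurable lborel {0..T} h \<longrightarrow> set_integrable lborel {0..T} (\<lambda>s. (norm (h s))\<^sup>2) \<longrightarrow>
    (\<forall>t\<in>{0..T}. y t = y 0 + (LBINT s:{0..t}. S (y s) + h s)) \<longrightarrow>
    (norm (y T))\<^sup>2 \<le> c * ((norm (y 0))\<^sup>2 + (LBINT s:{0..T}. (norm (h s))\<^sup>2)) \<and>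
    (LBINT s:{0..T}. (norm (y s))\<^sup>2) \<le> c * ((norm (y 0))\<^sup>2 + (LBINT s:{0..T}. (norm (h s))\<^sup>2)))"

lemma path_gainD:
  fixes T :: real
  assumes "path_gain S c" "0 \<le> T" "continuous_on {0..T} y"
    "set_borel_measurable lborel {0..T} h" "set_integrable lborel {0..T} (\<lambda>s. (norm (h s))\<^sup>2)"
    "\<And>t. t \<in> {0..T} \<Longrightarrow> y t = y 0 + (LBINT s:{0..t}. S (y s) + h s)"
  shows "(norm (y T))\<^sup>2 \<le> c * ((norm (y 0))\<^sup>2 + (LBINT s:{0..T}. (norm (h s))\<^sup>2))"
    and "(LBINT s:{0..T}. (norm (y s))\<^sup>2) \<le> c * ((norm (y 0))\<^sup>2 + (LBINT s:{0..T}. (norm (h s))\<^sup>2))"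
  using assms(1)[unfolded path_gain_def, rule_format, OF assms(2-6)] by simp_all

lemma stable_path_gain:
  fixes S :: "'a::euclidean_space \<Rightarrow>\<^sub>L 'a"
  assumes "stable S"
  obtains c where "c > 0" and "path_gain S c"
proof -
  obtain Q q where Q: "adj Q = Q" "\<And>x y. S x \<bullet> Q y + x \<bullet> Q (S y) = - (x \<bullet> y)"
    "q > 0" "\<And>x. q * (norm x)\<^sup>2 \<le> x \<bullet> Q x"
    by (rule lyapunov_function_exists[OF assms]) (rule that)
  define a where "a = norm Q + 2 * (norm Q)\<^sup>2 + 1"
  have a: "a > 0" by (simp add: a_def add_nonneg_pos)
  define c where "c = a / q + 2 * a"
  have c: "c > 0" using a Q(3) by (simp add: c_def add_pos_pos)
  show ?thesis
  proof (rule that[OF c], unfold path_gain_def, intro allI impI)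
    fix T :: real and y h
    assume as: "0 \<le> T" "continuous_on {0..T} y"
      "set_borel_measurable lborel {0..T} h" "set_integrable lborel {0..T} (\<lambda>s. (norm (h s))\<^sup>2)"
      "\<forall>t\<in>{0..T}. y t = y 0 + (LBINT s:{0..t}. S (y s) + h s)"
    let ?I = "LBINT s:{0..T}. (norm (h s))\<^sup>2" and ?J = "LBINT s:{0..T}. (norm (y s))\<^sup>2"
    have I: "0 \<le> ?I" and J: "0 \<le> ?J" by (simp_all add: set_lebesgue_integral_def)
    let ?r = "(norm (y 0))\<^sup>2 + ?I"
    have r: "0 \<le> ?r" using I by simp
    have "y T \<bullet> Q (y T) + ?J / 2 \<le> y 0 \<bullet> Q (y 0) + 2 * (norm Q)\<^sup>2 * ?I"
      by (rule energy_estimate[OF as(1) Q(1,2) as(2-4)]) (rule as(5)[rule_format])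
    also have "\<dots> \<le> norm Q * (norm (y 0))\<^sup>2 + 2 * (norm Q)\<^sup>2 * ?I"
      using quadratic_form_le_norm[of "y 0" Q] by simp
    also have "\<dots> \<le> a * (norm (y 0))\<^sup>2 + a * ?I"
      using I by (intro add_mono mult_right_mono) (auto simp: a_def)
    finally have e: "y T \<bullet> Q (y T) + ?J / 2 \<le> a * ?r" by (simp add: distrib_left)
    have "0 \<le> y T \<bullet> Q (y T)" using Q(3,4) order_trans[of 0 "q * (norm (y T))\<^sup>2"] by simp
    then have "?J \<le> 2 * a * ?r" using e by simp
    also have "\<dots> \<le> c * ?r" using r a Q(3) by (intro mult_right_mono) (auto simp: c_def)
    finally have 1: "?J \<le> c * ?r" .
    have "q * (norm (y T))\<^sup>2 \<le> a * ?r" using e J Q(4)[of "y T"] by linarith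
    then have "(norm (y T))\<^sup>2 \<le> a / q * ?r" using Q(3) by (simp add: field_simps)
    also have "\<dots> \<le> c * ?r" using r a by (intro mult_right_mono) (auto simp: c_def)
    finally show "(norm (y T))\<^sup>2 \<le> c * ?r \<and> ?J \<le> c * ?r" using 1 by blast
  qed
qed

context noise
begin

text \<open>
  \<open>dZ = (S Z + g) dt + dw\<close> with \<open>Z\<^sub>0 = \<eta>\<close>; subtracting the noise leaves an ordinary integral equation.
\<close>

definition solves :: "('x \<Rightarrow>\<^sub>L 'x) \<Rightarrow> (real \<Rightarrow> 'w \<Rightarrow> 'x) \<Rightarrow> ('w \<Rightarrow> 'x) \<Rightarrow> (real \<Rightarrow> 'w \<Rightarrow> 'x) \<Rightarrow> bool" where
  "solves S g \<eta> Z \<longleftrightarrow> adapted F Z \<and> jointly_measurable M Z \<and>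
     (AE \<omega> in M. continuous_on {0..} (\<lambda>t. Z t \<omega>)) \<and>
     evolves (\<lambda>s \<omega>. S (Z s \<omega>) + g s \<omega>) \<eta> (\<lambda>t \<omega>. Z t \<omega> - w t \<omega>)"

lemma solves_measurable:
  assumes "solves S g \<eta> Z"
  shows "t \<ge> 0 \<Longrightarrow> Z t \<in> borel_measurable (F t)" "t \<ge> 0 \<Longrightarrow> Z t \<in> borel_measurable M"
    "T > 0 \<Longrightarrow> (\<lambda>(\<omega>, t). Z t \<omega>) \<in> borel_measurable (Omega_T M T)"
  using assms filtration_measurable_M[OF filtration]
  by (auto simp: solves_def adapted_def jointly_measurable_def)

text \<open>
  The difference \<open>y = Z - w\<close> solves \<open>y' = S y + (S w + g)\<close>, whose input is square integrable.
\<close>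

lemma a_priori_estimate:
  assumes S: "stable S" and Z: "solves S g \<eta> Z"
    and \<eta>: "\<eta> \<in> borel_measurable M" "integrable M (\<lambda>\<omega>. (norm (\<eta> \<omega>))\<^sup>2)"
    and g: "\<And>T. T > 0 \<Longrightarrow> square_integrable M T g"
  shows "T > 0 \<Longrightarrow> square_integrable M T Z" and "t \<ge> 0 \<Longrightarrow> integrable M (\<lambda>\<omega>. (norm (Z t \<omega>))\<^sup>2)"
proof -
  obtain c where c: "c > 0" and est: "path_gain S c"
    by (rule stable_path_gain[OF S])
  have ex: "\<exists>G. integrable M G \<and> (\<forall>t. 0 \<le> t \<and> t \<le> T \<longrightarrow> (AE \<omega> in M. (norm (Z t \<omega>))\<^sup>2 \<le> G \<omega> + 2 * (norm (w t \<omega>))\<^sup>2))"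
    if T: "T > 0" for T
  proof -
    define h where "h t \<omega> = S (w t \<omega>) + g t \<omega>" for t \<omega>
    have h: "square_integrable M T h"
      unfolding h_def by (intro square_integrable_add(1) square_integrable_linear square_integrable_w g T)
    have hsq: "integrable (Omega_T M T) (\<lambda>(\<omega>, t). (norm (h t \<omega>))\<^sup>2)" using h by (simp add: square_integrable_def)
    have hm: "AE \<omega> in M. set_borel_measurable lborel {0..T} (\<lambda>t. h t \<omega>)"
      by (intro AE_I2 square_integrable_path_measurable[OF h])
    define H where "H \<omega> = 2 * (c * ((norm (\<eta> \<omega>))\<^sup>2 + (LBINT s:{0..T}. (norm (h s \<omega>))\<^sup>2)))" for \<omega>
    have H: "integrable M H" unfolding H_def using \<eta>(2) Omega_T_Fubini(2)[OF hsq] by simp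
    have ev: "evolves (\<lambda>s \<omega>. S (Z s \<omega>) + g s \<omega>) \<eta> (\<lambda>t \<omega>. Z t \<omega> - w t \<omega>)"
      and cont: "AE \<omega> in M. continuous_on {0..} (\<lambda>t. Z t \<omega>)" using Z by (auto simp: solves_def)
    have "AE \<omega> in M. \<forall>t. 0 \<le> t \<and> t \<le> T \<longrightarrow> (norm (Z t \<omega>))\<^sup>2 \<le> H \<omega> + 2 * (norm (w t \<omega>))\<^sup>2"
      using ev[unfolded evolves_def] evolves_0[OF ev] cont continuous hm Omega_T_Fubini(1)[OF hsq]
    proof eventually_elim
      case (elim \<omega>)
      show ?case
      proof (intro allI impI)
        fix t assume t: "0 \<le> t \<and> t \<le> T"
        define y where "y s = Z s \<omega> - w s \<omega>" for s
        have hs: "set_integrable lborel {0..t} (\<lambda>s. (norm (h s \<omega>))\<^sup>2)"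
          using elim t by (auto intro: set_integrable_subset)
        have eq: "S (Z s \<omega>) + g s \<omega> = S (y s) + h s \<omega>" for s
          by (simp add: y_def h_def blinfun.diff_right)
        have "(norm (y t))\<^sup>2 \<le> c * ((norm (y 0))\<^sup>2 + (LBINT s:{0..t}. (norm (h s \<omega>))\<^sup>2))"
        proof (rule path_gainD(1)[OF est])
          show "continuous_on {0..t} y" unfolding y_def
            using elim by (intro continuous_on_diff) (auto elim: continuous_on_subset)
          show "set_borel_measurable lborel {0..t} (\<lambda>s. h s \<omega>)"
            using set_borel_measurable_subset[of lborel "{0..T}" "\<lambda>s. h s \<omega>" "{0..t}"] elim t by auto
          show "y s = y 0 + (LBINT r:{0..s}. S (y r) + h r \<omega>)" if "s \<in> {0..t}" for s
            using elim that by (simp add: eq[symmetric]) (simp add: y_def)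
        qed (use t hs in auto)
        then have "(norm (y t))\<^sup>2 \<le> c * ((norm (\<eta> \<omega>))\<^sup>2 + (LBINT s:{0..t}. (norm (h s \<omega>))\<^sup>2))"
          using elim by (simp add: y_def)
        also have "\<dots> \<le> c * ((norm (\<eta> \<omega>))\<^sup>2 + (LBINT s:{0..T}. (norm (h s \<omega>))\<^sup>2))"
        proof (intro mult_left_mono add_left_mono)
          show "(LBINT s:{0..t}. (norm (h s \<omega>))\<^sup>2) \<le> (LBINT s:{0..T}. (norm (h s \<omega>))\<^sup>2)"
            unfolding set_lebesgue_integral_def
            by (rule integral_mono) (use elim hs t in \<open>auto simp: set_integrable_def indicator_def\<close>)
        qed (use c in simp)
        finally have "2 * (norm (y t))\<^sup>2 \<le> H \<omega>" by (simp add: H_def)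
        then show "(norm (Z t \<omega>))\<^sup>2 \<le> H \<omega> + 2 * (norm (w t \<omega>))\<^sup>2"
          using norm_add_square_le[of "y t" "w t \<omega>"] by (simp add: y_def)
      qed
    qed
    then have "\<forall>t. 0 \<le> t \<and> t \<le> T \<longrightarrow> (AE \<omega> in M. (norm (Z t \<omega>))\<^sup>2 \<le> H \<omega> + 2 * (norm (w t \<omega>))\<^sup>2)"
      by (auto elim!: eventually_mono)
    with H show ?thesis by blast
  qed
  have sq: "integrable M (\<lambda>\<omega>. (norm (Z t \<omega>))\<^sup>2)" if t: "t \<ge> 0" for t
  proof -
    from ex[of "t + 1"] t obtain G where G: "integrable M G"
      "\<forall>s. 0 \<le> s \<and> s \<le> t + 1 \<longrightarrow> (AE \<omega> in M. (norm (Z s \<omega>))\<^sup>2 \<le> G \<omega> + 2 * (norm (w s \<omega>))\<^sup>2)" by auto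
    show ?thesis
    proof (rule integrable_square_mono[OF solves_measurable(2)[OF Z t]])
      show "integrable M (\<lambda>\<omega>. G \<omega> + 2 * (norm (w t \<omega>))\<^sup>2)" using G(1) w_square(1)[OF t] by simp
    qed (use G t in auto)
  qed
  then show "t \<ge> 0 \<Longrightarrow> integrable M (\<lambda>\<omega>. (norm (Z t \<omega>))\<^sup>2)" .
  show "square_integrable M T Z" if T: "T > 0"
  proof -
    obtain G where G: "integrable M G"
      "\<forall>s. 0 \<le> s \<and> s \<le> T \<longrightarrow> (AE \<omega> in M. (norm (Z s \<omega>))\<^sup>2 \<le> G \<omega> + 2 * (norm (w s \<omega>))\<^sup>2)" using ex[OF T] by blast
    show ?thesis
    proof (rule square_integrable_of_bound[OF solves_measurable(3)[OF Z T] sq])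
      fix t assume t: "0 < t" "t < T"
      have "(\<integral>\<omega>. (norm (Z t \<omega>))\<^sup>2 \<partial>M) \<le> (\<integral>\<omega>. G \<omega> + 2 * (norm (w t \<omega>))\<^sup>2 \<partial>M)"
        using G t sq[of t] w_square(1)[of t] by (intro integral_mono_AE) auto
      also have "\<dots> = (\<integral>\<omega>. G \<omega> \<partial>M) + 2 * (\<integral>\<omega>. (norm (w t \<omega>))\<^sup>2 \<partial>M)"
        using G w_square(1)[of t] t by simp
      also have "\<dots> \<le> (\<integral>\<omega>. G \<omega> \<partial>M) + 2 * (\<kappa> * T)"
        using w_square(2)[of t] \<kappa>_nonneg mult_left_mono[of t T \<kappa>] t by simp
      finally show "(\<integral>\<omega>. (norm (Z t \<omega>))\<^sup>2 \<partial>M) \<le> (\<integral>\<omega>. G \<omega> \<partial>M) + 2 * (\<kappa> * T)" .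
    qed simp
  qed
qed

lemma square_integrable_zero: "square_integrable M T (\<lambda>t \<omega>. 0)"
  by (simp add: square_integrable_def split_beta')

text \<open>
  With the Lyapunov function \<open>Q\<close> of \<open>S\<close> put \<open>m t = E(Z\<^sub>t \<bullet> Q Z\<^sub>t)\<close> and \<open>v t = E(norm Z\<^sub>t)\<^sup>2\<close>.  The product rule in the mean
  gives \<open>m t - m s \<le> k (t - s) - \<integral>\<^sub>s\<^sup>t v\<close>, and \<open>m\<close> and \<open>v\<close> are comparable.  Over a unit interval this yields
  \<open>(1 + q) m t \<le> q m (t - 1) + (1 + q) k\<close>, so \<open>m\<close> stays bounded for all times, by a constant depending only on
  \<open>S\<close>, the noise and the initial value.
\<close>

lemma second_moment_bounded:
  assumes S: "stable S" and \<eta>: "\<eta> \<in> borel_measurable (F 0)" "integrable M (\<lambda>\<omega>. (norm (\<eta> \<omega>))\<^sup>2)"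
  obtains c where "c > 0"
    and "\<And>Z t. solves S (\<lambda>_ _. 0) \<eta> Z \<Longrightarrow> t \<ge> 0 \<Longrightarrow> (\<integral>\<omega>. (norm (Z t \<omega>))\<^sup>2 \<partial>M) \<le> c"
proof -
  have \<eta>M: "\<eta> \<in> borel_measurable M" by (rule filtration_measurable_M[OF filtration \<eta>(1)])
  obtain Q p where Q: "adj Q = Q" "\<And>x y. S x \<bullet> Q y + x \<bullet> Q (S y) = - (x \<bullet> y)"
    "p > 0" "\<And>x. p * (norm x)\<^sup>2 \<le> x \<bullet> Q x"
    by (rule lyapunov_function_exists[OF S]) (rule that)
  have Qsym: "Q x \<bullet> y = x \<bullet> Q y" for x y using inner_adj[of x Q y] Q(1) by simp
  define q where "q = norm Q"
  have q: "0 \<le> q" by (simp add: q_def)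
  define k where "k = q * \<kappa>"
  have k: "0 \<le> k" using \<kappa>_nonneg by (simp add: k_def q_def)
  define m0 where "m0 = (\<integral>\<omega>. Q (\<eta> \<omega>) \<bullet> \<eta> \<omega> \<partial>M)"
  define C where "C = m0 + (1 + q) * k"
  have Qnn: "0 \<le> Q x \<bullet> x" for x
    using Q(3,4) order_trans[of 0 "p * (norm x)\<^sup>2" "x \<bullet> Q x"] by (simp add: inner_commute)
  have C: "0 \<le> C" using k q Qnn by (auto simp: C_def m0_def intro!: add_nonneg_nonneg integral_nonneg_AE)
  have Qsq: "integrable M (\<lambda>\<omega>. (norm (Q (X \<omega>)))\<^sup>2)"
    if "X \<in> borel_measurable M" "integrable M (\<lambda>\<omega>. (norm (X \<omega>))\<^sup>2)" for X
    by (rule integrable_square_linear[OF that])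
  have Qint: "integrable M (\<lambda>\<omega>. Q (X \<omega>) \<bullet> Y \<omega>)"
    if "X \<in> borel_measurable M" "integrable M (\<lambda>\<omega>. (norm (X \<omega>))\<^sup>2)"
      "Y \<in> borel_measurable M" "integrable M (\<lambda>\<omega>. (norm (Y \<omega>))\<^sup>2)" for X Y
    by (rule integrable_inner_of_square[OF measurable_blinfun_apply[OF that(1)] that(3) Qsq[OF that(1,2)] that(4)])
  have main: "(\<integral>\<omega>. (norm (Z t \<omega>))\<^sup>2 \<partial>M) \<le> C / p"
    if Z: "solves S (\<lambda>_ _. 0) \<eta> Z" and t: "t \<ge> 0" for Z t
  proof -
    note Zm = solves_measurable[OF Z]
    note Zsq = a_priori_estimate[OF S Z \<eta>M \<eta>(2) square_integrable_zero]
    define y where "y t \<omega> = Z t \<omega> - w t \<omega>" for t \<omega>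
    define b where "b t \<omega> = S (Z t \<omega>)" for t \<omega>
    have ev: "evolves b \<eta> y" using Z by (simp add: solves_def b_def[abs_def] y_def[abs_def])
    have ym: "y t \<in> borel_measurable M" if "t \<ge> 0" for t
      unfolding y_def using Zm(2)[OF that] measurable_w[OF that] by measurable
    have ysq: "integrable M (\<lambda>\<omega>. (norm (y t \<omega>))\<^sup>2)" if t: "t \<ge> 0" for t
      unfolding y_def by (rule integrable_square_add(2)[OF Zm(2)[OF t] Zsq(2)[OF t] measurable_w[OF t] w_square(1)[OF t]])
    define m where "m t = (\<integral>\<omega>. Q (Z t \<omega>) \<bullet> Z t \<omega> \<partial>M)" for t
    define \<phi> where "\<phi> t = (\<integral>\<omega>. Q (w t \<omega>) \<bullet> w t \<omega> \<partial>M)" for t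
    define v where "v t = (\<integral>\<omega>. (norm (Z t \<omega>))\<^sup>2 \<partial>M)" for t
    have vint: "set_integrable lborel {0..T} v" if "T > 0" for T
      using Omega_T_Fubini(5)[of T "\<lambda>t \<omega>. (norm (Z t \<omega>))\<^sup>2"] Zsq(1)[OF that]
      by (simp add: v_def[abs_def] square_integrable_def)
    have vT: "(LBINT t:{0..T}. v t) = integral\<^sup>L (Omega_T M T) (\<lambda>(\<omega>, t). (norm (Z t \<omega>))\<^sup>2)" if "T > 0" for T
      using Omega_T_Fubini(6)[of T "\<lambda>t \<omega>. (norm (Z t \<omega>))\<^sup>2"] Zsq(1)[OF that]
      by (simp add: v_def square_integrable_def)
    have vn: "0 \<le> v t" for t by (simp add: v_def)
    have mT: "m T = m0 - (LBINT t:{0..T}. v t) + \<phi> T" if T: "T > 0" for T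
    proof -
      have sqb: "square_integrable M T b" unfolding b_def by (rule square_integrable_linear[OF Zsq(1)[OF T]])
      have sqy: "square_integrable M T y" unfolding y_def by (rule square_integrable_diff[OF Zsq(1)[OF T] square_integrable_w])
      note sqQ = square_integrable_linear[of T _ Q]
      have bad: "adapted F (\<lambda>t \<omega>. Q (b t \<omega>))"
        unfolding adapted_def b_def by (auto intro!: measurable_blinfun_apply Zm(1))
      have T0: "0 \<le> T" using T by simp
      note Qy = measurable_blinfun_apply[OF ym[OF T0]] Qsq[OF ym[OF T0] ysq[OF T0]]
      have 1: "(\<integral>\<omega>. Q (y T \<omega>) \<bullet> Z T \<omega> \<partial>M) = m0 + integral\<^sup>L (Omega_T M T) (\<lambda>(\<omega>, t). Q (b t \<omega>) \<bullet> Z t \<omega>)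
          + integral\<^sup>L (Omega_T M T) (\<lambda>(\<omega>, t). Q (y t \<omega>) \<bullet> b t \<omega>)"
        unfolding m0_def
        by (rule mean_pairing[OF T evolves_linear[OF ev, of Q] ev[unfolded y_def] sqQ[OF sqb] sqQ[OF sqy] sqb Zsq(1)[OF T]
              measurable_blinfun_apply[OF \<eta>(1)] Qsq[OF \<eta>M \<eta>(2)] Qint[OF \<eta>M \<eta>(2) \<eta>M \<eta>(2)] bad Qy Zm(2)[OF T0] Zsq(2)[OF T0]])
      have 2: "(\<integral>\<omega>. Q (y T \<omega>) \<bullet> w T \<omega> \<partial>M) = integral\<^sup>L (Omega_T M T) (\<lambda>(\<omega>, t). Q (b t \<omega>) \<bullet> w t \<omega>)"
        by (rule mean_product_noise[OF T evolves_linear[OF ev, of Q] measurable_blinfun_apply[OF \<eta>(1)]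
              Qsq[OF \<eta>M \<eta>(2)] bad sqQ[OF sqb] Qy(1)])
      note wm = measurable_w[OF T0] and wsq = w_square(1)[OF T0]
      have "m T = (\<integral>\<omega>. Q (y T \<omega>) \<bullet> Z T \<omega> + Q (y T \<omega>) \<bullet> w T \<omega> + Q (w T \<omega>) \<bullet> w T \<omega> \<partial>M)"
        unfolding m_def
      proof (rule Bochner_Integration.integral_cong[OF refl])
        fix \<omega>
        have "Z T \<omega> = y T \<omega> + w T \<omega>" by (simp add: y_def)
        then show "Q (Z T \<omega>) \<bullet> Z T \<omega> = Q (y T \<omega>) \<bullet> Z T \<omega> + Q (y T \<omega>) \<bullet> w T \<omega> + Q (w T \<omega>) \<bullet> w T \<omega>"
          using Qsym[of "w T \<omega>" "y T \<omega>"] by (simp add: blinfun.add_right inner_add inner_commute)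
      qed
      also have "\<dots> = (\<integral>\<omega>. Q (y T \<omega>) \<bullet> Z T \<omega> \<partial>M) + (\<integral>\<omega>. Q (y T \<omega>) \<bullet> w T \<omega> \<partial>M) + \<phi> T"
        using Qint[OF ym[OF T0] ysq[OF T0] Zm(2)[OF T0] Zsq(2)[OF T0]] Qint[OF ym[OF T0] ysq[OF T0] wm wsq]
          Qint[OF wm wsq wm wsq] by (simp add: \<phi>_def)
      also have "\<dots> = m0 + (integral\<^sup>L (Omega_T M T) (\<lambda>(\<omega>, t). Q (b t \<omega>) \<bullet> Z t \<omega>)
          + integral\<^sup>L (Omega_T M T) (\<lambda>(\<omega>, t). Q (y t \<omega>) \<bullet> b t \<omega>)
          + integral\<^sup>L (Omega_T M T) (\<lambda>(\<omega>, t). Q (b t \<omega>) \<bullet> w t \<omega>)) + \<phi> T"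
        by (simp add: 1 2)
      also have "integral\<^sup>L (Omega_T M T) (\<lambda>(\<omega>, t). Q (b t \<omega>) \<bullet> Z t \<omega>)
          + integral\<^sup>L (Omega_T M T) (\<lambda>(\<omega>, t). Q (y t \<omega>) \<bullet> b t \<omega>)
          + integral\<^sup>L (Omega_T M T) (\<lambda>(\<omega>, t). Q (b t \<omega>) \<bullet> w t \<omega>)
        = integral\<^sup>L (Omega_T M T) (\<lambda>x. (\<lambda>(\<omega>, t). Q (b t \<omega>) \<bullet> Z t \<omega>) x
          + (\<lambda>(\<omega>, t). Q (y t \<omega>) \<bullet> b t \<omega>) x + (\<lambda>(\<omega>, t). Q (b t \<omega>) \<bullet> w t \<omega>) x)"
        using square_integrable_inner[OF sqQ[OF sqb] Zsq(1)[OF T]] square_integrable_inner[OF sqQ[OF sqy] sqb]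
          square_integrable_inner[OF sqQ[OF sqb] square_integrable_w] by simp
      also have "\<dots> = integral\<^sup>L (Omega_T M T) (\<lambda>x. - (\<lambda>(\<omega>, t). (norm (Z t \<omega>))\<^sup>2) x)"
      proof (rule Bochner_Integration.integral_cong[OF refl])
        fix x :: "'w \<times> real"
        obtain \<omega> t where x: "x = (\<omega>, t)" by force
        have "Q (y t \<omega>) \<bullet> b t \<omega> = Q (b t \<omega>) \<bullet> y t \<omega>"
          using Qsym[of "y t \<omega>" "b t \<omega>"] by (simp add: inner_commute)
        moreover have "2 * (Q (b t \<omega>) \<bullet> Z t \<omega>) = - (norm (Z t \<omega>))\<^sup>2"
          using Q(2)[of "Z t \<omega>" "Z t \<omega>"] by (simp add: b_def Qsym power2_norm_eq_inner inner_commute)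
        ultimately show "(\<lambda>(\<omega>, t). Q (b t \<omega>) \<bullet> Z t \<omega>) x
          + (\<lambda>(\<omega>, t). Q (y t \<omega>) \<bullet> b t \<omega>) x + (\<lambda>(\<omega>, t). Q (b t \<omega>) \<bullet> w t \<omega>) x
          = - (\<lambda>(\<omega>, t). (norm (Z t \<omega>))\<^sup>2) x"
          by (simp add: x y_def inner_diff_right)
      qed
      also have "\<dots> = - (LBINT t:{0..T}. v t)" by (simp add: vT[OF T])
      finally show ?thesis by simp
    qed
    have \<phi>inc: "\<phi> t - \<phi> s \<le> k * (t - s)" if st: "0 \<le> s" "s \<le> t" for s t
    proof -
      have t0: "0 \<le> t" using st by simp
      note [measurable] = measurable_w[OF st(1)] measurable_w[OF t0]
      have [measurable]: "(\<lambda>\<omega>. w t \<omega> - w s \<omega>) \<in> borel_measurable M" by measurable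
      have Qws: "(\<lambda>\<omega>. Q (w s \<omega>)) \<in> borel_measurable (F s)" using adapted[OF st(1)] by measurable
      note i = Qint[OF measurable_w[OF st(1)] w_square(1)[OF st(1)] measurable_w[OF st(1)] w_square(1)[OF st(1)]]
        Qint[OF _ increment_square(1)[OF st] _ increment_square(1)[OF st]]
        integrable_inner_of_square[OF measurable_blinfun_apply[OF measurable_w[OF st(1)]] _ Qsq[OF measurable_w[OF st(1)] w_square(1)[OF st(1)]] increment_square(1)[OF st]]
      have "\<phi> t = (\<integral>\<omega>. Q (w s \<omega>) \<bullet> w s \<omega> + 2 * (Q (w s \<omega>) \<bullet> (w t \<omega> - w s \<omega>))
          + Q (w t \<omega> - w s \<omega>) \<bullet> (w t \<omega> - w s \<omega>) \<partial>M)"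
        unfolding \<phi>_def
      proof (rule Bochner_Integration.integral_cong[OF refl])
        show "Q (w t \<omega>) \<bullet> w t \<omega> = Q (w s \<omega>) \<bullet> w s \<omega> + 2 * (Q (w s \<omega>) \<bullet> (w t \<omega> - w s \<omega>))
          + Q (w t \<omega> - w s \<omega>) \<bullet> (w t \<omega> - w s \<omega>)" for \<omega>
          using Qsym[of "w t \<omega>" "w s \<omega>"] by (simp add: blinfun.diff_right inner_diff inner_commute)
      qed
      also have "\<dots> = \<phi> s + 2 * (\<integral>\<omega>. Q (w s \<omega>) \<bullet> (w t \<omega> - w s \<omega>) \<partial>M)
          + (\<integral>\<omega>. Q (w t \<omega> - w s \<omega>) \<bullet> (w t \<omega> - w s \<omega>) \<partial>M)"
        using i by (simp add: \<phi>_def)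
      also have "(\<integral>\<omega>. Q (w s \<omega>) \<bullet> (w t \<omega> - w s \<omega>) \<partial>M) = 0"
        by (rule increment_orthogonal[OF st Qws Qsq[OF measurable_w[OF st(1)] w_square(1)[OF st(1)]]])
      also have "(\<integral>\<omega>. Q (w t \<omega> - w s \<omega>) \<bullet> (w t \<omega> - w s \<omega>) \<partial>M) \<le> (\<integral>\<omega>. q * (norm (w t \<omega> - w s \<omega>))\<^sup>2 \<partial>M)"
        using i(2) increment_square(1)[OF st] quadratic_form_le_norm[of _ Q]
        by (intro integral_mono) (auto simp: q_def inner_commute)
      also have "\<dots> \<le> q * (\<kappa> * (t - s))"
        using mult_left_mono[OF increment_square(2)[OF st] q] by simp
      finally show ?thesis by (simp add: k_def)
    qed
    have \<phi>0: "\<phi> 0 = 0"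
      unfolding \<phi>_def
    proof (rule integral_eq_zero_AE)
      show "AE \<omega> in M. Q (w 0 \<omega>) \<bullet> w 0 \<omega> = 0" using continuous by eventually_elim simp
    qed
    have m0: "m 0 = m0"
      unfolding m_def m0_def
    proof (rule integral_cong_AE)
      show "AE \<omega> in M. Q (Z 0 \<omega>) \<bullet> Z 0 \<omega> = Q (\<eta> \<omega>) \<bullet> \<eta> \<omega>"
        using evolves_0[OF ev] continuous by eventually_elim (simp add: y_def)
    qed (use Zm(2)[of 0] \<eta>M in measurable)
    have minc: "m t - m s \<le> - (LBINT r:{s<..t}. v r) + k * (t - s)" if st: "0 \<le> s" "s < t" for s t
    proof (cases "s = 0")
      case True
      have "(LBINT r:{0<..t}. v r) = (LBINT r:{0..t}. v r)"
        by (rule set_integral_discrete_difference[where X = "{0}"]) auto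
      then show ?thesis using mT[of t] st \<phi>inc[of 0 t] True by (simp add: m0 \<phi>0)
    next
      case False
      have "(LBINT r:{0..s} \<union> {s<..t}. v r) = (LBINT r:{0..s}. v r) + (LBINT r:{s<..t}. v r)"
        using vint[of t] st by (intro set_integral_Un) (auto intro: set_integrable_subset)
      moreover have "{0..s} \<union> {s<..t} = {0..t}" using st by auto
      ultimately show ?thesis using mT[of t] mT[of s] st False \<phi>inc[of s t] by simp
    qed
    have m_le: "m t \<le> q * v t" if "t \<ge> 0" for t
    proof -
      have "m t \<le> (\<integral>\<omega>. q * (norm (Z t \<omega>))\<^sup>2 \<partial>M)"
        unfolding m_def
        using Qint[OF Zm(2)[OF that] Zsq(2)[OF that] Zm(2)[OF that] Zsq(2)[OF that]] Zsq(2)[OF that]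
          quadratic_form_le_norm[of _ Q]
        by (intro integral_mono) (auto simp: q_def inner_commute)
      then show ?thesis by (simp add: v_def)
    qed
    \<comment> \<open>induction over unit intervals; the step averages \<open>m t \<le> q * v r + k\<close> over \<open>r \<in> {t - 1<..t}\<close>\<close>
    have bounded: "m t \<le> C" if "t \<in> {0..real n}" for n t
      using that
    proof (induction n arbitrary: t)
      case 0
      then show ?case using k q by (simp add: m0 C_def)
    next
      case (Suc n)
      show ?case
      proof (cases "t \<le> 1")
        case True
        have "m t \<le> m0 + k * t"
        proof (cases "t = 0")
          case False
          have "0 \<le> (LBINT r:{0<..t}. v r)"
            unfolding set_lebesgue_integral_def using vn by (intro integral_nonneg_AE) auto
          then show ?thesis using minc[of 0 t] False Suc.prems m0 by auto
        qed (simp add: m0)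
        also have "k * t \<le> k * 1" using True k by (intro mult_left_mono)
        also have "m0 + k * 1 \<le> C" using k q by (simp add: C_def distrib_right)
        finally show ?thesis by simp
      next
        case False
        define s where "s = t - 1"
        have s: "0 \<le> s" "s < t" "t - s = 1" "s \<in> {0..real n}" using False Suc.prems by (auto simp: s_def)
        have ms: "m s \<le> C" by (rule Suc.IH[OF s(4)])
        let ?I = "LBINT r:{s<..t}. v r"
        have I: "m t - m s \<le> - ?I + k" using minc[OF s(1,2)] s(3) by simp
        have iv: "set_integrable lborel {s<..t} v"
          using vint[of t] s by (intro set_integrable_subset[of lborel "{0..t}" v "{s<..t}"]) auto
        have pw: "m t \<le> q * v r + k" if r: "r \<in> {s<..t}" for r
        proof (cases "r = t")
          case True
          then show ?thesis using m_le[of t] s k by simp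
        next
          case False
          then have "r < t" "0 \<le> r" using r s by auto
          have "0 \<le> (LBINT x:{r<..t}. v x)"
            unfolding set_lebesgue_integral_def using vn by (intro integral_nonneg_AE) auto
          then have "m t \<le> m r + k * (t - r)" using minc[OF \<open>0 \<le> r\<close> \<open>r < t\<close>] by simp
          also have "k * (t - r) \<le> k * 1" using r s k by (intro mult_left_mono) auto
          also have "m r \<le> q * v r" by (rule m_le[OF \<open>0 \<le> r\<close>])
          finally show ?thesis by simp
        qed
        have const: "set_integrable lborel {s<..t} (\<lambda>_. d)" "(LBINT r:{s<..t}. d) = d" for d :: real
          using s by (simp_all add: set_integrable_def set_lebesgue_integral_def)
        have "m t = (LBINT r:{s<..t}. m t)" by (simp add: const)
        also have "\<dots> \<le> (LBINT r:{s<..t}. q * v r + k)"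
          by (rule set_integral_mono) (use const iv pw in \<open>auto intro!: set_integral_add\<close>)
        also have "\<dots> = q * ?I + k" using iv const by (subst set_integral_add(2)) auto
        also have "q * ?I \<le> q * (C - m t + k)" using I ms q by (intro mult_left_mono) auto
        finally have "(1 + q) * m t \<le> q * C + (1 + q) * k" by (simp add: algebra_simps)
        also have "\<dots> \<le> (1 + q) * C" 
        proof -
          have "0 \<le> m0" using Qnn by (auto simp: m0_def intro!: integral_nonneg_AE)
          then show ?thesis by (simp add: C_def algebra_simps)
        qed
        finally show ?thesis using q by (simp add: mult_le_cancel_left_pos)
      qed
    qed
    have "p * v t \<le> m t"
    proof -
      have "(\<integral>\<omega>. p * (norm (Z t \<omega>))\<^sup>2 \<partial>M) \<le> m t"
        unfolding m_def
        using Qint[OF Zm(2)[OF t] Zsq(2)[OF t] Zm(2)[OF t] Zsq(2)[OF t]] Zsq(2)[OF t] Q(4)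
        by (intro integral_mono) (auto simp: inner_commute)
      then show ?thesis by (simp add: v_def)
    qed
    also have "m t \<le> C"
      using bounded[of t "nat \<lceil>t\<rceil>"] t by (simp add: real_nat_ceiling_ge)
    finally show ?thesis using Q(3) by (simp add: v_def field_simps)
  qed
  show ?thesis
  proof (rule that[of "C / p + 1"])
    show "0 < C / p + 1" using C Q(3) by (simp add: add_nonneg_pos)
    show "(\<integral>\<omega>. (norm (Z t \<omega>))\<^sup>2 \<partial>M) \<le> C / p + 1" if "solves S (\<lambda>_ _. 0) \<eta> Z" "t \<ge> 0" for Z t
      using main[OF that] by simp
  qed
qed

end

section \<open>Closed-loop processes\<close>

context noise
begin

lemma ou_process_iff_solves:
  fixes W :: "real \<Rightarrow> 'w \<Rightarrow> real^'d" and B :: "(real^'m) \<Rightarrow>\<^sub>L 'x" and K :: "(real^'d) \<Rightarrow>\<^sub>L 'x"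
  assumes w: "AE \<omega> in M. \<forall>t\<ge>0. w t \<omega> = K (W t \<omega>)"
  shows "ou_process M F W \<xi> A B K u Z \<longleftrightarrow> solves A (\<lambda>t \<omega>. B (u t \<omega>)) \<xi> Z"
proof -
  let ?b = "\<lambda>\<omega> s. A (Z s \<omega>) + B (u s \<omega>)"
  have "AE \<omega> in M. (\<forall>t\<ge>0. set_integrable lborel {0..t} (?b \<omega>) \<and>
        Z t \<omega> = \<xi> \<omega> + (LBINT s:{0..t}. ?b \<omega> s) + K (W t \<omega>))
    \<longleftrightarrow> (\<forall>t\<ge>0. set_integrable lborel {0..t} (?b \<omega>) \<and>
        Z t \<omega> - w t \<omega> = \<xi> \<omega> + (LBINT s:{0..t}. ?b \<omega> s))"
    using w by eventually_elim (auto simp: diff_eq_eq)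
  from eventually_subst[OF this] show ?thesis
    by (simp add: ou_process_def solves_def evolves_def)
qed

lemma closed_loop_iff_solves:
  fixes W :: "real \<Rightarrow> 'w \<Rightarrow> real^'d" and B :: "(real^'m) \<Rightarrow>\<^sub>L 'x" and K :: "(real^'d) \<Rightarrow>\<^sub>L 'x"
  assumes w: "AE \<omega> in M. \<forall>t\<ge>0. w t \<omega> = K (W t \<omega>)"
  shows "closed_loop M F W \<xi> A B K L Z \<longleftrightarrow> solves (A - (B o\<^sub>L L)) (\<lambda>_ _. 0) \<xi> Z"
  unfolding closed_loop_def ou_process_iff_solves[OF w] by (simp add: blinfun.zero_right)

lemma closed_loop_imp_ou_process:
  fixes W :: "real \<Rightarrow> 'w \<Rightarrow> real^'d" and B :: "(real^'m) \<Rightarrow>\<^sub>L 'x" and K :: "(real^'d) \<Rightarrow>\<^sub>L 'x"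
  assumes "closed_loop M F W \<xi> A B K L Z"
  shows "ou_process M F W \<xi> A B K (feedback L Z) Z"
  using assms by (simp add: closed_loop_def ou_process_def feedback_def blinfun.bilinear_simps)

lemma solves_exists:
  assumes "\<xi> \<in> borel_measurable (F 0)"
  shows "\<exists>Z. solves S (\<lambda>_ _. 0) \<xi> Z"
proof -
  obtain Z where Z: "adapted F Z" "jointly_measurable M Z"
    and ae: "AE \<omega> in M. continuous_on {0..} (\<lambda>t. Z t \<omega>) \<and>
      (\<forall>t\<ge>0. Z t \<omega> = \<xi> \<omega> + (LBINT s:{0..t}. S (Z s \<omega>)) + w t \<omega>)"
    using path_solution_exists[OF assms] by blast
  have "evolves (\<lambda>s \<omega>. S (Z s \<omega>) + 0) \<xi> (\<lambda>t \<omega>. Z t \<omega> - w t \<omega>)"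
    unfolding evolves_def using ae
  proof eventually_elim
    case (elim \<omega>)
    have "set_integrable lborel {0..t} (\<lambda>s. S (Z s \<omega>) + 0)" for t
      using elim by (intro borel_integrable_atLeastAtMost' continuous_intros) (auto elim: continuous_on_subset)
    then show ?case using elim by (auto simp: diff_eq_eq)
  qed
  then show ?thesis using Z ae unfolding solves_def by (auto elim!: eventually_mono)
qed

lemma mean_energy_le:
  assumes S: "stable S" and \<eta>: "\<eta> \<in> borel_measurable (F 0)" "integrable M (\<lambda>\<omega>. (norm (\<eta> \<omega>))\<^sup>2)"
    and Z: "solves S (\<lambda>_ _. 0) \<eta> Z" and T: "T > 0"
    and c: "\<And>t. t \<ge> 0 \<Longrightarrow> (\<integral>\<omega>. (norm (Z t \<omega>))\<^sup>2 \<partial>M) \<le> c"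
  shows "integrable M (\<lambda>\<omega>. LBINT t:{0..T}. (norm (Z t \<omega>))\<^sup>2)"
    and "(\<integral>\<omega>. (LBINT t:{0..T}. (norm (Z t \<omega>))\<^sup>2) \<partial>M) \<le> c * T"
proof -
  have "square_integrable M T Z"
    by (rule a_priori_estimate(1)[OF S Z filtration_measurable_M[OF filtration \<eta>(1)] \<eta>(2) square_integrable_zero T])
  then have i: "integrable (Omega_T M T) (\<lambda>(\<omega>, t). (norm (Z t \<omega>))\<^sup>2)" by (simp add: square_integrable_def)
  show "integrable M (\<lambda>\<omega>. LBINT t:{0..T}. (norm (Z t \<omega>))\<^sup>2)" by (rule Omega_T_Fubini(2)[OF i])
  have "(\<integral>\<omega>. (LBINT t:{0..T}. (norm (Z t \<omega>))\<^sup>2) \<partial>M) = (LBINT t:{0..T}. (\<integral>\<omega>. (norm (Z t \<omega>))\<^sup>2 \<partial>M))"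
    using Omega_T_Fubini(3,6)[OF i] by simp
  also have "\<dots> \<le> (LBINT t:{0..T}. c)"
  proof (rule set_integral_mono[OF Omega_T_Fubini(5)[OF i]])
    show "set_integrable lborel {0..T} (\<lambda>t. c)" by (rule borel_integrable_atLeastAtMost') (rule continuous_on_const)
  qed (use c in auto)
  also have "\<dots> = c * T" using T by (simp add: set_lebesgue_integral_def)
  finally show "(\<integral>\<omega>. (LBINT t:{0..T}. (norm (Z t \<omega>))\<^sup>2) \<partial>M) \<le> c * T" .
qed

text \<open>
  Both processes see the same noise, so their difference \<open>y\<close> solves \<open>y' = S y + (S' - S) Z'\<close> pathwise.  With
  \<open>Z' = y + Z\<close> the part of the input that contains \<open>y\<close> is absorbed once \<open>S' - S\<close> is small.  In this way
  stability of \<open>S\<close> alone suffices, and the bound involves only the unperturbed process.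
\<close>

lemma closed_loop_perturbation:
  assumes S: "stable S"
  obtains c where "c > 0" and "\<And>S' Z Z' T. 4 * c * (norm (S' - S))\<^sup>2 \<le> 1 \<Longrightarrow> T > 0 \<Longrightarrow>
    solves S (\<lambda>_ _. 0) \<eta> Z \<Longrightarrow> solves S' (\<lambda>_ _. 0) \<eta> Z' \<Longrightarrow>
    AE \<omega> in M. (LBINT t:{0..T}. (norm (Z' t \<omega> - Z t \<omega>))\<^sup>2)
      \<le> 4 * c * (norm (S' - S))\<^sup>2 * (LBINT t:{0..T}. (norm (Z t \<omega>))\<^sup>2)"
proof -
  obtain c where c: "c > 0" and est: "path_gain S c"
    by (rule stable_path_gain[OF S])
  show ?thesis
  proof (rule that[OF c])
    fix S' Z Z' and T :: real
    assume small: "4 * c * (norm (S' - S))\<^sup>2 \<le> 1" and T: "T > 0"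
      and Z: "solves S (\<lambda>_ _. 0) \<eta> Z" and Z': "solves S' (\<lambda>_ _. 0) \<eta> Z'"
    let ?e = "norm (S' - S)"
    have ev: "evolves (\<lambda>s \<omega>. S (Z s \<omega>)) \<eta> (\<lambda>t \<omega>. Z t \<omega> - w t \<omega>)"
      "evolves (\<lambda>s \<omega>. S' (Z' s \<omega>)) \<eta> (\<lambda>t \<omega>. Z' t \<omega> - w t \<omega>)"
      and ct: "AE \<omega> in M. continuous_on {0..} (\<lambda>t. Z t \<omega>)" "AE \<omega> in M. continuous_on {0..} (\<lambda>t. Z' t \<omega>)"
      using Z Z' by (simp_all add: solves_def)
    show "AE \<omega> in M. (LBINT t:{0..T}. (norm (Z' t \<omega> - Z t \<omega>))\<^sup>2)
      \<le> 4 * c * ?e\<^sup>2 * (LBINT t:{0..T}. (norm (Z t \<omega>))\<^sup>2)"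
      using ev(1)[unfolded evolves_def] ev(2)[unfolded evolves_def] evolves_0[OF ev(1)] evolves_0[OF ev(2)] ct
    proof eventually_elim
      case (elim \<omega>)
      define y where "y t = Z' t \<omega> - Z t \<omega>" for t
      define h where "h t = (S' - S) (Z' t \<omega>)" for t
      have zc: "continuous_on {0..T} (\<lambda>t. Z t \<omega>)" and zc': "continuous_on {0..T} (\<lambda>t. Z' t \<omega>)"
        using elim by (auto elim: continuous_on_subset)
      have yc: "continuous_on {0..T} y" unfolding y_def by (intro continuous_intros zc zc')
      have hc: "continuous_on {0..T} h" unfolding h_def by (intro continuous_intros zc')
      have hsq: "set_integrable lborel {0..T} (\<lambda>s. (norm (h s))\<^sup>2)"
        by (intro borel_integrable_atLeastAtMost' continuous_intros hc)
      have ysq: "set_integrable lborel {0..T} (\<lambda>s. (norm (y s))\<^sup>2)"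
        by (intro borel_integrable_atLeastAtMost' continuous_intros yc)
      have zsq: "set_integrable lborel {0..T} (\<lambda>s. (norm (Z s \<omega>))\<^sup>2)"
        by (intro borel_integrable_atLeastAtMost' continuous_intros zc)
      have y0: "y 0 = 0" using elim(3,4) by (simp add: y_def diff_eq_eq)
      have eq: "y t = y 0 + (LBINT s:{0..t}. S (y s) + h s)" if "t \<in> {0..T}" for t
      proof -
        have "(LBINT s:{0..t}. S (y s) + h s) = (LBINT s:{0..t}. S' (Z' s \<omega>) - S (Z s \<omega>))"
          by (simp add: y_def h_def blinfun.bilinear_simps)
        also have "\<dots> = (LBINT s:{0..t}. S' (Z' s \<omega>)) - (LBINT s:{0..t}. S (Z s \<omega>))"
          using elim that by (intro set_integral_diff) auto
        also have "\<dots> = (Z' t \<omega> - w t \<omega>) - (Z t \<omega> - w t \<omega>)" using elim that by simp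
        finally show ?thesis by (simp add: y0) (simp add: y_def)
      qed
      let ?J = "LBINT s:{0..T}. (norm (y s))\<^sup>2" and ?I = "LBINT s:{0..T}. (norm (Z s \<omega>))\<^sup>2"
      have J: "0 \<le> ?J" by (simp add: set_lebesgue_integral_def)
      have hm: "set_borel_measurable lborel {0..T} h"
        using borel_integrable_atLeastAtMost'[OF hc] by (simp add: set_integrable_def set_borel_measurable_def)
      have "?J \<le> c * ((norm (y 0))\<^sup>2 + (LBINT s:{0..T}. (norm (h s))\<^sup>2))"
        by (rule path_gainD(2)[OF est less_imp_le[OF T] yc hm hsq eq])
      also have "\<dots> = c * (LBINT s:{0..T}. (norm (h s))\<^sup>2)" by (simp add: y0)
      also have "(LBINT s:{0..T}. (norm (h s))\<^sup>2)
          \<le> (LBINT s:{0..T}. 2 * ?e\<^sup>2 * (norm (y s))\<^sup>2 + 2 * ?e\<^sup>2 * (norm (Z s \<omega>))\<^sup>2)"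
      proof (rule set_integral_mono[OF hsq])
        show "set_integrable lborel {0..T} (\<lambda>s. 2 * ?e\<^sup>2 * (norm (y s))\<^sup>2 + 2 * ?e\<^sup>2 * (norm (Z s \<omega>))\<^sup>2)"
          using ysq zsq by (intro set_integral_add set_integrable_mult_right)
        fix s
        have "(norm (h s))\<^sup>2 \<le> ?e\<^sup>2 * (norm (Z' s \<omega>))\<^sup>2"
          unfolding h_def by (rule norm_blinfun_square_le)
        also have "\<dots> \<le> ?e\<^sup>2 * (2 * (norm (y s))\<^sup>2 + 2 * (norm (Z s \<omega>))\<^sup>2)"
          using norm_add_square_le[of "y s" "Z s \<omega>"] by (intro mult_left_mono) (simp_all add: y_def)
        finally show "(norm (h s))\<^sup>2 \<le> 2 * ?e\<^sup>2 * (norm (y s))\<^sup>2 + 2 * ?e\<^sup>2 * (norm (Z s \<omega>))\<^sup>2"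
          by (simp add: algebra_simps)
      qed
      also have "\<dots> = 2 * ?e\<^sup>2 * ?J + 2 * ?e\<^sup>2 * ?I"
        using set_integral_add(2)[OF set_integrable_mult_right set_integrable_mult_right, OF ysq zsq]
        by (simp only: set_integral_mult_right)
      finally have "?J \<le> c * (2 * ?e\<^sup>2 * ?J + 2 * ?e\<^sup>2 * ?I)" using c by (simp add: mult_le_cancel_left_pos)
      then have "2 * ?J \<le> (4 * c * ?e\<^sup>2) * ?J + 4 * c * ?e\<^sup>2 * ?I" by (simp add: algebra_simps)
      also have "(4 * c * ?e\<^sup>2) * ?J \<le> 1 * ?J" using small J by (intro mult_right_mono)
      finally show ?case by (simp add: y_def)
    qed
  qed
qed

end

lemma L2_inner_eq:
  assumes "prob_space M" and "integrable (Omega_T M T) (\<lambda>(\<omega>, t). f t \<omega> \<bullet> g t \<omega>)"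
  shows "L2_inner M T f g = integral\<^sup>L (Omega_T M T) (\<lambda>(\<omega>, t). f t \<omega> \<bullet> g t \<omega>)"
proof -
  interpret prob_space M by fact
  have "(LBINT t:{0<..<T}. f t \<omega> \<bullet> g t \<omega>) = (LBINT t:{0..T}. f t \<omega> \<bullet> g t \<omega>)" for \<omega>
    by (rule set_integral_discrete_difference[where X = "{0, T}"]) auto
  then show ?thesis using Omega_T_Fubini(3)[OF assms(2)] by (simp add: L2_inner_def)
qed

lemma admissible_square_integrable:
  assumes "admissible_control M F u" "T > 0"
  shows "square_integrable M T u"
  using assms by (simp add: admissible_control_def square_integrable_def jointly_measurable_def)

section \<open>Optimality of the Riccati feedback\<close>

locale lqr_noise = lqr A B C R + noise M F w \<kappa>
  for A :: "'x::euclidean_space \<Rightarrow>\<^sub>L 'x" and B :: "(real^'m) \<Rightarrow>\<^sub>L 'x"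
    and C :: "'x \<Rightarrow>\<^sub>L 'h::real_inner" and R :: "real^'m^'m"
    and M :: "'w measure" and F :: "real \<Rightarrow> 'w measure" and w :: "real \<Rightarrow> 'w \<Rightarrow> 'x" and \<kappa> :: real +
  fixes \<xi> :: "'w \<Rightarrow> 'x" and P :: "'x \<Rightarrow>\<^sub>L 'x"
  assumes \<xi>: "\<xi> \<in> borel_measurable (F 0)" "integrable M (\<lambda>\<omega>. (norm (\<xi> \<omega>))\<^sup>2)"
    and P: "pos_def P" "riccati A B C R P"
begin

abbreviation "L \<equiv> gain B R P"

lemma \<xi>M: "\<xi> \<in> borel_measurable M" by (rule filtration_measurable_M[OF filtration \<xi>(1)])

definition running_cost :: "real \<Rightarrow> (real \<Rightarrow> 'w \<Rightarrow> 'x) \<Rightarrow> (real \<Rightarrow> 'w \<Rightarrow> real^'m) \<Rightarrow> real" where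
  "running_cost T Z u = integral\<^sup>L (Omega_T M T) (\<lambda>(\<omega>, t). (norm (C (Z t \<omega>)))\<^sup>2 + u t \<omega> \<bullet> (R *v u t \<omega>))"

lemma running_cost_integrable:
  assumes "square_integrable M T Z" "square_integrable M T Z'"
  shows "integrable (Omega_T M T) (\<lambda>(\<omega>, t). C (Z t \<omega>) \<bullet> C (Z' t \<omega>))"
  using square_integrable_inner[OF assms(1) square_integrable_linear[OF assms(2), of "adj C o\<^sub>L C"]]
  by (simp add: inner_adj)

lemma control_cost_integrable:
  assumes "square_integrable M T u" "square_integrable M T u'"
  shows "integrable (Omega_T M T) (\<lambda>(\<omega>, t). u t \<omega> \<bullet> (R *v u' t \<omega>))"
  using square_integrable_inner[OF assms(1) square_integrable_linear[OF assms(2), of "matrix_op R"]] by simp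

lemma J_LQR_eq:
  assumes "\<And>T. T > 0 \<Longrightarrow> square_integrable M T Z" "\<And>T. T > 0 \<Longrightarrow> square_integrable M T u"
  shows "J_LQR M R (\<lambda>t \<omega>. C (Z t \<omega>)) u = Limsup at_top (\<lambda>T. ereal (running_cost T Z u / T))"
  unfolding J_LQR_def
proof (rule Limsup_eq, rule eventually_mono[OF eventually_gt_at_top[of 0]])
  fix T :: real assume T: "0 < T"
  note i1 = running_cost_integrable[OF assms(1)[OF T] assms(1)[OF T]]
  note i2 = control_cost_integrable[OF assms(2)[OF T] assms(2)[OF T]]
  have e1: "L2_inner M T (\<lambda>t \<omega>. C (Z t \<omega>)) (\<lambda>t \<omega>. C (Z t \<omega>)) = integral\<^sup>L (Omega_T M T) (\<lambda>(\<omega>, t). C (Z t \<omega>) \<bullet> C (Z t \<omega>))"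
    by (rule L2_inner_eq[OF prob_space_axioms i1])
  have "0 \<le> L2_inner M T (\<lambda>t \<omega>. C (Z t \<omega>)) (\<lambda>t \<omega>. C (Z t \<omega>))"
    unfolding e1 by (rule integral_nonneg_AE) auto
  then have "(L2_norm M T (\<lambda>t \<omega>. C (Z t \<omega>)))\<^sup>2 = integral\<^sup>L (Omega_T M T) (\<lambda>(\<omega>, t). C (Z t \<omega>) \<bullet> C (Z t \<omega>))"
    by (simp add: L2_norm_def e1[symmetric])
  moreover have "L2_inner M T u (\<lambda>t \<omega>. R *v u t \<omega>) = integral\<^sup>L (Omega_T M T) (\<lambda>(\<omega>, t). u t \<omega> \<bullet> (R *v u t \<omega>))"
    by (rule L2_inner_eq[OF prob_space_axioms i2])
  moreover have "running_cost T Z u = integral\<^sup>L (Omega_T M T) (\<lambda>(\<omega>, t). C (Z t \<omega>) \<bullet> C (Z t \<omega>))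
      + integral\<^sup>L (Omega_T M T) (\<lambda>(\<omega>, t). u t \<omega> \<bullet> (R *v u t \<omega>))"
    unfolding running_cost_def
    using Bochner_Integration.integral_add[OF i1 i2] by (simp add: split_beta' power2_norm_eq_inner)
  ultimately show "ereal (1 / T * ((L2_norm M T (\<lambda>t \<omega>. C (Z t \<omega>)))\<^sup>2 + L2_inner M T u (\<lambda>t \<omega>. R *v u t \<omega>)))
      = ereal (running_cost T Z u / T)" by simp
qed

text \<open>
  The Riccati equation makes \<open>P Z\<close> the costate: the derivative of \<open>P D \<bullet> Z\<close> along \<open>D' = A D + B v\<close> and
  \<open>dZ = cl L Z dt + dw\<close>, apart from the noise, is minus the linear part of the change of the cost.
\<close>

lemma cross_term:
  "C D \<bullet> C z + v \<bullet> (R *v (- L z)) = - (P (A D + B v) \<bullet> z + P D \<bullet> cl L z)"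
proof -
  have sym: "P x \<bullet> y = x \<bullet> P y" for x y using inner_adj[of x P y] pos_def_sym[OF P(1)] by simp
  have RL: "R *v L z = adj B (P z)" by (rule R_gain)
  have "D \<bullet> residual L P z = 0" by (simp add: riccati_residual[OF P])
  then have "cl L D \<bullet> P z + D \<bullet> P (cl L z) + C D \<bullet> C z + L D \<bullet> (R *v L z) = 0"
    by (simp add: residual_def blinfun.add_left inner_add_right inner_lyap_op inner_cost)
  moreover have "cl L D = A D - B (L D)" by (simp add: cl_def blinfun.bilinear_simps)
  moreover have "u \<bullet> (R *v L z) = B u \<bullet> P z" for u by (simp add: RL inner_adj)
  moreover have "R *v (- L z) = - (R *v L z)" using matrix_vector_mult_diff_distrib[of R 0 "L z"] by simp
  ultimately show ?thesis
    by (simp add: sym blinfun.add_right inner_add_left inner_diff_left)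
qed

text \<open>
  A competitor \<open>(u', Z')\<close> is compared with the feedback process \<open>Z\<close> through the differences \<open>D\<close> of the states
  and \<open>v\<close> of the controls; the noise cancels in \<open>D\<close>.
\<close>

context
  fixes Z Z' D :: "real \<Rightarrow> 'w \<Rightarrow> 'x" and u' v :: "real \<Rightarrow> 'w \<Rightarrow> real^'m" and T :: real
  assumes Z: "solves (cl L) (\<lambda>_ _. 0) \<xi> Z" and u': "admissible_control M F u'"
    and Z': "solves A (\<lambda>t \<omega>. B (u' t \<omega>)) \<xi> Z'" and T: "T > 0"
    and D: "D = (\<lambda>t \<omega>. Z' t \<omega> - Z t \<omega>)" and v: "v = (\<lambda>t \<omega>. u' t \<omega> - feedback L Z t \<omega>)"
begin

lemma T0: "0 \<le> T" using T by simp

lemmas Z_square_integrable = a_priori_estimate[OF riccati_stable[OF P] Z \<xi>M \<xi>(2) square_integrable_zero]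

lemma Z'_square_integrable:
  "S > 0 \<Longrightarrow> square_integrable M S Z'" "t \<ge> 0 \<Longrightarrow> integrable M (\<lambda>\<omega>. (norm (Z' t \<omega>))\<^sup>2)"
  using a_priori_estimate[OF stable_A Z' \<xi>M \<xi>(2)]
    square_integrable_linear[OF admissible_square_integrable[OF u'], of _ B] by blast+

lemmas Z_measurable = solves_measurable[OF Z] and Z'_measurable = solves_measurable[OF Z']

lemma u_square_integrable: "square_integrable M T (feedback L Z)"
  using square_integrable_linear[OF Z_square_integrable(1)[OF T], of "- L"]
  by (simp add: feedback_def[abs_def] blinfun.minus_left)

lemma v_square_integrable: "square_integrable M T v"
  unfolding v by (rule square_integrable_diff[OF admissible_square_integrable[OF u' T] u_square_integrable])

lemma D_square_integrable: "square_integrable M T D"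
  unfolding D by (rule square_integrable_diff[OF Z'_square_integrable(1)[OF T] Z_square_integrable(1)[OF T]])

lemma D_T: "D T \<in> borel_measurable M" "integrable M (\<lambda>\<omega>. (norm (D T \<omega>))\<^sup>2)"
  unfolding D
  by (intro borel_measurable_diff integrable_square_add(2) Z_measurable(2) Z'_measurable(2)
      Z_square_integrable(2) Z'_square_integrable(2) T0)+

lemma D_evolves: "evolves (\<lambda>t \<omega>. A (D t \<omega>) + B (v t \<omega>)) (\<lambda>_. 0) D"
proof -
  have Zev: "evolves (\<lambda>s \<omega>. cl L (Z s \<omega>)) \<xi> (\<lambda>t \<omega>. Z t \<omega> - w t \<omega>)"
    and Z'ev: "evolves (\<lambda>s \<omega>. A (Z' s \<omega>) + B (u' s \<omega>)) \<xi> (\<lambda>t \<omega>. Z' t \<omega> - w t \<omega>)"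
    using Z Z' by (simp_all add: solves_def)
  have drift: "(A (Z' s \<omega>) + B (u' s \<omega>)) - cl L (Z s \<omega>) = A (D s \<omega>) + B (v s \<omega>)" for s \<omega>
    by (simp add: D v feedback_def cl_def blinfun.bilinear_simps)
  show ?thesis
    using Zev Z'ev unfolding evolves_def
  proof eventually_elim
    case (elim \<omega>)
    show ?case
    proof (intro allI impI)
      fix t :: real assume t: "0 \<le> t"
      have i: "set_integrable lborel {0..t} (\<lambda>s. A (Z' s \<omega>) + B (u' s \<omega>))" "set_integrable lborel {0..t} (\<lambda>s. cl L (Z s \<omega>))"
        using elim t by auto
      from set_integral_diff[OF i] elim t
      show "set_integrable lborel {0..t} (\<lambda>s. A (D s \<omega>) + B (v s \<omega>)) \<and>
          D t \<omega> = 0 + (LBINT s:{0..t}. A (D s \<omega>) + B (v s \<omega>))"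
        unfolding drift by (auto simp: D algebra_simps)
    qed
  qed
qed

lemma costate_pairing:
  "(\<integral>\<omega>. P (D T \<omega>) \<bullet> Z T \<omega> \<partial>M) = - (integral\<^sup>L (Omega_T M T) (\<lambda>(\<omega>, t). C (D t \<omega>) \<bullet> C (Z t \<omega>))
    + integral\<^sup>L (Omega_T M T) (\<lambda>(\<omega>, t). v t \<omega> \<bullet> (R *v feedback L Z t \<omega>)))"
proof -
  define d where "d t \<omega> = P (A (D t \<omega>) + B (v t \<omega>))" for t \<omega>
  have sqd: "square_integrable M T d" unfolding d_def
    by (intro square_integrable_linear square_integrable_add(1) D_square_integrable v_square_integrable)
  note sqPD = square_integrable_linear[OF D_square_integrable, of P]
    and sqb = square_integrable_linear[OF Z_square_integrable(1)[OF T], of "cl L"]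
  have d_adapted: "adapted F d"
    unfolding adapted_def
  proof (intro allI impI)
    fix t :: real assume t: "t \<ge> 0"
    have [measurable]: "u' t \<in> borel_measurable (F t)" using u' t by (simp add: admissible_control_def adapted_def)
    have [measurable]: "Z t \<in> borel_measurable (F t)" "Z' t \<in> borel_measurable (F t)"
      using Z_measurable(1)[OF t] Z'_measurable(1)[OF t] .
    show "d t \<in> borel_measurable (F t)" unfolding d_def[abs_def] D v feedback_def by measurable
  qed
  have evD: "evolves d (\<lambda>_. 0) (\<lambda>t \<omega>. P (D t \<omega>))"
    using evolves_linear[OF D_evolves, of P] by (simp add: d_def[abs_def] blinfun.zero_right)
  have evZ: "evolves (\<lambda>s \<omega>. cl L (Z s \<omega>)) \<xi> (\<lambda>t \<omega>. Z t \<omega> - w t \<omega>)" using Z by (simp add: solves_def)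
  have "(\<integral>\<omega>. P (D T \<omega>) \<bullet> Z T \<omega> \<partial>M) = (\<integral>\<omega>. 0 \<bullet> \<xi> \<omega> \<partial>M)
      + integral\<^sup>L (Omega_T M T) (\<lambda>(\<omega>, t). d t \<omega> \<bullet> Z t \<omega>)
      + integral\<^sup>L (Omega_T M T) (\<lambda>(\<omega>, t). P (D t \<omega>) \<bullet> cl L (Z t \<omega>))"
    by (rule mean_pairing[OF T evD evZ sqd sqPD sqb Z_square_integrable(1)[OF T] _ _ _ d_adapted
          measurable_blinfun_apply[OF D_T(1)] integrable_square_linear[OF D_T]
          Z_measurable(2)[OF T0] Z_square_integrable(2)[OF T0]]) auto
  also have "\<dots> = integral\<^sup>L (Omega_T M T) (\<lambda>x. (\<lambda>(\<omega>, t). d t \<omega> \<bullet> Z t \<omega>) x + (\<lambda>(\<omega>, t). P (D t \<omega>) \<bullet> cl L (Z t \<omega>)) x)"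
    using Bochner_Integration.integral_add[OF square_integrable_inner[OF sqd Z_square_integrable(1)[OF T]]
        square_integrable_inner[OF sqPD sqb]] by simp
  also have "\<dots> = integral\<^sup>L (Omega_T M T) (\<lambda>x. - ((\<lambda>(\<omega>, t). C (D t \<omega>) \<bullet> C (Z t \<omega>)) x + (\<lambda>(\<omega>, t). v t \<omega> \<bullet> (R *v feedback L Z t \<omega>)) x))"
  proof (rule Bochner_Integration.integral_cong[OF refl])
    fix x :: "'w \<times> real"
    obtain \<omega> t where x: "x = (\<omega>, t)" by force
    show "(\<lambda>(\<omega>, t). d t \<omega> \<bullet> Z t \<omega>) x + (\<lambda>(\<omega>, t). P (D t \<omega>) \<bullet> cl L (Z t \<omega>)) x
        = - ((\<lambda>(\<omega>, t). C (D t \<omega>) \<bullet> C (Z t \<omega>)) x + (\<lambda>(\<omega>, t). v t \<omega> \<bullet> (R *v feedback L Z t \<omega>)) x)"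
      using cross_term[of "D t \<omega>" "Z t \<omega>" "v t \<omega>"] by (simp add: x d_def feedback_def)
  qed
  finally show ?thesis
    using running_cost_integrable[OF D_square_integrable Z_square_integrable(1)[OF T]]
      control_cost_integrable[OF v_square_integrable u_square_integrable] by simp
qed

lemma cost_expansion:
  "running_cost T Z' u' = running_cost T Z (feedback L Z) + running_cost T D v - 2 * (\<integral>\<omega>. P (D T \<omega>) \<bullet> Z T \<omega> \<partial>M)"
proof -
  let ?u = "feedback L Z"
  let ?c = "\<lambda>X Y. \<lambda>(\<omega>, t). C (X t \<omega>) \<bullet> C (Y t \<omega>)" and ?r = "\<lambda>a b. \<lambda>(\<omega>, t). a t \<omega> \<bullet> (R *v b t \<omega>)"
  note sqZ = Z_square_integrable(1)[OF T]
  note i = running_cost_integrable[OF sqZ sqZ] control_cost_integrable[OF u_square_integrable u_square_integrable]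
    running_cost_integrable[OF D_square_integrable D_square_integrable]
    control_cost_integrable[OF v_square_integrable v_square_integrable]
    running_cost_integrable[OF D_square_integrable sqZ] control_cost_integrable[OF v_square_integrable u_square_integrable]
  have rc: "running_cost T X a = integral\<^sup>L (Omega_T M T) (\<lambda>x. ?c X X x + ?r a a x)" for X a
    unfolding running_cost_def by (simp add: split_beta' power2_norm_eq_inner)
  have "running_cost T Z' u' = integral\<^sup>L (Omega_T M T) (\<lambda>x. (?c Z Z x + ?r ?u ?u x) + (?c D D x + ?r v v x)
      + 2 * (?c D Z x + ?r v ?u x))"
    unfolding rc
  proof (rule Bochner_Integration.integral_cong[OF refl])
    fix x :: "'w \<times> real"
    obtain \<omega> t where x: "x = (\<omega>, t)" by force
    have Z'e: "Z' t \<omega> = Z t \<omega> + D t \<omega>" and u'e: "u' t \<omega> = ?u t \<omega> + v t \<omega>" by (simp_all add: D v)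
    have "?u t \<omega> \<bullet> (R *v v t \<omega>) = v t \<omega> \<bullet> (R *v ?u t \<omega>)" using R_sym[of "?u t \<omega>" "v t \<omega>"] by (simp add: inner_commute)
    then show "?c Z' Z' x + ?r u' u' x = (?c Z Z x + ?r ?u ?u x) + (?c D D x + ?r v v x) + 2 * (?c D Z x + ?r v ?u x)"
      by (simp add: x Z'e u'e blinfun.add_right inner_add matrix_vector_right_distrib
          inner_commute[of "C (Z t \<omega>)" "C (D t \<omega>)"])
  qed
  also have "\<dots> = running_cost T Z ?u + running_cost T D v - 2 * (\<integral>\<omega>. P (D T \<omega>) \<bullet> Z T \<omega> \<partial>M)"
    unfolding rc costate_pairing using i by simp
  finally show ?thesis .
qed

lemma terminal_difference_bound:
  assumes c: "c > 0" "path_gain A c"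
  shows "AE \<omega> in M. (norm (D T \<omega>))\<^sup>2 \<le> c * (norm B)\<^sup>2 * (LBINT t:{0..T}. (norm (v t \<omega>))\<^sup>2)"
proof -
  have sqBv: "square_integrable M T (\<lambda>t \<omega>. B (v t \<omega>))" by (rule square_integrable_linear[OF v_square_integrable])
  have Bvi: "integrable (Omega_T M T) (\<lambda>(\<omega>, t). (norm (B (v t \<omega>)))\<^sup>2)"
    and vi: "integrable (Omega_T M T) (\<lambda>(\<omega>, t). (norm (v t \<omega>))\<^sup>2)"
    using sqBv v_square_integrable by (simp_all add: square_integrable_def)
  have hm: "AE \<omega> in M. set_borel_measurable lborel {0..T} (\<lambda>t. B (v t \<omega>))"
    by (intro AE_I2 square_integrable_path_measurable[OF sqBv])
  have ct: "AE \<omega> in M. continuous_on {0..} (\<lambda>t. Z t \<omega>)" "AE \<omega> in M. continuous_on {0..} (\<lambda>t. Z' t \<omega>)"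
    using Z Z' by (simp_all add: solves_def)
  show ?thesis
    using D_evolves[unfolded evolves_def] evolves_0[OF D_evolves] ct hm Omega_T_Fubini(1)[OF Bvi] Omega_T_Fubini(1)[OF vi]
  proof eventually_elim
    case (elim \<omega>)
    have "(norm (D T \<omega>))\<^sup>2 \<le> c * ((norm (D 0 \<omega>))\<^sup>2 + (LBINT s:{0..T}. (norm (B (v s \<omega>)))\<^sup>2))"
    proof (rule path_gainD(1)[OF c(2) T0])
      show "continuous_on {0..T} (\<lambda>t. D t \<omega>)" unfolding D
        using elim by (intro continuous_on_diff) (auto elim: continuous_on_subset)
      show "D t \<omega> = D 0 \<omega> + (LBINT s:{0..t}. A (D s \<omega>) + B (v s \<omega>))" if "t \<in> {0..T}" for t
        using elim that by simp
    qed (use elim in auto)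
    also have "\<dots> = c * (LBINT s:{0..T}. (norm (B (v s \<omega>)))\<^sup>2)" using elim by simp
    also have "(LBINT s:{0..T}. (norm (B (v s \<omega>)))\<^sup>2) \<le> (LBINT s:{0..T}. (norm B)\<^sup>2 * (norm (v s \<omega>))\<^sup>2)"
      by (rule set_integral_mono) (use elim norm_blinfun_square_le in auto)
    finally show ?case using c(1) by (simp add: mult.assoc mult_le_cancel_left_pos)
  qed
qed

end

text \<open>
  In the cost expansion only the terminal term \<open>2 E(P D\<^sub>T \<bullet> Z\<^sub>T)\<close> has the wrong sign.  Stability of \<open>A\<close> bounds
  \<open>norm D\<^sub>T\<close> by the \<open>L\<^sup>2\<close> norm of \<open>v\<close>, which the control cost controls, and \<open>Z\<^sub>T\<close> has bounded second moment.  So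
  by Young's inequality the feedback loses at most a constant, independent of the horizon.
\<close>

lemma cost_gap:
  obtains c where "c \<ge> 0" and "\<And>Z u' Z' T. solves (cl L) (\<lambda>_ _. 0) \<xi> Z \<Longrightarrow> admissible_control M F u' \<Longrightarrow>
    solves A (\<lambda>t \<omega>. B (u' t \<omega>)) \<xi> Z' \<Longrightarrow> T > 0 \<Longrightarrow>
    running_cost T Z (feedback L Z) \<le> running_cost T Z' u' + c"
proof -
  obtain mz where mz: "mz > 0" "\<And>Z t. solves (cl L) (\<lambda>_ _. 0) \<xi> Z \<Longrightarrow> t \<ge> 0 \<Longrightarrow> (\<integral>\<omega>. (norm (Z t \<omega>))\<^sup>2 \<partial>M) \<le> mz"
    by (rule second_moment_bounded[OF riccati_stable[OF P] \<xi>]) blast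
  obtain c where c: "c > 0" "path_gain A c" by (rule stable_path_gain[OF stable_A])
  obtain r where r: "r > 0" "\<And>v. r * (norm v)\<^sup>2 \<le> v \<bullet> matrix_op R v"
    by (rule pos_def_lower_bound[of "matrix_op R"]) (use R_pos in auto)
  define a where "a = c * (norm B)\<^sup>2"
  have a: "0 \<le> a" using c by (simp add: a_def)
  \<comment> \<open>the weight in Young's inequality: small enough that \<open>e * a\<close> times the energy of \<open>v\<close> is paid for by its cost\<close>
  define e where "e = r / (a + 1)"
  have e: "e > 0" "e * a \<le> r" using r(1) a by (auto simp: e_def field_simps)
  define c0 where "c0 = (norm P)\<^sup>2 / e * mz"
  have c0: "c0 \<ge> 0" using e mz by (simp add: c0_def)
  show ?thesis
  proof (rule that[OF c0])
    fix Z u' Z' and T :: real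
    assume as: "solves (cl L) (\<lambda>_ _. 0) \<xi> Z" "admissible_control M F u'"
      "solves A (\<lambda>t \<omega>. B (u' t \<omega>)) \<xi> Z'" "T > 0"
    have T0: "0 \<le> T" using as(4) by simp
    define v D where "v = (\<lambda>t \<omega>. u' t \<omega> - feedback L Z t \<omega>)" and "D = (\<lambda>t \<omega>. Z' t \<omega> - Z t \<omega>)"
    note as = as D_def v_def
    note D_T = D_T[OF as] and sqv = v_square_integrable[OF as] and sqD = D_square_integrable[OF as]
    note Zm = solves_measurable(2)[OF as(1) T0] and Zsq = Z_square_integrable(2)[OF as T0]
    have vi: "integrable (Omega_T M T) (\<lambda>(\<omega>, t). (norm (v t \<omega>))\<^sup>2)" using sqv by (simp add: square_integrable_def)
    let ?V = "integral\<^sup>L (Omega_T M T) (\<lambda>(\<omega>, t). (norm (v t \<omega>))\<^sup>2)"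
    have "integral\<^sup>L (Omega_T M T) (\<lambda>x. r * (\<lambda>(\<omega>, t). (norm (v t \<omega>))\<^sup>2) x) \<le> running_cost T D v"
      unfolding running_cost_def
    proof (rule integral_mono)
      show "integrable (Omega_T M T) (\<lambda>(\<omega>, t). (norm (C (D t \<omega>)))\<^sup>2 + v t \<omega> \<bullet> (R *v v t \<omega>))"
        using Bochner_Integration.integrable_add[OF running_cost_integrable[OF sqD sqD] control_cost_integrable[OF sqv sqv]]
        by (simp add: split_beta' power2_norm_eq_inner)
    qed (use vi r(2) in \<open>auto intro: add_increasing\<close>)
    then have V: "r * ?V \<le> running_cost T D v" by simp
    have "2 * (\<integral>\<omega>. P (D T \<omega>) \<bullet> Z T \<omega> \<partial>M) = (\<integral>\<omega>. 2 * (P (D T \<omega>) \<bullet> Z T \<omega>) \<partial>M)" by simp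
    also have "\<dots> \<le> (\<integral>\<omega>. e * (a * (LBINT t:{0..T}. (norm (v t \<omega>))\<^sup>2)) + (norm P)\<^sup>2 / e * (norm (Z T \<omega>))\<^sup>2 \<partial>M)"
    proof (rule integral_mono_AE)
      show "integrable M (\<lambda>\<omega>. 2 * (P (D T \<omega>) \<bullet> Z T \<omega>))"
        using integrable_inner_of_square[OF measurable_blinfun_apply[OF D_T(1)] Zm integrable_square_linear[OF D_T] Zsq] by simp
      show "integrable M (\<lambda>\<omega>. e * (a * (LBINT t:{0..T}. (norm (v t \<omega>))\<^sup>2)) + (norm P)\<^sup>2 / e * (norm (Z T \<omega>))\<^sup>2)"
        using Omega_T_Fubini(2)[OF vi] Zsq by simp
      show "AE \<omega> in M. 2 * (P (D T \<omega>) \<bullet> Z T \<omega>) \<le> e * (a * (LBINT t:{0..T}. (norm (v t \<omega>))\<^sup>2)) + (norm P)\<^sup>2 / e * (norm (Z T \<omega>))\<^sup>2"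
        using terminal_difference_bound[OF as c]
      proof eventually_elim
        case (elim \<omega>)
        have "P (D T \<omega>) \<bullet> Z T \<omega> \<le> (norm P * norm (D T \<omega>)) * norm (Z T \<omega>)"
          by (meson norm_blinfun norm_cauchy_schwarz norm_ge_zero mult_right_mono order_trans)
        moreover have "2 * ((norm P * norm (D T \<omega>)) * norm (Z T \<omega>)) \<le> e * (norm (D T \<omega>))\<^sup>2 + (norm P)\<^sup>2 / e * (norm (Z T \<omega>))\<^sup>2"
        proof -
          let ?p = "sqrt e * norm (D T \<omega>)" and ?q = "norm P / sqrt e * norm (Z T \<omega>)"
          have "2 * ?p * ?q \<le> ?p\<^sup>2 + ?q\<^sup>2" by (rule sum_squares_bound)
          then show ?thesis using e(1) by (simp add: power_mult_distrib power_divide mult_ac)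
        qed
        moreover have "e * (norm (D T \<omega>))\<^sup>2 \<le> e * (a * (LBINT t:{0..T}. (norm (v t \<omega>))\<^sup>2))"
          using elim e(1) by (intro mult_left_mono) (auto simp: a_def)
        ultimately show ?case by linarith
      qed
    qed
    also have "\<dots> = e * (a * ?V) + (norm P)\<^sup>2 / e * (\<integral>\<omega>. (norm (Z T \<omega>))\<^sup>2 \<partial>M)"
      using Omega_T_Fubini(2,3)[OF vi] Zsq by simp
    also have "\<dots> \<le> r * ?V + c0"
    proof (rule add_mono)
      have "0 \<le> ?V" by (rule integral_nonneg_AE) auto
      then show "e * (a * ?V) \<le> r * ?V" using e(2) by (simp add: mult.assoc[symmetric] mult_right_mono)
      show "(norm P)\<^sup>2 / e * (\<integral>\<omega>. (norm (Z T \<omega>))\<^sup>2 \<partial>M) \<le> c0"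
        unfolding c0_def using mz(2)[OF as(1) T0] e(1) by (intro mult_left_mono) auto
    qed
    finally show "running_cost T Z (feedback L Z) \<le> running_cost T Z' u' + c0"
      using cost_expansion[OF as] V by linarith
  qed
qed

text \<open>
  A bounded loss disappears after division by \<open>T\<close>.
\<close>

lemma riccati_feedback_optimal:
  fixes W :: "real \<Rightarrow> 'w \<Rightarrow> real^'d" and K :: "(real^'d) \<Rightarrow>\<^sub>L 'x"
  assumes w: "AE \<omega> in M. \<forall>t\<ge>0. w t \<omega> = K (W t \<omega>)" and Z: "closed_loop M F W \<xi> A B K L Z"
  shows "optimal_control M F W \<xi> A B K C R (feedback L Z) Z"
proof -
  have Zs: "solves (cl L) (\<lambda>_ _. 0) \<xi> Z" using closed_loop_iff_solves[OF w, THEN iffD1, OF Z] by (simp add: cl_def)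
  note Zsq = a_priori_estimate(1)[OF riccati_stable[OF P] Zs \<xi>M \<xi>(2) square_integrable_zero]
  have fsq: "square_integrable M T (feedback L Z)" if "T > 0" for T
    using square_integrable_linear[OF Zsq[OF that], of "- L"] by (simp add: feedback_def[abs_def] blinfun.minus_left)
  have adm: "admissible_control M F (feedback L Z)"
    unfolding admissible_control_def jointly_measurable_def adapted_def
  proof (intro conjI allI impI)
    show "feedback L Z t \<in> borel_measurable (F t)" if "t \<ge> 0" for t
      unfolding feedback_def[abs_def] using measurable_blinfun_apply[OF solves_measurable(1)[OF Zs that], of L] by simp
  qed (use fsq in \<open>simp_all add: square_integrable_def\<close>)
  show ?thesis unfolding optimal_control_def
  proof (intro conjI allI impI adm closed_loop_imp_ou_process[OF Z])
    fix u' Z' assume u': "admissible_control M F u'" and "ou_process M F W \<xi> A B K u' Z'"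
    then have Z': "solves A (\<lambda>t \<omega>. B (u' t \<omega>)) \<xi> Z'" using ou_process_iff_solves[OF w] by blast
    have Bu': "square_integrable M S (\<lambda>t \<omega>. B (u' t \<omega>))" if "S > 0" for S
      by (rule square_integrable_linear[OF admissible_square_integrable[OF u' that]])
    have Zsq': "\<And>S. S > 0 \<Longrightarrow> square_integrable M S Z'"
      using a_priori_estimate(1)[OF stable_A Z' \<xi>M \<xi>(2)] Bu' by blast
    obtain c where c: "c \<ge> 0" "\<And>T. T > 0 \<Longrightarrow> running_cost T Z (feedback L Z) \<le> running_cost T Z' u' + c"
      using cost_gap Zs u' Z' by metis
    have "Limsup at_top (\<lambda>T. ereal (running_cost T Z (feedback L Z) / T)) \<le> Limsup at_top (\<lambda>T. ereal (running_cost T Z' u' / T))"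
    proof (rule ereal_le_epsilon2)
      fix \<epsilon> :: real assume \<epsilon>: "\<epsilon> > 0"
        have "Limsup at_top (\<lambda>T. ereal (running_cost T Z (feedback L Z) / T)) \<le> Limsup at_top (\<lambda>T. ereal (running_cost T Z' u' / T) + ereal \<epsilon>)"
        proof (rule Limsup_mono, rule eventually_mono[OF eventually_gt_at_top[of "c / \<epsilon>"]])
          fix T assume T: "c / \<epsilon> < T"
          have "0 \<le> c / \<epsilon>" using c(1) \<epsilon> by simp
          then have T0: "0 < T" using T by linarith
          have "c \<le> \<epsilon> * T" using T \<epsilon> by (simp add: field_simps)
          then have "running_cost T Z (feedback L Z) \<le> running_cost T Z' u' + \<epsilon> * T" using c(2)[OF T0] by linarith
          then show "ereal (running_cost T Z (feedback L Z) / T) \<le> ereal (running_cost T Z' u' / T) + ereal \<epsilon>"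
            using T0 by (simp add: field_simps)
        qed
        also have "\<dots> = Limsup at_top (\<lambda>T. ereal (running_cost T Z' u' / T)) + ereal \<epsilon>"
          by (rule Limsup_add_ereal_right) auto
        finally show "Limsup at_top (\<lambda>T. ereal (running_cost T Z (feedback L Z) / T)) \<le> Limsup at_top (\<lambda>T. ereal (running_cost T Z' u' / T)) + ereal \<epsilon>" .
    qed
    then show "J_LQR M R (\<lambda>t \<omega>. C (Z t \<omega>)) (feedback L Z) \<le> J_LQR M R (\<lambda>t \<omega>. C (Z' t \<omega>)) u'"
      by (simp add: J_LQR_eq Zsq fsq Zsq' admissible_square_integrable[OF u'])
  qed
qed

text \<open>
  Writing \<open>u\<^sub>P - u\<^sub>X\<close> as the gain of \<open>X\<close> applied to \<open>Z' - Z\<close> plus the difference of the gains applied to \<open>Z\<close>,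
  both parts are linear in \<open>X - P\<close>, the first by the perturbation bound.  The energy of \<open>Z\<close> grows at most
  linearly in \<open>T\<close> because its second moment is bounded; this matches the factor \<open>T\<^sup>-\<^sup>1\<^sup>/\<^sup>2\<close> for short and long
  horizons alike.
\<close>

lemma feedback_difference:
  obtains c \<delta> where "c > 0" "\<delta> > 0" and "\<And>X Z Z' T. norm (P - X) < \<delta> \<Longrightarrow> T > 0 \<Longrightarrow>
    solves (cl L) (\<lambda>_ _. 0) \<xi> Z \<Longrightarrow> solves (cl (gain B R X)) (\<lambda>_ _. 0) \<xi> Z' \<Longrightarrow>
    T powr (- 1/2) * L2_norm M T (\<lambda>t \<omega>. feedback L Z t \<omega> - feedback (gain B R X) Z' t \<omega>) \<le> c * norm (X - P)"
proof -
  note stableL = riccati_stable[OF P]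
  obtain mz where mz: "mz > 0" "\<And>Z t. solves (cl L) (\<lambda>_ _. 0) \<xi> Z \<Longrightarrow> t \<ge> 0 \<Longrightarrow> (\<integral>\<omega>. (norm (Z t \<omega>))\<^sup>2 \<partial>M) \<le> mz"
    by (rule second_moment_bounded[OF stableL \<xi>]) blast
  obtain c where c: "c > 0" and pert: "\<And>S' Z Z' T. 4 * c * (norm (S' - cl L))\<^sup>2 \<le> 1 \<Longrightarrow> T > 0 \<Longrightarrow>
    solves (cl L) (\<lambda>_ _. 0) \<xi> Z \<Longrightarrow> solves S' (\<lambda>_ _. 0) \<xi> Z' \<Longrightarrow>
    AE \<omega> in M. (LBINT t:{0..T}. (norm (Z' t \<omega> - Z t \<omega>))\<^sup>2)
      \<le> 4 * c * (norm (S' - cl L))\<^sup>2 * (LBINT t:{0..T}. (norm (Z t \<omega>))\<^sup>2)"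
    by (rule closed_loop_perturbation[OF stableL, of \<xi>]) blast
  define g where "g = norm (matrix_op (matrix_inv R) o\<^sub>L adj B)"
  have g: "0 \<le> g" by (simp add: g_def)
  define h where "h = norm B * g"
  have h: "0 \<le> h" using g by (simp add: h_def)
  \<comment> \<open>\<open>\<delta>\<close> ensures the smallness hypothesis of the perturbation bound; the summand \<open>1\<close> also gives \<open>\<delta> \<le> 1\<close>\<close>
  define \<delta> where "\<delta> = 1 / (1 + 2 * sqrt c * h)"
  have den: "1 + 2 * sqrt c * h > 0" using c h by (intro add_pos_nonneg) auto
  have \<delta>: "\<delta> > 0" "\<delta> \<le> 1" "2 * sqrt c * h * \<delta> \<le> 1"
    using c h den by (auto simp: \<delta>_def field_simps)
  define l where "l = norm L + g"
  define k where "k = 2 * l\<^sup>2 * (4 * c * h\<^sup>2) + 2 * g\<^sup>2"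
  have k: "0 \<le> k" using c by (simp add: k_def)
  show ?thesis
  proof (rule that[of "sqrt (k * mz) + 1" \<delta>])
    show "0 < sqrt (k * mz) + 1" using k mz by (intro add_nonneg_pos) auto
    fix X Z Z' and T :: real
    assume near: "norm (P - X) < \<delta>" and T: "T > 0"
      and Z: "solves (cl L) (\<lambda>_ _. 0) \<xi> Z" and Z': "solves (cl (gain B R X)) (\<lambda>_ _. 0) \<xi> Z'"
    let ?n = "norm (X - P)" and ?L = "gain B R X"
    have n: "?n < \<delta>" using near by (simp add: norm_minus_commute)
    have LL: "norm (?L - L) \<le> g * ?n" unfolding gain_diff[symmetric] g_def by (rule norm_gain_le)
    have e: "norm (cl ?L - cl L) \<le> h * ?n"
    proof -
      have "cl ?L - cl L = - (B o\<^sub>L (?L - L))" by (rule blinfun_eqI) (simp add: cl_def blinfun.bilinear_simps)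
      then have "norm (cl ?L - cl L) \<le> norm B * norm (?L - L)" by (simp add: norm_blinfun_compose)
      also have "\<dots> \<le> norm B * (g * ?n)" by (rule mult_left_mono[OF LL]) simp
      finally show ?thesis by (simp add: h_def mult.assoc)
    qed
    have e2: "(norm (cl ?L - cl L))\<^sup>2 \<le> h\<^sup>2 * ?n\<^sup>2" using power_mono[OF e, of 2] by (simp add: power_mult_distrib)
    have small: "4 * c * (norm (cl ?L - cl L))\<^sup>2 \<le> 1"
    proof -
      have "4 * c * (norm (cl ?L - cl L))\<^sup>2 \<le> 4 * c * (h\<^sup>2 * ?n\<^sup>2)" using e2 c by (intro mult_left_mono) auto
      also have "\<dots> = (2 * sqrt c * h * ?n)\<^sup>2" using c by (simp add: power_mult_distrib)
      also have "\<dots> \<le> 1\<^sup>2"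
      proof (rule power_mono)
        have "2 * sqrt c * h * ?n \<le> 2 * sqrt c * h * \<delta>" using n c h by (intro mult_left_mono) auto
        then show "2 * sqrt c * h * ?n \<le> 1" using \<delta>(3) by linarith
      qed (use c h in auto)
      finally show ?thesis by simp
    qed
    have nL: "norm ?L \<le> l"
    proof -
      have "norm ?L \<le> norm L + norm (?L - L)" by (metis add.commute diff_add_cancel norm_triangle_ineq)
      also have "norm (?L - L) \<le> g * 1" using n \<delta>(2) g by (intro order_trans[OF LL] mult_left_mono) auto
      finally show ?thesis by (simp add: l_def)
    qed
    let ?f = "\<lambda>t \<omega>. feedback L Z t \<omega> - feedback ?L Z' t \<omega>"
    have ct: "AE \<omega> in M. continuous_on {0..} (\<lambda>t. Z t \<omega>)" "AE \<omega> in M. continuous_on {0..} (\<lambda>t. Z' t \<omega>)"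
      using Z Z' by (simp_all add: solves_def)
    have "AE \<omega> in M. (LBINT t:{0<..<T}. ?f t \<omega> \<bullet> ?f t \<omega>) \<le> k * ?n\<^sup>2 * (LBINT t:{0..T}. (norm (Z t \<omega>))\<^sup>2)"
      using ct pert[OF small T Z Z']
    proof eventually_elim
      case (elim \<omega>)
      let ?I = "LBINT t:{0..T}. (norm (Z t \<omega>))\<^sup>2"
      have I: "0 \<le> ?I" by (simp add: set_lebesgue_integral_def)
      have zc: "continuous_on {0..T} (\<lambda>t. Z t \<omega>)" and zc': "continuous_on {0..T} (\<lambda>t. Z' t \<omega>)"
        using elim by (auto elim: continuous_on_subset)
      have i1: "set_integrable lborel {0..T} (\<lambda>t. (norm (Z t \<omega>))\<^sup>2)"
        by (intro borel_integrable_atLeastAtMost' continuous_intros zc)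
      have i2: "set_integrable lborel {0..T} (\<lambda>t. (norm (Z' t \<omega> - Z t \<omega>))\<^sup>2)"
        by (intro borel_integrable_atLeastAtMost' continuous_intros zc zc')
      have "(LBINT t:{0<..<T}. ?f t \<omega> \<bullet> ?f t \<omega>) = (LBINT t:{0..T}. ?f t \<omega> \<bullet> ?f t \<omega>)"
        by (rule set_integral_discrete_difference[where X = "{0, T}"]) auto
      also have "\<dots> \<le> (LBINT t:{0..T}. 2 * l\<^sup>2 * (norm (Z' t \<omega> - Z t \<omega>))\<^sup>2 + 2 * (g\<^sup>2 * ?n\<^sup>2) * (norm (Z t \<omega>))\<^sup>2)"
      proof (rule set_integral_mono)
        show "set_integrable lborel {0..T} (\<lambda>t. ?f t \<omega> \<bullet> ?f t \<omega>)"
          unfolding feedback_def by (intro borel_integrable_atLeastAtMost' continuous_intros zc zc')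
        show "set_integrable lborel {0..T} (\<lambda>t. 2 * l\<^sup>2 * (norm (Z' t \<omega> - Z t \<omega>))\<^sup>2 + 2 * (g\<^sup>2 * ?n\<^sup>2) * (norm (Z t \<omega>))\<^sup>2)"
          using i1 i2 by (intro set_integral_add set_integrable_mult_right)
        fix t
        let ?D = "Z' t \<omega> - Z t \<omega>"
        have "?f t \<omega> = ?L ?D + (?L - L) (Z t \<omega>)" by (simp add: feedback_def blinfun.bilinear_simps)
        then have "?f t \<omega> \<bullet> ?f t \<omega> \<le> 2 * (norm (?L ?D))\<^sup>2 + 2 * (norm ((?L - L) (Z t \<omega>)))\<^sup>2"
          using norm_add_square_le[of "?L ?D" "(?L - L) (Z t \<omega>)"] by (simp add: power2_norm_eq_inner)
        also have "(norm (?L ?D))\<^sup>2 \<le> (l * norm ?D)\<^sup>2"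
          by (intro power_mono order_trans[OF norm_blinfun] mult_right_mono nL) auto
        also have "(norm ((?L - L) (Z t \<omega>)))\<^sup>2 \<le> ((g * ?n) * norm (Z t \<omega>))\<^sup>2"
          by (intro power_mono order_trans[OF norm_blinfun] mult_right_mono LL) auto
        finally show "?f t \<omega> \<bullet> ?f t \<omega> \<le> 2 * l\<^sup>2 * (norm ?D)\<^sup>2 + 2 * (g\<^sup>2 * ?n\<^sup>2) * (norm (Z t \<omega>))\<^sup>2"
          by (simp add: power_mult_distrib)
      qed
      also have "\<dots> = 2 * l\<^sup>2 * (LBINT t:{0..T}. (norm (Z' t \<omega> - Z t \<omega>))\<^sup>2) + 2 * (g\<^sup>2 * ?n\<^sup>2) * ?I"
        using set_integral_add(2)[OF set_integrable_mult_right set_integrable_mult_right, OF i2 i1]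
        by (simp only: set_integral_mult_right)
      also have "\<dots> \<le> 2 * l\<^sup>2 * (4 * c * (h\<^sup>2 * ?n\<^sup>2) * ?I) + 2 * (g\<^sup>2 * ?n\<^sup>2) * ?I"
      proof (rule add_right_mono, rule mult_left_mono)
        have "4 * c * (norm (cl ?L - cl L))\<^sup>2 * ?I \<le> 4 * c * (h\<^sup>2 * ?n\<^sup>2) * ?I"
          using e2 c I by (intro mult_right_mono mult_left_mono) auto
        then show "(LBINT t:{0..T}. (norm (Z' t \<omega> - Z t \<omega>))\<^sup>2) \<le> 4 * c * (h\<^sup>2 * ?n\<^sup>2) * ?I" using elim by linarith
      qed simp
      also have "\<dots> = k * ?n\<^sup>2 * ?I" by (simp add: k_def algebra_simps)
      finally show ?case .
    qed
    note ae = this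
    note en = mean_energy_le[OF stableL \<xi> Z T mz(2)[OF Z]]
    have "L2_inner M T ?f ?f \<le> (\<integral>\<omega>. k * ?n\<^sup>2 * (LBINT t:{0..T}. (norm (Z t \<omega>))\<^sup>2) \<partial>M)"
      unfolding L2_inner_def
    proof (rule integral_mono_AE'[OF _ ae])
      show "integrable M (\<lambda>\<omega>. k * ?n\<^sup>2 * (LBINT t:{0..T}. (norm (Z t \<omega>))\<^sup>2))" using en(1) by simp
      show "AE \<omega> in M. 0 \<le> k * ?n\<^sup>2 * (LBINT t:{0..T}. (norm (Z t \<omega>))\<^sup>2)"
        by (intro AE_I2 mult_nonneg_nonneg k zero_le_power2) (simp add: set_lebesgue_integral_def)
    qed
    also have "\<dots> = k * ?n\<^sup>2 * (\<integral>\<omega>. (LBINT t:{0..T}. (norm (Z t \<omega>))\<^sup>2) \<partial>M)" by simp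
    also have "\<dots> \<le> k * ?n\<^sup>2 * (mz * T)" using en(2) k by (intro mult_left_mono mult_nonneg_nonneg) auto
    finally have "L2_norm M T ?f \<le> sqrt (k * ?n\<^sup>2 * (mz * T))" unfolding L2_norm_def by (rule real_sqrt_le_mono)
    also have "\<dots> = sqrt (k * mz) * ?n * sqrt T" by (simp add: real_sqrt_mult)
    finally have "T powr (- 1/2) * L2_norm M T ?f \<le> T powr (- 1/2) * (sqrt (k * mz) * ?n * sqrt T)"
      by (rule mult_left_mono) simp
    also have "\<dots> = sqrt (k * mz) * ?n"
      using T by (simp add: powr_minus powr_half_sqrt field_simps)
    also have "\<dots> \<le> (sqrt (k * mz) + 1) * ?n" by (intro mult_right_mono) auto
    finally show "T powr (- 1/2) * L2_norm M T ?f \<le> (sqrt (k * mz) + 1) * ?n" .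
  qed (rule \<delta>(1))
qed

end

theorem proposition5p2:
  fixes M :: "'w measure" and F :: "real \<Rightarrow> 'w measure" and W :: "real \<Rightarrow> 'w \<Rightarrow> real^'d"
    and \<xi> :: "'w \<Rightarrow> 'x::euclidean_space"
    and A :: "'x \<Rightarrow>\<^sub>L 'x" and B :: "(real^'m) \<Rightarrow>\<^sub>L 'x" and K :: "(real^'d) \<Rightarrow>\<^sub>L 'x"
    and C :: "'x \<Rightarrow>\<^sub>L 'h::{real_inner, complete_space}"
    and R :: "real^'m^'m" and \<omega>\<^sub>0 \<nu> :: real
  assumes "prob_space M" and "filtration_on M F" and "wiener_process M F W"
    and "\<xi> \<in> borel_measurable (F 0)" and "integrable M (\<lambda>\<omega>. (norm (\<xi> \<omega>))\<^sup>2)"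
    and "\<omega>\<^sub>0 > 0" and "\<nu> \<ge> 1" and "\<And>t. t \<ge> 0 \<Longrightarrow> norm (op_exp (t *\<^sub>R A)) \<le> \<nu> * exp (- \<omega>\<^sub>0 * t)"
    and "observable A C" and "symmetric_pos_def_matrix R"
  shows "(\<exists>!P. pos_def P \<and> riccati A B C R P) \<and>
    (\<forall>k. pos_semidef (P_seq A B C R k) \<and> lyapunov A B C R (L_seq A B C R k) (P_seq A B C R k) \<and>
       (\<forall>Q. lyapunov A B C R (L_seq A B C R k) Q \<longrightarrow> Q = P_seq A B C R k)) \<and>
    (\<forall>P. pos_def P \<and> riccati A B C R P \<longrightarrow>
       (\<exists>Z. closed_loop M F W \<xi> A B K (gain B R P) Z) \<and>
       (\<forall>Z. closed_loop M F W \<xi> A B K (gain B R P) Z \<longrightarrow>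
          optimal_control M F W \<xi> A B K C R (feedback (gain B R P) Z) Z) \<and>
       P_seq A B C R \<longlonglongrightarrow> P \<and>
       (\<forall>k. op_le P (P_seq A B C R k) \<and> op_le (P_seq A B C R (Suc k)) (P_seq A B C R k)) \<and>
       (\<exists>c>0. \<forall>k. norm (P_seq A B C R (Suc k) - P) \<le> c * (norm (P_seq A B C R k - P))\<^sup>2) \<and>
       (\<forall>k. \<exists>Z. closed_loop M F W \<xi> A B K (gain B R (P_seq A B C R k)) Z) \<and>
       (\<exists>c>0. \<exists>\<delta>>0. \<forall>k\<ge>1. norm (P - P_seq A B C R k) < \<delta> \<longrightarrow>
          (\<forall>T>0. \<forall>Z Z\<^sub>k.
             closed_loop M F W \<xi> A B K (gain B R P) Z \<longrightarrow>
             closed_loop M F W \<xi> A B K (gain B R (P_seq A B C R k)) Z\<^sub>k \<longrightarrow>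
             T powr (- 1/2) *
               L2_norm M T (\<lambda>t \<omega>. feedback (gain B R P) Z t \<omega>
                                   - feedback (gain B R (P_seq A B C R k)) Z\<^sub>k t \<omega>)
             \<le> c * (norm (P_seq A B C R k - P_seq A B C R (k - 1)))\<^sup>2)))"
proof -
  define w where "w t \<omega> = K (dyadic_modification W t \<omega>)" for t \<omega>
  let ?\<kappa> = "(norm K)\<^sup>2 * real CARD('d)"
  have noise: "noise M F w ?\<kappa>" and w: "AE \<omega> in M. \<forall>t\<ge>0. w t \<omega> = K (W t \<omega>)"
    using wiener_imp_noise[OF assms(1-3), of K] by (simp_all add: w_def[abs_def])
  interpret noise M F w ?\<kappa> by (rule noise)
  interpret lqr A B C R
    by unfold_locales (rule stable_of_exponential_bound[OF assms(6,8)] assms(9,10); simp)+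
  have "\<exists>!P. pos_def P \<and> riccati A B C R P"
    by (metis riccati_solution_exists riccati_unique)
  moreover have "pos_semidef (Pk k) \<and> lyapunov A B C R (Lk k) (Pk k) \<and>
       (\<forall>Q. lyapunov A B C R (Lk k) Q \<longrightarrow> Q = Pk k)" for k
    using pos_def_imp_pos_semidef[OF Pk_pos_def] Pk_residual Pk_unique by (auto simp: lyapunov_iff_residual)
  moreover have closed_loop_exists: "\<exists>Z. closed_loop M F W \<xi> A B K L Z" for L
    using solves_exists[OF assms(4)] by (simp add: closed_loop_iff_solves[OF w])
  moreover have "(\<forall>Z. closed_loop M F W \<xi> A B K (gain B R P) Z \<longrightarrow>
          optimal_control M F W \<xi> A B K C R (feedback (gain B R P) Z) Z) \<and>
       Pk \<longlonglongrightarrow> P \<and> (\<forall>k. op_le P (Pk k) \<and> op_le (Pk (Suc k)) (Pk k)) \<and>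
       (\<exists>c>0. \<forall>k. norm (Pk (Suc k) - P) \<le> c * (norm (Pk k - P))\<^sup>2) \<and>
       (\<exists>c>0. \<exists>\<delta>>0. \<forall>k\<ge>1. norm (P - Pk k) < \<delta> \<longrightarrow>
          (\<forall>T>0. \<forall>Z Z\<^sub>k. closed_loop M F W \<xi> A B K (gain B R P) Z \<longrightarrow>
             closed_loop M F W \<xi> A B K (gain B R (Pk k)) Z\<^sub>k \<longrightarrow>
             T powr (- 1/2) * L2_norm M T (\<lambda>t \<omega>. feedback (gain B R P) Z t \<omega> - feedback (gain B R (Pk k)) Z\<^sub>k t \<omega>)
             \<le> c * (norm (Pk k - Pk (k - 1)))\<^sup>2))"
    if P: "pos_def P" "riccati A B C R P" for P
  proof -
    interpret lqr_noise A B C R M F w ?\<kappa> \<xi> P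
      by unfold_locales (rule assms P)+
    obtain c \<delta> where c: "c > 0" and \<delta>: "\<delta> > 0" and diff: "\<And>X Z Z' T. norm (P - X) < \<delta> \<Longrightarrow> T > 0 \<Longrightarrow>
      solves (cl L) (\<lambda>_ _. 0) \<xi> Z \<Longrightarrow> solves (cl (gain B R X)) (\<lambda>_ _. 0) \<xi> Z' \<Longrightarrow>
      T powr (- 1/2) * L2_norm M T (\<lambda>t \<omega>. feedback L Z t \<omega> - feedback (gain B R X) Z' t \<omega>) \<le> c * norm (X - P)"
      using feedback_difference by blast
    obtain c' \<delta>' where c': "c' > 0" and \<delta>': "\<delta>' > 0" and
      err: "\<And>k. k \<ge> 1 \<Longrightarrow> norm (P - Pk k) < \<delta>' \<Longrightarrow> norm (Pk k - P) \<le> c' * (norm (Pk k - Pk (k - 1)))\<^sup>2"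
      using error_le_increment[OF P] by blast
    have "T powr (- 1/2) * L2_norm M T (\<lambda>t \<omega>. feedback L Z t \<omega> - feedback (gain B R (Pk k)) Z\<^sub>k t \<omega>)
             \<le> c * c' * (norm (Pk k - Pk (k - 1)))\<^sup>2"
      if k: "k \<ge> 1" "norm (P - Pk k) < min \<delta> \<delta>'" and T: "T > 0"
        and cl: "closed_loop M F W \<xi> A B K L Z" "closed_loop M F W \<xi> A B K (gain B R (Pk k)) Z\<^sub>k" for k T Z Z\<^sub>k
    proof -
      have "T powr (- 1/2) * L2_norm M T (\<lambda>t \<omega>. feedback L Z t \<omega> - feedback (gain B R (Pk k)) Z\<^sub>k t \<omega>) \<le> c * norm (Pk k - P)"
        using k cl T by (intro diff) (simp_all add: closed_loop_iff_solves[OF w] cl_def)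
      also have "\<dots> \<le> c * (c' * (norm (Pk k - Pk (k - 1)))\<^sup>2)"
        using k c by (intro mult_left_mono err) auto
      finally show ?thesis by (simp add: mult.assoc)
    qed
    then have "\<exists>c>0. \<exists>\<delta>>0. \<forall>k\<ge>1. norm (P - Pk k) < \<delta> \<longrightarrow>
          (\<forall>T>0. \<forall>Z Z\<^sub>k. closed_loop M F W \<xi> A B K (gain B R P) Z \<longrightarrow>
             closed_loop M F W \<xi> A B K (gain B R (Pk k)) Z\<^sub>k \<longrightarrow>
             T powr (- 1/2) * L2_norm M T (\<lambda>t \<omega>. feedback (gain B R P) Z t \<omega> - feedback (gain B R (Pk k)) Z\<^sub>k t \<omega>)
             \<le> c * (norm (Pk k - Pk (k - 1)))\<^sup>2)"
      using c c' \<delta> \<delta>' by (intro exI[of _ "c * c'"] exI[of _ "min \<delta> \<delta>'"] conjI) auto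
    then show ?thesis
      using riccati_feedback_optimal[OF w] Pk_tendsto[OF P] P_le_Pk[OF P] Pk_decreasing quadratic_convergence[OF P]
      by blast
  qed
  ultimately show ?thesis by blast
qed

end
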